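(* Let $\xi \in \mathcal{D}_1$ and let $N$, $M$ be arbitrary non-negative integers. Let $\mu$ and $\nu$ be complex numbers satisfying $|\Re\mu | <\min \left( N + \frac{1}{2},M + \frac{1}{2} \right)$ and $\Re\nu > \max \left( N - \frac{1}{2},M - \frac{1}{2} \right)$. Then there exist remainder terms $R_N^{(P1)} (\xi ,\mu ,\nu )$ and $R_M^{(P2)} (\xi ,\mu ,\nu )$ such that $$\begin{aligned} P_\nu ^\mu (\cosh \xi ) =\; & \frac{e^{ \left(\nu+\frac{1}{2} \right)\xi}}{\Gamma (\nu - \mu + 1)\sqrt{2\pi \sinh \xi}} \left( \sum_{n = 0}^{N - 1} a_n (\mu ) \Gamma \left( \nu - n + \tfrac{1}{2} \right) \left( \frac{-e^{ - \xi } }{\sinh \xi } \right)^n + R_N^{(P1)} (\xi ,\mu ,\nu ) \right)\\ & + \frac{C(\xi ,\mu ) e^{- \left(\nu+\frac{1}{2} \right)\xi}}{\Gamma (\nu - \mu + 1)\sqrt{2\pi \sinh \xi}} \left( \sum_{m = 0}^{M - 1} a_m (\mu ) \Gamma \left( \nu - m + \tfrac{1}{2} \right)\left( \frac{e^\xi }{\sinh \xi} \right)^m + R_M^{(P2)} (\xi ,\mu ,\nu ) \right),\end{aligned}$$ and the remainder terms satisfy the estimates $$\begin{aligned}\left| R_N^{(P1)} (\xi ,\mu ,\nu ) \right| \le \; & \left|\frac{ \cos (\pi \mu ) }{ \cos (\pi \Re\mu ) }\right|\left| a_N (\Re\mu ) \right| \Gamma \left( \Re\nu - N + \tfrac{1}{2}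 \right) \left| \frac{e^{ - \xi } }{\sinh \xi } \right|^N \\ & \times \begin{cases} 1 & \text{if } \Re (e^{2\xi } ) \le 1, \\ \min\left(\left| 1 - e^{ - 2\xi } \right|\left| \csc (2\Im\xi ) \right|,\,1 + \chi\left(N+\tfrac{1}{2}\right)\right) & \text{if } \Re (e^{2\xi } ) > 1, \end{cases}\end{aligned}$$ and $$\left| R_M^{(P2)} (\xi ,\mu ,\nu ) \right| \le \left|\frac{\cos (\pi \mu )}{\cos (\pi \Re\mu )}\right|\left|a_M (\Re\mu )\right|\Gamma \left( \Re\nu - M + \tfrac{1}{2} \right)\left| \frac{e^\xi}{\sinh \xi } \right|^M .$$ If $2\Re\mu $ is an odd integer, then the limiting values have to be taken in these bounds. The square roots are positive for positive real $\xi$ and are defined by continuity elsewhere. In addition, $R_M^{(P2)} (\xi ,\mu ,\nu )$ does not exceed the corresponding first neglected term $a_M(\mu)\Gamma(\nu-M+\frac12)\left(\frac{e^\xi}{\sinh\xi}\right)^M$ in absolute value and has the same sign, provided that $\xi$ is positive, $\mu$ and $\nu$ are real, $|\mu| <M + \frac{1}{2}$ and $\nu > M - \frac{1}{2}$.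
   Context: $\mathcal{D}_1=\{\xi\in\mathbb{C} : \Re \xi>0,\ |\Im \xi |<\pi\}$; $\cosh$ maps $\mathcal{D}_1$ biholomorphically onto $\mathbb{C}\setminus(-\infty,1]$. The associated Legendre function of the first kind is $P_\nu ^\mu (z) = \left(\frac{z + 1}{z - 1}\right)^{\mu /2}\mathbf{F}\left(\nu+1,-\nu;1-\mu;\frac{1-z}{2}\right)$ for $z\in\mathbb{C}\setminus(-\infty,1]$, where the power has its principal branch (positive base for $z>1$) and $\mathbf{F}(a,b;c;w)$ is the regularised hypergeometric function, $\mathbf{F}(a,b;c;w)=\sum_{n\ge 0}\frac{(a)_n(b)_n}{\Gamma(c+n)\,n!}w^n$ for $|w|<1$, continued analytically to $w\in\mathbb{C}\setminus[1,+\infty)$. $a_n (\mu ) = \frac{(4\mu ^2 - 1^2 )(4\mu ^2 - 3^2 ) \cdots (4\mu ^2 - (2n - 1)^2 )}{8^n n!}=\frac{(\frac12-\mu)_n(\frac12+\mu)_n}{(-2)^n n!}$, with $(\cdot)_n$ the Pochhammer symbol. $C(\xi ,\mu ) = \sin (\pi \mu )$ if $\xi > 0$, and $C(\xi,\mu)=\pm i\, e^{ \mp \pi i\mu }$ if $0<\pm \Im\xi < \pi$. $\chi(p)= \frac{\sqrt\pi\,\Gamma\left(\frac{p}{2}+1\right)}{\Gamma\left(\frac{p}{2}+\frac{1}{2}\right)}$ for $p>0$. "Limiting value" means that $|a_N(\Re\mu)|/|\cos(\pi\Re\mu)|$ is replaced by $\lim_{x\to\Re\mu}|a_N(x)|/|\cos(\pi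 x)|$. When $\sin(2\Im\xi)=0$, $|\csc(2\Im\xi)|$ is read as $+\infty$. *)

theory Defs
  imports "HOL-Complex_Analysis.Complex_Analysis"
begin

definition D1 :: "complex set" where
  "D1 = {\<xi>. Re \<xi> > 0 \<and> \<bar>Im \<xi>\<bar> < pi}"

definition slit_plane :: "complex set" where
  "slit_plane = - (complex_of_real ` {1..})"

text \<open>
  \<open>hyp2F1_reg\<close> is the analytic continuation of the regularised hypergeometric series
  from the unit disc to the plane cut along \<open>[1, \<infinity>)\<close>. By the lemma
  \<open>slit_plane_continuation_unique\<close> below, the choice operator only affects
  values on the cut.
\<close>

definition hyp2F1_reg_series :: "complex \<Rightarrow> complex \<Rightarrow> complex \<Rightarrow> complex \<Rightarrow> complex" where
  "hyp2F1_reg_series a b c w =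
     (\<Sum>n. pochhammer a n * pochhammer b n / fact n * rGamma (c + of_nat n) * w ^ n)"

definition hyp2F1_reg :: "complex \<Rightarrow> complex \<Rightarrow> complex \<Rightarrow> complex \<Rightarrow> complex" where
  "hyp2F1_reg a b c =
     (SOME F. F holomorphic_on slit_plane \<and> (\<forall>w. norm w < 1 \<longrightarrow> F w = hyp2F1_reg_series a b c w))"

text \<open>For \<open>z\<close> off the cut \<open>(-\<infinity>, 1]\<close> the base of the power is off \<open>(-\<infinity>, 0]\<close>.\<close>

definition legendre_P :: "complex \<Rightarrow> complex \<Rightarrow> complex \<Rightarrow> complex" where
  "legendre_P \<nu> \<mu> z =
     ((z + 1) / (z - 1)) powr (\<mu> / 2) * hyp2F1_reg (\<nu> + 1) (- \<nu>) (1 - \<mu>) ((1 - z) / 2)"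

definition a_coeff :: "nat \<Rightarrow> 'a :: field_char_0 \<Rightarrow> 'a" where
  "a_coeff n \<mu> = (\<Prod>k=1..n. 4 * \<mu>\<^sup>2 - (2 * of_nat k - 1)\<^sup>2) / (8 ^ n * fact n)"

text \<open>On \<open>D1\<close>, \<open>Im \<xi> = 0\<close> means that \<open>\<xi>\<close> is a positive real.\<close>

definition C_coeff :: "complex \<Rightarrow> complex \<Rightarrow> complex" where
  "C_coeff \<xi> \<mu> =
     (if Im \<xi> = 0 then sin (of_real pi * \<mu>)
      else if Im \<xi> > 0 then \<i> * exp (- (of_real pi * \<i> * \<mu>))
      else - \<i> * exp (of_real pi * \<i> * \<mu>))"

definition chi :: "real \<Rightarrow> real" where
  "chi p = sqrt pi * Gamma (p / 2 + 1) / Gamma (p / 2 + 1 / 2)"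

text \<open>\<open>|a\<^sub>N(x)| / |cos(\<pi> x)|\<close>, with its limiting value where the cosine vanishes.\<close>

definition a_cos_ratio :: "nat \<Rightarrow> real \<Rightarrow> real" where
  "a_cos_ratio N x =
     (if \<exists>k::int. odd k \<and> 2 * x = of_int k
      then Lim (at x) (\<lambda>t. \<bar>a_coeff N t\<bar> / \<bar>cos (pi * t)\<bar>)
      else \<bar>a_coeff N x\<bar> / \<bar>cos (pi * x)\<bar>)"

text \<open>The innermost case is the minimum with \<open>|csc (2 Im \<xi>)| = +\<infinity>\<close>.\<close>

definition P1_factor :: "nat \<Rightarrow> complex \<Rightarrow> real" where
  "P1_factor N \<xi> =
     (if Re (exp (2 * \<xi>)) \<le> 1 then 1
      else if sin (2 * Im \<xi>) = 0 then 1 + chi (real N + 1 / 2)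
      else min (norm (1 - exp (- 2 * \<xi>)) * \<bar>1 / sin (2 * Im \<xi>)\<bar>) (1 + chi (real N + 1 / 2)))"

definition P1_term :: "nat \<Rightarrow> complex \<Rightarrow> complex \<Rightarrow> complex \<Rightarrow> complex" where
  "P1_term n \<xi> \<mu> \<nu> = a_coeff n \<mu> * Gamma (\<nu> - of_nat n + 1 / 2) * (- exp (- \<xi>) / sinh \<xi>) ^ n"

definition P2_term :: "nat \<Rightarrow> complex \<Rightarrow> complex \<Rightarrow> complex \<Rightarrow> complex" where
  "P2_term n \<xi> \<mu> \<nu> = a_coeff n \<mu> * Gamma (\<nu> - of_nat n + 1 / 2) * (exp \<xi> / sinh \<xi>) ^ n"

lemma open_slit_plane: "open slit_plane"
proof -
  have "closed (complex_of_real ` {1..})"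
  proof -
    have "complex_of_real ` {1..} = {z. Re z \<ge> 1} \<inter> \<real>"
    proof (intro equalityI subsetI)
      fix z assume "z \<in> {z. Re z \<ge> 1} \<inter> \<real>"
      then show "z \<in> complex_of_real ` {1..}"
        by (intro image_eqI[of _ _ "Re z"]) (simp_all add: of_real_Re)
    qed auto
    then show ?thesis
      by (simp add: closed_Int closed_halfspace_Re_ge closed_complex_Reals)
  qed
  then show ?thesis
    by (simp add: slit_plane_def open_Compl)
qed

lemma connected_slit_plane: "connected slit_plane"
proof (rule starlike_imp_connected)
  have "closed_segment 0 z \<subseteq> slit_plane" if z: "z \<in> slit_plane" for z
  proof
    fix w assume "w \<in> closed_segment 0 z"
    then obtain u where u: "0 \<le> u" "u \<le> 1" "w = of_real u * z"
      by (auto simp: in_segment scaleR_conv_of_real)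
    show "w \<in> slit_plane"
    proof (rule ccontr)
      assume "w \<notin> slit_plane"
      then obtain t where t: "t \<ge> 1" "of_real u * z = of_real t"
        using u by (auto simp: slit_plane_def)
      then have "u > 0" using u by (cases "u = 0") auto
      then have "z = of_real (t / u)" "t / u \<ge> 1"
        using t u by (auto simp: field_simps)
      then have "z \<in> complex_of_real ` {1..}"
        by (intro image_eqI[of _ _ "t / u"]) simp_all
      then show False using z by (simp add: slit_plane_def)
    qed
  qed
  moreover have "0 \<in> slit_plane"
    by (auto simp: slit_plane_def)
  ultimately show "starlike slit_plane"
    unfolding starlike_def by blast
qed

lemma ball_subset_slit_plane: "ball 0 1 \<subseteq> slit_plane"
  by (auto simp: slit_plane_def)

lemma slit_plane_continuation_unique:
  assumes "F holomorphic_on slit_plane" "G holomorphic_on slit_plane"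
    and "\<And>w. norm w < 1 \<Longrightarrow> F w = G w" and "w \<in> slit_plane"
  shows "F w = G w"
proof (rule analytic_continuation_open[OF open_ball open_slit_plane _ connected_slit_plane
        ball_subset_slit_plane assms(1,2) _ assms(4)])
  show "F z = G z" if "z \<in> ball 0 1" for z
    using that assms(3) by simp
qed simp

text \<open>
  The principal square root is the branch of \<open>sqrt (2 \<pi> sinh \<xi>)\<close> on \<open>D1\<close> that is
  continuous and positive for positive \<open>\<xi>\<close>.
\<close>

lemma sinh_D1_notin_nonpos_Reals:
  assumes "\<xi> \<in> D1"
  shows "2 * of_real pi * sinh \<xi> \<notin> \<real>\<^sub>\<le>\<^sub>0"
proof
  assume *: "2 * of_real pi * sinh \<xi> \<in> \<real>\<^sub>\<le>\<^sub>0"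
  have \<xi>: "Re \<xi> > 0" "\<bar>Im \<xi>\<bar> < pi" using assms by (auto simp: D1_def)
  have Re: "Re (sinh \<xi>) = sinh (Re \<xi>) * cos (Im \<xi>)"
    and Im: "Im (sinh \<xi>) = cosh (Re \<xi>) * sin (Im \<xi>)"
    by (simp_all add: sinh_def cosh_def Re_exp Im_exp algebra_simps)
  have "2 * pi * Re (sinh \<xi>) \<le> 0" "2 * pi * Im (sinh \<xi>) = 0"
    using * by (simp_all add: complex_nonpos_Reals_iff)
  then have "sinh (Re \<xi>) * cos (Im \<xi>) \<le> 0" "cosh (Re \<xi>) * sin (Im \<xi>) = 0"
    unfolding Re Im using pi_gt_zero by (simp_all add: mult_le_0_iff)
  moreover have "sinh (Re \<xi>) > 0" "cosh (Re \<xi>) > 0"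
    using \<xi> by simp_all
  ultimately have "cos (Im \<xi>) \<le> 0" "sin (Im \<xi>) = 0"
    by (simp_all add: mult_le_0_iff)
  moreover have "Im \<xi> = 0"
    by (rule sin_eq_0_pi) (use \<xi> \<open>sin (Im \<xi>) = 0\<close> in linarith)+
  ultimately show False by simp
qed

lemma continuous_on_sqrt_sinh: "continuous_on D1 (\<lambda>\<xi>. csqrt (2 * of_real pi * sinh \<xi>))"
proof (rule holomorphic_on_imp_continuous_on, rule holomorphic_on_csqrt')
  show "(\<lambda>\<xi>. 2 * of_real pi * sinh \<xi>) holomorphic_on D1"
    unfolding sinh_field_def by (intro holomorphic_intros) simp
qed (rule sinh_D1_notin_nonpos_Reals)

lemma csqrt_sinh_of_real:
  assumes "x > 0"
  shows "csqrt (2 * of_real pi * sinh (of_real x)) = of_real (sqrt (2 * pi * sinh x))"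
proof -
  have "2 * of_real pi * sinh (complex_of_real x) = of_real (2 * pi * sinh x)"
    by (simp add: sinh_def exp_of_real scaleR_conv_of_real flip: of_real_minus)
  moreover have "2 * pi * sinh x \<ge> 0"
    using assms by simp
  ultimately show ?thesis
    by (metis Im_complex_of_real Re_complex_of_real csqrt_of_real_nonneg)
qed

end

theory Submission
  imports Defs "HOL-Real_Asymp.Real_Asymp"
begin

text \<open>
  The remainders are iterated Laplace and beta integrals of the terminant
  \<open>q \<mapsto> \<integral> u powr (N - 1/2) * exp (- u) / (1 + u * q) du\<close>. Expanding the geometric kernel gives
  the finite sums; elementary lower bounds for \<open>|1 + u q|\<close>, or near the cut a Laplace
  representation of the kernel, give the error bounds. For \<open>N = 0\<close> and small real \<open>\<mu>\<close>
  the remainder collapses to an Euler integral along a ray, and Cauchy's theorem in the half strip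
  \<open>Re t < 0\<close>, \<open>|Im t| < b\<close> expresses Mehler's integral for the hypergeometric function at
  \<open>\<xi> = \<plusminus>ib\<close> as the difference of two such rays. Analytic continuation in \<open>\<mu>\<close> and then
  in \<open>\<xi>\<close> yields the expansion off the real axis; on the positive axis one averages the two
  boundary values.
\<close>

section \<open>Integrals depending on a parameter\<close>

lemma set_integral_cong:
  assumes "\<And>x. x \<in> A \<Longrightarrow> f x = g x"
  shows "(LINT x:A|M. f x) = (LINT x:A|M. g x)"
  unfolding set_lebesgue_integral_def
  by (rule Bochner_Integration.integral_cong) (use assms in \<open>auto simp: indicator_def\<close>)

lemma set_integrable_transform:
  assumes "set_integrable M A f" "\<And>x. x \<in> A \<Longrightarrow> f x = g x"
  shows "set_integrable M A g"
  using assms set_integrable_cong[of M M A A f g] by simp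

lemma set_borel_measurable_continuous_on:
  fixes f :: "real \<Rightarrow> 'b::real_normed_vector"
  assumes "A \<in> sets borel" "continuous_on A f"
  shows "set_borel_measurable lborel A f"
  using set_measurable_continuous_on[OF assms] by (simp add: set_borel_measurable_def)

lemma set_integrable_continuous_bound:
  fixes f :: "real \<Rightarrow> 'b::euclidean_space" and g :: "real \<Rightarrow> real"
  assumes "A \<in> sets borel" "continuous_on A f" "set_integrable lborel A g"
    and "\<And>x. x \<in> A \<Longrightarrow> norm (f x) \<le> g x"
  shows "set_integrable lborel A f"
proof (rule set_integrable_bound[OF assms(3)])
  show "set_borel_measurable lborel A f"
    using assms(1,2) by (rule set_borel_measurable_continuous_on)
  show "AE x in lborel. x \<in> A \<longrightarrow> norm (f x) \<le> norm (g x)"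
    using assms(4) by (intro AE_I2) force
qed

lemma norm_set_integral_le:
  fixes f :: "'a \<Rightarrow> 'b::{banach, second_countable_topology}"
  assumes "set_integrable M A g" and "\<And>x. x \<in> A \<Longrightarrow> norm (f x) \<le> g x"
  shows "norm (LINT x:A|M. f x) \<le> (LINT x:A|M. g x)"
proof -
  have g_nonneg: "0 \<le> g x" if "x \<in> A" for x
    using assms(2)[OF that] norm_ge_zero order_trans by blast
  have "norm (LINT x:A|M. f x) \<le> (\<integral>x. norm (indicator A x *\<^sub>R f x) \<partial>M)"
    unfolding set_lebesgue_integral_def by (rule integral_norm_bound)
  also have "\<dots> \<le> (LINT x:A|M. g x)"
    unfolding set_lebesgue_integral_def
    by (rule integral_mono')
       (use assms g_nonneg in \<open>auto simp: set_integrable_def indicator_def\<close>)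
  finally show ?thesis .
qed

lemma set_integral_dominated_convergence:
  fixes f :: "'a \<Rightarrow> 'b::{banach, second_countable_topology}"
  assumes "set_integrable M A g"
    and "\<And>n. set_borel_measurable M A (s n)"
    and "\<And>n x. x \<in> A \<Longrightarrow> norm (s n x) \<le> g x"
    and "\<And>x. x \<in> A \<Longrightarrow> (\<lambda>n. s n x) \<longlonglongrightarrow> f x"
  shows "(\<lambda>n. LINT x:A|M. s n x) \<longlonglongrightarrow> (LINT x:A|M. f x)"
  unfolding set_lebesgue_integral_def
proof (rule integral_dominated_convergence[where w = "\<lambda>x. indicator A x *\<^sub>R g x"])
  have pointwise: "(\<lambda>n. indicator A x *\<^sub>R s n x) \<longlonglongrightarrow> indicator A x *\<^sub>R f x" for x
    using assms(4)[of x] by (auto simp: indicator_def)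
  show "(\<lambda>x. indicator A x *\<^sub>R f x) \<in> borel_measurable M"
    using pointwise by (rule borel_measurable_LIMSEQ_metric[rotated])
      (use assms(2) in \<open>simp add: set_borel_measurable_def\<close>)
  show "AE x in M. (\<lambda>n. indicator A x *\<^sub>R s n x) \<longlonglongrightarrow> indicator A x *\<^sub>R f x"
    using pointwise by simp
  show "AE x in M. norm (indicator A x *\<^sub>R s n x) \<le> indicator A x *\<^sub>R g x" for n
    using assms(3) by (intro AE_I2) (auto simp: indicator_def)
qed (use assms(1,2) in \<open>simp_all add: set_integrable_def set_borel_measurable_def\<close>)

lemma set_integral_dominated_convergence_at:
  fixes f :: "'b::first_countable_topology \<Rightarrow> 'a \<Rightarrow> 'c::{banach, second_countable_topology}"
  assumes "set_integrable M A g"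
    and "\<And>w. w \<in> S - {z} \<Longrightarrow> set_borel_measurable M A (f w)"
    and "\<And>w x. w \<in> S - {z} \<Longrightarrow> x \<in> A \<Longrightarrow> norm (f w x) \<le> g x"
    and "\<And>x. x \<in> A \<Longrightarrow> ((\<lambda>w. f w x) \<longlongrightarrow> l x) (at z within S)"
  shows "((\<lambda>w. LINT x:A|M. f w x) \<longlongrightarrow> (LINT x:A|M. l x)) (at z within S)"
proof (subst tendsto_at_iff_sequentially, intro allI impI)
  fix X assume X: "\<forall>i. X i \<in> S - {z}" "X \<longlonglongrightarrow> z"
  have "(\<lambda>n. LINT x:A|M. f (X n) x) \<longlonglongrightarrow> (LINT x:A|M. l x)"
  proof (rule set_integral_dominated_convergence[OF assms(1)])
    show "(\<lambda>n. f (X n) x) \<longlonglongrightarrow> l x" if "x \<in> A" for x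
      using assms(4)[OF that] X by (auto simp: tendsto_at_iff_sequentially o_def)
  qed (use assms(2,3) X(1) in auto)
  then show "((\<lambda>w. LINT x:A|M. f w x) \<circ> X) \<longlonglongrightarrow> (LINT x:A|M. l x)"
    by (simp add: o_def)
qed

lemma set_integrable_lborel_iff_absolutely_integrable:
  fixes f :: "real \<Rightarrow> 'b::euclidean_space"
  assumes "A \<in> sets borel" "continuous_on A f"
  shows "set_integrable lborel A f \<longleftrightarrow> f absolutely_integrable_on A"
proof -
  have "(\<lambda>x. indicator A x *\<^sub>R f x) \<in> borel_measurable lborel"
    using borel_measurable_continuous_on_indicator[OF assms] by simp
  then show ?thesis
    unfolding set_integrable_def by (rule integrable_completion[symmetric])
qed

lemma set_integral_substitution:
  fixes f :: "real \<Rightarrow> 'b::euclidean_space" and g :: "real \<Rightarrow> real"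
  assumes borel: "S \<in> sets borel" "T \<in> sets borel" and bij: "bij_betw g S T"
    and der: "\<And>x. x \<in> S \<Longrightarrow> (g has_field_derivative g' x) (at x)"
    and cont: "continuous_on S g'" "continuous_on T f"
    and int: "set_integrable lborel T f"
  shows "set_integrable lborel S (\<lambda>x. \<bar>g' x\<bar> *\<^sub>R f (g x))"
    and "(LINT x:S|lborel. \<bar>g' x\<bar> *\<^sub>R f (g x)) = (LINT y:T|lborel. f y)"
proof -
  have img: "g ` S = T" and inj: "inj_on g S"
    using bij by (auto simp: bij_betw_def)
  have "continuous_on S g"
    using der by (meson DERIV_isCont continuous_at_imp_continuous_on)
  then have cont_subst: "continuous_on S (\<lambda>x. \<bar>g' x\<bar> *\<^sub>R f (g x))"
    by (intro continuous_intros cont(1) continuous_on_compose2[OF cont(2)]) (use img in auto)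
  have "f absolutely_integrable_on g ` S \<and> integral (g ` S) f = integral T f"
    using int img set_integrable_lborel_iff_absolutely_integrable[OF borel(2) cont(2)] by simp
  then have henstock_kurzweil: "(\<lambda>x. \<bar>g' x\<bar> *\<^sub>R f (g x)) absolutely_integrable_on S"
      "integral S (\<lambda>x. \<bar>g' x\<bar> *\<^sub>R f (g x)) = integral T f"
    by (subst (asm) has_absolute_integral_change_of_variables_real[symmetric],
        use borel inj der in \<open>auto intro: has_field_derivative_at_within\<close>)+
  then show int_subst: "set_integrable lborel S (\<lambda>x. \<bar>g' x\<bar> *\<^sub>R f (g x))"
    using set_integrable_lborel_iff_absolutely_integrable[OF borel(1) cont_subst] by simp
  show "(LINT x:S|lborel. \<bar>g' x\<bar> *\<^sub>R f (g x)) = (LINT y:T|lborel. f y)"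
    using henstock_kurzweil(2) set_borel_integral_eq_integral(2)[OF int_subst]
      set_borel_integral_eq_integral(2)[OF int] by simp
qed

lemma
  fixes f :: "real \<Rightarrow> 'b::{banach, second_countable_topology}"
  assumes "c > 0"
  shows set_integrable_Ioi_scale:
      "set_integrable lborel {0<..} (\<lambda>x. f (c * x)) \<longleftrightarrow> set_integrable lborel {0<..} f"
    and set_integral_Ioi_scale:
      "(LINT x:{0<..}|lborel. f x) = c *\<^sub>R (LINT x:{0<..}|lborel. f (c * x))"
proof -
  have scaled: "(\<lambda>x. indicator {0<..} (0 + c * x) *\<^sub>R f (0 + c * x)) =
      (\<lambda>x. indicator {0<..} x *\<^sub>R f (c * x))"
    using assms by (auto simp: indicator_def zero_less_mult_iff)
  show "set_integrable lborel {0<..} (\<lambda>x. f (c * x)) \<longleftrightarrow> set_integrable lborel {0<..} f"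
    unfolding set_integrable_def scaled[symmetric]
    using assms by (subst lborel_integrable_real_affine_iff) auto
  show "(LINT x:{0<..}|lborel. f x) = c *\<^sub>R (LINT x:{0<..}|lborel. f (c * x))"
    unfolding set_lebesgue_integral_def scaled[symmetric]
    using assms by (subst lborel_integral_real_affine[of c _ 0]) auto
qed

lemma set_integrable_reflect:
  fixes f :: "real \<Rightarrow> 'b::{banach, second_countable_topology}"
  shows "set_integrable lborel {x. - x \<in> A} (\<lambda>x. f (- x)) \<longleftrightarrow> set_integrable lborel A f"
proof -
  have "indicator {x. - x \<in> A} x = (indicator A (- x) :: real)" for x :: real
    by (auto simp: indicator_def)
  then show ?thesis
    unfolding set_integrable_def
    using lborel_integrable_real_affine_iff[of "- 1" "\<lambda>x. indicator A x *\<^sub>R f x" 0] by simp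
qed

lemma set_integral_Fubini:
  fixes f :: "real \<Rightarrow> real \<Rightarrow> 'b::euclidean_space"
  assumes borel: "A \<in> sets borel" "B \<in> sets borel"
    and cont: "continuous_on (A \<times> B) (\<lambda>p. f (fst p) (snd p))"
    and inner: "\<And>x. x \<in> A \<Longrightarrow> set_integrable lborel B (f x)"
    and outer: "set_integrable lborel A (\<lambda>x. LINT y:B|lborel. norm (f x y))"
  shows "(LINT x:A|lborel. LINT y:B|lborel. f x y) = (LINT y:B|lborel. LINT x:A|lborel. f x y)"
proof -
  define F where "F p = indicator (A \<times> B) p *\<^sub>R f (fst p) (snd p)" for p
  have F_sections: "F (x, y) = indicator A x *\<^sub>R (indicator B y *\<^sub>R f x y)"
      "F (x, y) = indicator B y *\<^sub>R (indicator A x *\<^sub>R f x y)" for x y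
    by (auto simp: F_def indicator_def)
  have "F \<in> borel_measurable borel"
    unfolding F_def by (rule borel_measurable_continuous_on_indicator[OF _ cont])
      (use borel in \<open>auto simp: borel_prod[symmetric]\<close>)
  then have "F \<in> borel_measurable (lborel \<Otimes>\<^sub>M lborel)"
    by (simp add: lborel_prod)
  then have "integrable (lborel \<Otimes>\<^sub>M lborel) F"
  proof (rule lborel_pair.Fubini_integrable)
    have "(\<lambda>x. \<integral>y. norm (F (x, y)) \<partial>lborel) =
        (\<lambda>x. indicator A x *\<^sub>R (LINT y:B|lborel. norm (f x y)))"
      by (auto simp: F_def set_lebesgue_integral_def indicator_def fun_eq_iff
          intro!: Bochner_Integration.integral_cong)
    then show "integrable lborel (\<lambda>x. \<integral>y. norm (F (x, y)) \<partial>lborel)"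
      using outer by (simp add: set_integrable_def)
    show "AE x in lborel. integrable lborel (\<lambda>y. F (x, y))"
    proof (rule AE_I2)
      show "integrable lborel (\<lambda>y. F (x, y))" for x
        unfolding F_sections(1) using inner[of x]
        by (cases "x \<in> A") (auto simp: set_integrable_def)
    qed
  qed
  then have "integrable (lborel \<Otimes>\<^sub>M lborel) (case_prod (\<lambda>x y. F (x, y)))"
    by (simp add: case_prod_beta')
  then have "(\<integral>y. (\<integral>x. F (x, y) \<partial>lborel) \<partial>lborel) = (\<integral>x. (\<integral>y. F (x, y) \<partial>lborel) \<partial>lborel)"
    by (rule lborel_pair.Fubini_integral)
  moreover have "(\<integral>x. (\<integral>y. F (x, y) \<partial>lborel) \<partial>lborel) = (LINT x:A|lborel. LINT y:B|lborel. f x y)"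
    by (simp only: F_sections(1) set_lebesgue_integral_def integral_scaleR_right)
  moreover have "(\<integral>y. (\<integral>x. F (x, y) \<partial>lborel) \<partial>lborel) = (LINT y:B|lborel. LINT x:A|lborel. f x y)"
    by (simp only: F_sections(2) set_lebesgue_integral_def integral_scaleR_right)
  ultimately show ?thesis by simp
qed

lemma norm_holomorphic_difference_quotient_le:
  assumes hol: "f holomorphic_on cball z r"
    and bound: "\<And>w. w \<in> cball z r \<Longrightarrow> norm (f w) \<le> B"
    and w: "w \<in> ball z (r / 2) - {z}"
  shows "norm ((f w - f z) / (w - z)) \<le> 2 * B / r"
proof -
  have r: "r > 0"
    using w zero_le_dist[of z w] by (simp del: zero_le_dist)
  have "norm (f w - f z) \<le> 2 * B / r * norm (w - z)"
  proof (rule field_differentiable_bound[where S = "ball z (r / 2)" and f' = "deriv f"])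
    fix y assume y: "y \<in> ball z (r / 2)"
    have "f holomorphic_on ball z r"
      using hol by (rule holomorphic_on_subset) auto
    then have "(f has_field_derivative deriv f y) (at y)"
      by (rule holomorphic_derivI) (use y r in auto)
    then show "(f has_field_derivative deriv f y) (at y within ball z (r / 2))"
      by (rule has_field_derivative_at_within)
    have sub: "cball y (r / 2) \<subseteq> cball z r"
    proof
      fix v assume "v \<in> cball y (r / 2)"
      then show "v \<in> cball z r"
        using y dist_triangle[of z v y] by (simp add: dist_commute)
    qed
    have "norm ((deriv ^^ 1) f y) \<le> fact 1 * B / (r / 2) ^ 1"
    proof (rule Cauchy_inequality)
      have hol_y: "f holomorphic_on cball y (r / 2)"
        using hol sub by (rule holomorphic_on_subset)
      show "f holomorphic_on ball y (r / 2)"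
        using hol_y ball_subset_cball by (rule holomorphic_on_subset)
      show "continuous_on (cball y (r / 2)) f"
        using hol_y by (rule holomorphic_on_imp_continuous_on)
      show "norm (f v) \<le> B" if "norm (y - v) = r / 2" for v
        using that sub by (intro bound) (auto simp: dist_norm)
    qed (use r in simp)
    then show "norm (deriv f y) \<le> 2 * B / r"
      by (simp add: mult.commute)
  qed (use w r in auto)
  then show ?thesis
    using w by (simp add: norm_divide pos_divide_le_eq)
qed

lemma has_field_derivative_set_integral:
  fixes f :: "complex \<Rightarrow> 'a \<Rightarrow> complex"
  assumes r: "r > 0"
    and hol: "\<And>t. t \<in> A \<Longrightarrow> (\<lambda>w. f w t) holomorphic_on cball z r"
    and meas: "\<And>w. w \<in> cball z r \<Longrightarrow> set_borel_measurable M A (f w)"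
    and g: "set_integrable M A g"
    and bound: "\<And>w t. w \<in> cball z r \<Longrightarrow> t \<in> A \<Longrightarrow> norm (f w t) \<le> g t"
  shows "((\<lambda>w. LINT t:A|M. f w t) has_field_derivative (LINT t:A|M. deriv (\<lambda>w. f w t) z)) (at z)"
proof -
  define quotient where "quotient w t = (f w t - f z t) / (w - z)" for w t
  have integrable_f: "set_integrable M A (f w)" if "w \<in> cball z r" for w
    using bound[OF that]
    by (intro set_integrable_bound[OF g meas[OF that]] AE_I2)
      (auto intro: order_trans[OF _ abs_ge_self])
  have integrable_quotient: "set_integrable M A (quotient w)"
    and integral_quotient: "(LINT t:A|M. quotient w t) =
      ((LINT t:A|M. f w t) - (LINT t:A|M. f z t)) / (w - z)" if "w \<in> cball z r" for w
    unfolding quotient_def using integrable_f[OF that] integrable_f[of z] r by simp_all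
  have "((\<lambda>w. LINT t:A|M. quotient w t) \<longlongrightarrow> (LINT t:A|M. deriv (\<lambda>w. f w t) z))
      (at z within ball z (r / 2))"
  proof (rule set_integral_dominated_convergence_at)
    show "set_integrable M A (\<lambda>t. 2 * g t / r)"
      using g by simp
    show "set_borel_measurable M A (quotient w)" if "w \<in> ball z (r / 2) - {z}" for w
      using that r integrable_quotient[of w]
      by (simp add: set_integrable_def set_borel_measurable_def)
    show "norm (quotient w t) \<le> 2 * g t / r" if "w \<in> ball z (r / 2) - {z}" "t \<in> A" for w t
      unfolding quotient_def
      by (rule norm_holomorphic_difference_quotient_le[OF hol[OF that(2)] bound]) (use that in auto)
    show "((\<lambda>w. quotient w t) \<longlongrightarrow> deriv (\<lambda>w. f w t) z) (at z within ball z (r / 2))" if "t \<in> A" for t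
    proof -
      have "(\<lambda>w. f w t) holomorphic_on ball z r"
        using hol[OF that] ball_subset_cball by (rule holomorphic_on_subset)
      then have "((\<lambda>w. f w t) has_field_derivative deriv (\<lambda>w. f w t) z) (at z)"
        by (rule holomorphic_derivI) (use r in auto)
      then show ?thesis
        using r by (simp add: has_field_derivative_iff quotient_def at_within_open[OF _ open_ball])
    qed
  qed
  moreover have "\<forall>\<^sub>F w in at z within ball z (r / 2). (LINT t:A|M. quotient w t) =
      ((LINT t:A|M. f w t) - (LINT t:A|M. f z t)) / (w - z)"
    using r by (auto simp: eventually_at_filter intro!: always_eventually integral_quotient)
  ultimately have "((\<lambda>w. ((LINT t:A|M. f w t) - (LINT t:A|M. f z t)) / (w - z)) \<longlongrightarrow>
      (LINT t:A|M. deriv (\<lambda>w. f w t) z)) (at z within ball z (r / 2))"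
    by (rule Lim_transform_eventually)
  then show ?thesis
    using r by (simp add: has_field_derivative_iff at_within_open[OF _ open_ball])
qed

lemma holomorphic_on_set_integral:
  fixes f :: "complex \<Rightarrow> 'a \<Rightarrow> complex"
  assumes U: "open U"
    and hol: "\<And>t. t \<in> A \<Longrightarrow> (\<lambda>z. f z t) holomorphic_on U"
    and meas: "\<And>z. z \<in> U \<Longrightarrow> set_borel_measurable M A (f z)"
    and dom: "\<And>z. z \<in> U \<Longrightarrow> \<exists>e>0. \<exists>g :: 'a \<Rightarrow> real. set_integrable M A g \<and>
                (\<forall>w\<in>ball z e \<inter> U. \<forall>t\<in>A. norm (f w t) \<le> g t)"
  shows "(\<lambda>z. LINT t:A|M. f z t) holomorphic_on U"
proof (subst holomorphic_on_open[OF U], intro ballI)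
  fix z assume z: "z \<in> U"
  obtain e and g :: "'a \<Rightarrow> real" where e: "e > 0" and g: "set_integrable M A g"
    and f_le_g: "\<And>w t. w \<in> ball z e \<Longrightarrow> w \<in> U \<Longrightarrow> t \<in> A \<Longrightarrow> norm (f w t) \<le> g t"
    using dom[OF z] by auto
  obtain r where r: "r > 0" "cball z r \<subseteq> ball z e \<inter> U"
    using U z e open_contains_cball_eq[of "ball z e \<inter> U"]
    by (metis IntI centre_in_ball open_Int open_ball)
  have "((\<lambda>z. LINT t:A|M. f z t) has_field_derivative (LINT t:A|M. deriv (\<lambda>z. f z t) z)) (at z)"
  proof (rule has_field_derivative_set_integral[OF r(1) _ _ g])
    show "(\<lambda>w. f w t) holomorphic_on cball z r" if "t \<in> A" for t
      using hol[OF that] by (rule holomorphic_on_subset) (use r(2) in blast)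
    show "norm (f w t) \<le> g t" if "w \<in> cball z r" "t \<in> A" for w t
      using that r(2) by (intro f_le_g) auto
  qed (use meas r(2) in auto)
  then show "\<exists>f'. ((\<lambda>z. LINT t:A|M. f z t) has_field_derivative f') (at z)" ..
qed

lemma set_integrable_weighted:
  fixes w f :: "real \<Rightarrow> complex"
  assumes w: "set_integrable lborel A w" and f: "A \<in> sets borel" "continuous_on A f"
    and bound: "\<And>t. t \<in> A \<Longrightarrow> norm (f t) \<le> C"
  shows "set_integrable lborel A (\<lambda>t. w t * f t)"
proof (rule set_integrable_bound)
  show "set_integrable lborel A (\<lambda>t. C * norm (w t))"
    using set_integrable_norm[OF w] by (intro set_integrable_mult_right)
  have "(\<lambda>t. indicator A t *\<^sub>R (w t * f t)) =
      (\<lambda>t. (indicator A t *\<^sub>R w t) * (indicator A t *\<^sub>R f t))"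
    by (auto simp: indicator_def)
  moreover have "(\<lambda>t. indicator A t *\<^sub>R w t) \<in> borel_measurable lborel"
    using w by (simp only: set_integrable_def borel_measurable_integrable)
  moreover have "(\<lambda>t. indicator A t *\<^sub>R f t) \<in> borel_measurable lborel"
    using set_borel_measurable_continuous_on[OF f] by (simp only: set_borel_measurable_def)
  ultimately show "set_borel_measurable lborel A (\<lambda>t. w t * f t)"
    unfolding set_borel_measurable_def by (simp only: borel_measurable_times)
  show "AE t in lborel. t \<in> A \<longrightarrow> norm (w t * f t) \<le> norm (C * norm (w t))"
  proof (intro AE_I2 impI)
    fix t assume "t \<in> A"
    then have "norm (w t * f t) \<le> C * norm (w t)"
      using mult_right_mono[OF bound, of t "norm (w t)"] by (simp add: norm_mult mult.commute)
    then show "norm (w t * f t) \<le> norm (C * norm (w t))"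
      by simp
  qed
qed

lemma norm_set_integral_weighted_le:
  fixes w f :: "real \<Rightarrow> complex"
  assumes w: "set_integrable lborel A w" and bound: "\<And>t. t \<in> A \<Longrightarrow> norm (f t) \<le> C"
  shows "norm (LINT t:A|lborel. w t * f t) \<le> C * (LINT t:A|lborel. norm (w t))"
proof -
  have "norm (w t * f t) \<le> C * norm (w t)" if "t \<in> A" for t
    using mult_right_mono[OF bound[OF that], of "norm (w t)"] by (simp add: norm_mult mult.commute)
  then have "norm (LINT t:A|lborel. w t * f t) \<le> (LINT t:A|lborel. C * norm (w t))"
    using set_integrable_norm[OF w] by (intro norm_set_integral_le set_integrable_mult_right)
  then show ?thesis by simp
qed

lemma holomorphic_on_set_integral_weighted:
  fixes w :: "real \<Rightarrow> complex" and f :: "complex \<Rightarrow> real \<Rightarrow> complex"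
  assumes U: "open U" and A: "A \<in> sets borel" and w: "set_integrable lborel A w"
    and hol: "\<And>t. t \<in> A \<Longrightarrow> (\<lambda>z. f z t) holomorphic_on U"
    and cont: "\<And>z. z \<in> U \<Longrightarrow> continuous_on A (f z)"
    and bound: "\<And>z. z \<in> U \<Longrightarrow> \<exists>e>0. \<exists>C. \<forall>v\<in>ball z e \<inter> U. \<forall>t\<in>A. norm (f v t) \<le> C"
  shows "(\<lambda>z. LINT t:A|lborel. w t * f z t) holomorphic_on U"
proof (rule holomorphic_on_set_integral[OF U])
  show "(\<lambda>z. w t * f z t) holomorphic_on U" if "t \<in> A" for t
    by (intro holomorphic_intros hol that)
  fix z assume z: "z \<in> U"
  obtain e C where e: "e > 0" and C: "\<And>v t. v \<in> ball z e \<inter> U \<Longrightarrow> t \<in> A \<Longrightarrow> norm (f v t) \<le> C"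
    using bound[OF z] by blast
  have "set_integrable lborel A (\<lambda>t. w t * f z t)"
    by (rule set_integrable_weighted[OF w A cont[OF z] C]) (use e z in auto)
  then show "set_borel_measurable lborel A (\<lambda>t. w t * f z t)"
    by (simp add: set_integrable_def set_borel_measurable_def)
  have "norm (w t * f v t) \<le> C * norm (w t)" if "v \<in> ball z e \<inter> U" "t \<in> A" for v t
    using mult_right_mono[OF C[OF that], of "norm (w t)"] by (simp add: norm_mult mult.commute)
  moreover have "set_integrable lborel A (\<lambda>t. C * norm (w t))"
    using set_integrable_norm[OF w] by (intro set_integrable_mult_right)
  ultimately show "\<exists>e>0. \<exists>g. set_integrable lborel A g \<and>
      (\<forall>v\<in>ball z e \<inter> U. \<forall>t\<in>A. norm (w t * f v t) \<le> g t)"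
    using e by blast
qed

lemma islimpt_of_real_Ioo:
  assumes "a < x" "x < b"
  shows "complex_of_real x islimpt complex_of_real ` {a<..<b}"
proof -
  have "x islimpt {a<..<b}"
    using assms by (intro interior_limit_point) (simp add: interior_open)
  moreover have "\<forall>\<^sub>F y in at x. complex_of_real y \<noteq> of_real x"
    unfolding of_real_eq_iff by (rule eventually_neq_at_within)
  ultimately show ?thesis
    by (intro islimpt_isCont_image) auto
qed

lemma analytic_continuation_Ioo:
  fixes f g :: "complex \<Rightarrow> complex"
  assumes hol: "f holomorphic_on S" "g holomorphic_on S" and S: "open S" "connected S"
    and sub: "complex_of_real ` {a<..<b} \<subseteq> S" and "a < b"
    and eq: "\<And>x. a < x \<Longrightarrow> x < b \<Longrightarrow> f (of_real x) = g (of_real x)" and z: "z \<in> S"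
  shows "f z = g z"
proof -
  let ?mid = "(a + b) / 2"
  have mid: "a < ?mid" "?mid < b"
    using \<open>a < b\<close> by auto
  have "f z - g z = 0"
  proof (rule analytic_continuation[OF holomorphic_on_diff[OF hol] S sub
    _ islimpt_of_real_Ioo[OF mid] _ z])
    show "complex_of_real ?mid \<in> S"
      using sub mid by (meson greaterThanLessThan_iff imageI subsetD)
    show "f w - g w = 0" if "w \<in> complex_of_real ` {a<..<b}" for w
      using that eq by auto
  qed
  then show ?thesis by simp
qed

section \<open>Gamma and beta integrals\<close>

lemma norm_of_real_powr: "t > 0 \<Longrightarrow> norm (complex_of_real t powr z) = t powr Re z"
  by (simp add: norm_powr_real_powr)

lemma continuous_on_powr_slit:
  fixes f :: "'a::topological_space \<Rightarrow> complex"
  assumes "continuous_on A f" "\<And>x. x \<in> A \<Longrightarrow> f x \<notin> \<real>\<^sub>\<le>\<^sub>0"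
  shows "continuous_on A (\<lambda>x. f x powr c)"
  using assms unfolding continuous_on_def by (auto intro!: tendsto_powr_complex)

definition gamma_weight :: "complex \<Rightarrow> real \<Rightarrow> complex" where
  "gamma_weight z t = of_real t powr (z - 1) * of_real (exp (- t))"

lemma norm_gamma_weight: "t > 0 \<Longrightarrow> norm (gamma_weight z t) = t powr (Re z - 1) * exp (- t)"
  by (simp add: gamma_weight_def norm_mult norm_of_real_powr)

lemma gamma_weight_of_real:
  "t > 0 \<Longrightarrow> gamma_weight (of_real x) t = of_real (t powr (x - 1) * exp (- t))"
  by (simp add: gamma_weight_def powr_of_real[symmetric])

lemma gamma_weight_plus1: "t > 0 \<Longrightarrow> gamma_weight (z + 1) t = of_real t * gamma_weight z t"
  by (simp add: gamma_weight_def powr_diff)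

lemma continuous_on_gamma_weight: "continuous_on {0<..} (gamma_weight z)"
  unfolding gamma_weight_def
  by (intro continuous_intros continuous_on_powr_slit) (auto simp: complex_nonpos_Reals_iff)

lemma
  assumes "Re z > 0"
  shows gamma_weight_integrable: "set_integrable lborel {0<..} (gamma_weight z)"
    and gamma_weight_integral: "(LINT t:{0<..}|lborel. gamma_weight z t) = Gamma z"
proof -
  have gamma_weight_eq: "gamma_weight z t = of_real t powr (z - 1) / of_real (exp t)" for t
    by (simp add: gamma_weight_def exp_minus divide_inverse)
  show integrable: "set_integrable lborel {0<..} (gamma_weight z)"
    using absolutely_integrable_Gamma_integral'[OF assms] continuous_on_gamma_weight[of z]
    by (subst set_integrable_lborel_iff_absolutely_integrable)
      (simp_all add: gamma_weight_eq[abs_def])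
  show "(LINT t:{0<..}|lborel. gamma_weight z t) = Gamma z"
    using set_borel_integral_eq_integral(2)[OF integrable] Gamma_integral_complex'[OF assms]
    by (simp add: gamma_weight_eq[abs_def] integral_unique)
qed

lemma
  assumes x: "x > (0::real)"
  shows Gamma_real_integrable: "set_integrable lborel {0<..} (\<lambda>t. t powr (x - 1) * exp (- t))"
    and Gamma_real_integral: "(LINT t:{0<..}|lborel. t powr (x - 1) * exp (- t)) = Gamma x"
proof -
  have Re: "Re (of_real x) > 0"
    using x by simp
  have norm_eq: "norm (gamma_weight (of_real x) t) = t powr (x - 1) * exp (- t)"
    if "t \<in> {0<..}" for t
    using that by (simp add: norm_gamma_weight)
  show "set_integrable lborel {0<..} (\<lambda>t. t powr (x - 1) * exp (- t))"
    using set_integrable_norm[OF gamma_weight_integrable[OF Re]] norm_eq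
    by (rule set_integrable_transform)
  have "complex_of_real (LINT t:{0<..}|lborel. t powr (x - 1) * exp (- t)) =
      (LINT t:{0<..}|lborel. gamma_weight (of_real x) t)"
    unfolding set_integral_complex_of_real[symmetric]
    by (intro set_integral_cong) (simp add: gamma_weight_of_real)
  then show "(LINT t:{0<..}|lborel. t powr (x - 1) * exp (- t)) = Gamma x"
    unfolding gamma_weight_integral[OF Re] Gamma_complex_of_real of_real_eq_iff .
qed

lemma gamma_weight_integral_norm:
  assumes "Re z > 0"
  shows "(LINT t:{0<..}|lborel. norm (gamma_weight z t)) = Gamma (Re z)"
  unfolding Gamma_real_integral[OF assms, symmetric]
  by (rule set_integral_cong) (simp add: norm_gamma_weight)

lemma
  assumes x: "x > (0::real)" and a: "a > 0"
  shows Gamma_real_integrable_scaled: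
      "set_integrable lborel {0<..}
        (\<lambda>t. t powr (x - 1) * exp (- (a * t)))" (is "set_integrable _ _ ?f")
    and Gamma_real_integral_scaled:
      "(LINT t:{0<..}|lborel. t powr (x - 1) * exp (- (a * t))) = Gamma x * a powr (- x)"
proof -
  have scaled: "(a * t) powr (x - 1) * exp (- (a * t)) = a powr (x - 1) * ?f t" for t
    by (simp add: powr_mult)
  have "set_integrable lborel {0<..} (\<lambda>t. a powr (x - 1) * ?f t)"
    using Gamma_real_integrable[OF x]
      set_integrable_Ioi_scale[OF a, of "\<lambda>t. t powr (x - 1) * exp (- t)"]
    by (simp only: scaled)
  then show "set_integrable lborel {0<..} ?f"
    using a by simp
  have "Gamma x = a * (a powr (x - 1) * (LINT t:{0<..}|lborel. ?f t))"
    using Gamma_real_integral[OF x]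
      set_integral_Ioi_scale[OF a, of "\<lambda>t. t powr (x - 1) * exp (- t)"]
    by (simp only: scaled set_integral_mult_right real_scaleR_def)
  also have "\<dots> = a powr x * (LINT t:{0<..}|lborel. ?f t)"
    using a by (simp add: powr_diff)
  finally show "(LINT t:{0<..}|lborel. ?f t) = Gamma x * a powr (- x)"
    using a by (simp add: powr_minus field_simps)
qed

lemma continuous_on_powr_times_exp:
  "continuous_on {0<..} (\<lambda>t. complex_of_real t powr c * exp (- (a * of_real t)))"
  by (intro continuous_intros continuous_on_powr_slit) (auto simp: complex_nonpos_Reals_iff)

lemma norm_powr_times_exp:
  "t > 0 \<Longrightarrow> norm (complex_of_real t powr c * exp (- (a * of_real t))) =
    t powr Re c * exp (- (Re a * t))"
  by (simp add: norm_mult norm_of_real_powr)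

lemma Gamma_complex_integrable_scaled:
  assumes z: "Re z > 0" and a: "Re a > 0"
  shows "set_integrable lborel {0<..}
    (\<lambda>t. complex_of_real t powr (z - 1) * exp (- (a * of_real t)))"
  by (rule set_integrable_continuous_bound
      [OF _ continuous_on_powr_times_exp Gamma_real_integrable_scaled[OF z a]])
    (simp_all add: norm_powr_times_exp)

lemma Gamma_complex_integral_scaled_holomorphic:
  assumes z: "Re z > 0"
  shows "(\<lambda>a. LINT t:{0<..}|lborel. complex_of_real t powr (z - 1) * exp (- (a * of_real t)))
    holomorphic_on {a. Re a > 0}"
proof (rule holomorphic_on_set_integral)
  fix a :: complex assume "a \<in> {a. Re a > 0}"
  then have a: "Re a > 0" by simp
  show "set_borel_measurable lborel {0<..}
      (\<lambda>t. complex_of_real t powr (z - 1) * exp (- (a * of_real t)))"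
    by (rule set_borel_measurable_continuous_on[OF _ continuous_on_powr_times_exp]) simp
  have "norm (complex_of_real t powr (z - 1) * exp (- (w * of_real t))) \<le>
      t powr (Re z - 1) * exp (- (Re a / 2 * t))"
    if "w \<in> ball a (Re a / 2)" "t \<in> {0<..}" for w t
  proof -
    have "Re w \<ge> Re a / 2"
      using abs_Re_le_cmod[of "a - w"] that by (simp add: dist_norm)
    then show ?thesis
      using that by (simp add: norm_powr_times_exp mult_left_mono)
  qed
  then show "\<exists>e>0. \<exists>g. set_integrable lborel {0<..} g \<and> (\<forall>w\<in>ball a e \<inter> {a. Re a > 0}. \<forall>t\<in>{0<..}.
      norm (complex_of_real t powr (z - 1) * exp (- (w * of_real t))) \<le> g t)"
    using a Gamma_real_integrable_scaled[OF z, of "Re a / 2"]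
    by (intro exI[of _ "Re a / 2"] conjI
        exI[of _ "\<lambda>t. t powr (Re z - 1) * exp (- (Re a / 2 * t))"]) auto
qed (auto intro!: holomorphic_intros open_halfspace_Re_gt)

lemma Gamma_complex_integral_scaled:
  assumes z: "Re z > 0" and a: "Re a > 0"
  shows "(LINT t:{0<..}|lborel. complex_of_real t powr (z - 1) * exp (- (a * of_real t))) =
    Gamma z * a powr (- z)"
proof (rule analytic_continuation_Ioo[OF Gamma_complex_integral_scaled_holomorphic[OF z],
  where a = 0 and b = 1])
  fix r :: real assume r: "0 < r" "r < 1"
  define f where "f t = complex_of_real t powr (z - 1) * exp (- (of_real r * of_real t))" for t
  have "gamma_weight z (r * t) = of_real r powr (z - 1) * f t" if "t \<in> {0<..}" for t
    using that r by (simp add: gamma_weight_def f_def powr_times_real flip: exp_of_real)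
  then have "Gamma z = of_real r * (of_real r powr (z - 1) * (LINT t:{0<..}|lborel. f t))"
    using gamma_weight_integral[OF z] set_integral_Ioi_scale[OF r(1), of "gamma_weight z"]
    by (simp only: scaleR_conv_of_real set_integral_mult_right cong: set_integral_cong)
  also have "\<dots> = of_real r powr z * (LINT t:{0<..}|lborel. f t)"
    using r by (simp add: powr_diff)
  finally show "(LINT t:{0<..}|lborel. complex_of_real t powr (z - 1) *
        exp (- (of_real r * of_real t))) =
      Gamma z * of_real r powr (- z)"
    using r by (simp add: f_def powr_minus field_simps)
qed (use a in \<open>auto intro!: holomorphic_intros convex_connected convex_halfspace_Re_gt
    open_halfspace_Re_gt simp: complex_nonpos_Reals_iff\<close>)

lemma
  assumes "Re a > 0"
  shows exp_Ioi_integrable: "set_integrable lborel {0<..} (\<lambda>t. exp (- (a * of_real t)))"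
    and exp_Ioi_integral: "(LINT t:{0<..}|lborel. exp (- (a * of_real t))) = 1 / a"
proof -
  have eq: "complex_of_real t powr (1 - 1) * exp (- (a * of_real t)) = exp (- (a * of_real t))"
    if "t \<in> {0<..}" for t
    using that by simp
  show "set_integrable lborel {0<..} (\<lambda>t. exp (- (a * of_real t)))"
    using Gamma_complex_integrable_scaled[OF _ assms, of 1] eq
    by (rule set_integrable_transform) simp
  have "(LINT t:{0<..}|lborel. exp (- (a * of_real t))) =
      (LINT t:{0<..}|lborel. complex_of_real t powr (1 - 1) * exp (- (a * of_real t)))"
    by (rule set_integral_cong) (use eq in auto)
  also have "\<dots> = Gamma 1 * a powr (- 1)"
    using assms by (intro Gamma_complex_integral_scaled) auto
  finally show "(LINT t:{0<..}|lborel. exp (- (a * of_real t))) = 1 / a"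
    using assms by (auto simp: powr_minus divide_inverse)
qed

lemma
  assumes "(a::real) > 0"
  shows exp_Ioi_integrable_real: "set_integrable lborel {0<..} (\<lambda>t. exp (- (a * t)))"
    and exp_Ioi_integral_real: "(LINT t:{0<..}|lborel. exp (- (a * t))) = 1 / a"
proof -
  have eq: "t powr (1 - 1) * exp (- (a * t)) = exp (- (a * t))" if "t \<in> {0<..}" for t
    using that by simp
  show "set_integrable lborel {0<..} (\<lambda>t. exp (- (a * t)))"
    using Gamma_real_integrable_scaled[OF _ assms, of 1] eq
    by (rule set_integrable_transform) simp
  have "(LINT t:{0<..}|lborel. exp (- (a * t))) =
      (LINT t:{0<..}|lborel. t powr (1 - 1) * exp (- (a * t)))"
    by (rule set_integral_cong) (use eq in auto)
  then show "(LINT t:{0<..}|lborel. exp (- (a * t))) = 1 / a"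
    using Gamma_real_integral_scaled[OF _ assms, of 1] assms
    by (simp add: powr_minus divide_inverse)
qed

definition beta_weight :: "complex \<Rightarrow> complex \<Rightarrow> real \<Rightarrow> complex" where
  "beta_weight a b r = of_real r powr (a - 1) * of_real (1 - r) powr (b - 1)"

lemma norm_beta_weight:
  "r \<in> {0<..<1} \<Longrightarrow> norm (beta_weight a b r) = r powr (Re a - 1) * (1 - r) powr (Re b - 1)"
  using norm_of_real_powr[of "1 - r"] by (simp add: beta_weight_def norm_mult norm_of_real_powr)

lemma beta_weight_of_real:
  assumes "r \<in> {0<..<1}"
  shows "beta_weight (of_real a) (of_real b) r = of_real (r powr (a - 1) * (1 - r) powr (b - 1))"
  using assms powr_of_real[of "1 - r" "b - 1"]
  by (simp add: beta_weight_def powr_of_real[symmetric])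

lemma beta_weight_plus1:
  assumes "r \<in> {0<..<1}"
  shows "beta_weight (a + 1) (b + 1) r = of_real (r * (1 - r)) * beta_weight a b r"
proof -
  have "complex_of_real (1 - r) \<noteq> 0"
    using assms by (simp only: of_real_eq_0_iff) simp
  then show ?thesis
    using assms by (simp add: beta_weight_def powr_diff)
qed

lemma continuous_on_beta_weight: "continuous_on {0<..<1} (beta_weight a b)"
  unfolding beta_weight_def
  by (intro continuous_intros continuous_on_powr_slit) (auto simp: complex_nonpos_Reals_iff)

lemma
  assumes "a > 0" "b > (0::real)"
  shows Beta_real_integrable: "set_integrable lborel {0<..<1}
    (\<lambda>t. t powr (a - 1) * (1 - t) powr (b - 1))"
    and Beta_real_integral:
      "(LINT t:{0<..<1}|lborel. t powr (a - 1) * (1 - t) powr (b - 1)) = Beta a b"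
proof -
  show integrable: "set_integrable lborel {0<..<1} (\<lambda>t. t powr (a - 1) * (1 - t) powr (b - 1))"
    by (rule set_integrable_subset[OF integrable_Beta[OF assms]]) auto
  have "((\<lambda>t. t powr (a - 1) * (1 - t) powr (b - 1)) has_integral Beta a b) {0<..<1}"
    using has_integral_Beta_real[OF assms] by (simp add: has_integral_Icc_iff_Ioo)
  then show "(LINT t:{0<..<1}|lborel. t powr (a - 1) * (1 - t) powr (b - 1)) = Beta a b"
    using set_borel_integral_eq_integral(2)[OF integrable] by (simp add: integral_unique)
qed

lemma
  assumes "Re a > 0" "Re b > 0"
  shows beta_weight_integrable: "set_integrable lborel {0<..<1} (beta_weight a b)"
    and beta_weight_integral_norm: "(LINT r:{0<..<1}|lborel. norm (beta_weight a b r)) =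
      Beta (Re a) (Re b)"
proof -
  show "set_integrable lborel {0<..<1} (beta_weight a b)"
    by (rule set_integrable_continuous_bound[OF _ continuous_on_beta_weight
      Beta_real_integrable[OF assms]])
      (simp_all add: norm_beta_weight)
  show "(LINT r:{0<..<1}|lborel. norm (beta_weight a b r)) = Beta (Re a) (Re b)"
    unfolding Beta_real_integral[OF assms, symmetric]
    by (rule set_integral_cong) (simp add: norm_beta_weight)
qed

lemma beta_transform_holomorphic:
  fixes f :: "complex \<Rightarrow> real \<Rightarrow> complex"
  assumes U: "open U" and ab: "a holomorphic_on U" "b holomorphic_on U"
    and pos: "\<And>z. z \<in> U \<Longrightarrow> Re (a z) > 0" "\<And>z. z \<in> U \<Longrightarrow> Re (b z) > 0"
    and hol: "\<And>r. r \<in> {0<..<1} \<Longrightarrow> (\<lambda>z. f z r) holomorphic_on U"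
    and cont: "\<And>z. z \<in> U \<Longrightarrow> continuous_on {0<..<1} (f z)"
    and bound: "\<And>z. z \<in> U \<Longrightarrow> \<exists>e>0. \<exists>C. \<forall>v\<in>ball z e \<inter> U. \<forall>r\<in>{0<..<1}. norm (f v r) \<le> C"
  shows "(\<lambda>z. LINT r:{0<..<1}|lborel. beta_weight (a z) (b z) r * f z r) holomorphic_on U"
proof (rule holomorphic_on_set_integral[OF U])
  fix r :: real assume r: "r \<in> {0<..<1}"
  show "(\<lambda>z. beta_weight (a z) (b z) r * f z r) holomorphic_on U"
    unfolding beta_weight_def by (intro holomorphic_intros hol ab r)
next
  fix z assume z: "z \<in> U"
  show "set_borel_measurable lborel {0<..<1} (\<lambda>r. beta_weight (a z) (b z) r * f z r)"
    by (intro set_borel_measurable_continuous_on continuous_on_mult continuous_on_beta_weight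
      cont z) simp
  obtain e1 C where e1: "e1 > 0"
    and C: "\<And>v r. v \<in> ball z e1 \<inter> U \<Longrightarrow> r \<in> {0<..<1} \<Longrightarrow> norm (f v r) \<le> C"
    using bound[OF z] by blast
  define \<alpha> \<beta> where "\<alpha> = Re (a z) / 2" and "\<beta> = Re (b z) / 2"
  have \<alpha>\<beta>: "\<alpha> > 0" "\<alpha> < Re (a z)" "\<beta> > 0" "\<beta> < Re (b z)"
    using pos[OF z] by (auto simp: \<alpha>_def \<beta>_def)
  have "isCont a z" "isCont b z"
    using ab U z by (meson continuous_on_eq_continuous_at holomorphic_on_imp_continuous_on)+
  then have "((\<lambda>v. Re (a v)) \<longlongrightarrow> Re (a z)) (nhds z)" "((\<lambda>v. Re (b v)) \<longlongrightarrow> Re (b z)) (nhds z)"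
    unfolding isCont_def tendsto_at_iff_tendsto_nhds by (auto intro: tendsto_intros)
  then have "\<forall>\<^sub>F v in nhds z. Re (a v) > \<alpha> \<and> Re (b v) > \<beta>"
    using \<alpha>\<beta> by (intro eventually_conj order_tendstoD(1)) auto
  then obtain e2 where e2: "e2 > 0"
    and exponents_gt: "\<And>v. v \<in> ball z e2 \<Longrightarrow> Re (a v) > \<alpha> \<and> Re (b v) > \<beta>"
    by (auto simp: eventually_nhds_metric dist_commute)
  have dominated: "norm (beta_weight (a v) (b v) r * f v r) \<le>
      C * (r powr (\<alpha> - 1) * (1 - r) powr (\<beta> - 1))"
    if v: "v \<in> ball z (min e1 e2) \<inter> U" and r: "r \<in> {0<..<1}" for v r
  proof -
    have "r powr (Re (a v) - 1) \<le> r powr (\<alpha> - 1)"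
      "(1 - r) powr (Re (b v) - 1) \<le> (1 - r) powr (\<beta> - 1)"
      using r exponents_gt[of v] v by (intro powr_mono'; auto)+
    then have "norm (beta_weight (a v) (b v) r) * norm (f v r) \<le>
        r powr (\<alpha> - 1) * (1 - r) powr (\<beta> - 1) * C"
      unfolding norm_beta_weight[OF r] using v r by (intro mult_mono C) auto
    then show ?thesis
      by (simp add: norm_mult mult.commute)
  qed
  show "\<exists>e>0. \<exists>g. set_integrable lborel {0<..<1} g \<and>
      (\<forall>v\<in>ball z e \<inter> U. \<forall>r\<in>{0<..<1}. norm (beta_weight (a v) (b v) r * f v r) \<le> g r)"
    using e1 e2 dominated Beta_real_integrable[OF \<alpha>\<beta>(1,3)]
    by (intro exI[of _ "min e1 e2"] conjI
      exI[of _ "\<lambda>r. C * (r powr (\<alpha> - 1) * (1 - r) powr (\<beta> - 1))"]) auto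
qed

lemma Gamma_arg_notin_nonpos_Ints: "Re z > 0 \<Longrightarrow> z \<notin> \<int>\<^sub>\<le>\<^sub>0"
  by (auto elim!: nonpos_Ints_cases)

lemma beta_weight_integral_holomorphic:
  assumes "open U" "a holomorphic_on U" "b holomorphic_on U"
    and "\<And>z. z \<in> U \<Longrightarrow> Re (a z) > 0" "\<And>z. z \<in> U \<Longrightarrow> Re (b z) > 0"
  shows "(\<lambda>z. LINT r:{0<..<1}|lborel. beta_weight (a z) (b z) r) holomorphic_on U"
proof -
  have "\<exists>e>0. \<exists>C. \<forall>v\<in>ball z e \<inter> U. \<forall>r\<in>{0<..<1::real}. norm (1 :: complex) \<le> C" for z
    by (intro exI[of _ 1]) auto
  then have "(\<lambda>z. LINT r:{0<..<1}|lborel. beta_weight (a z) (b z) r * 1) holomorphic_on U"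
    by (intro beta_transform_holomorphic assms) auto
  then show ?thesis by simp
qed

lemma beta_weight_integral_of_real:
  fixes x y :: real
  assumes "x > 0" "y > 0"
  shows "(LINT r:{0<..<1}|lborel. beta_weight (of_real x) (of_real y) r) =
    Beta (of_real x) (of_real y)"
proof -
  have "(LINT r:{0<..<1}|lborel. beta_weight (of_real x) (of_real y) r) =
      (LINT r:{0<..<1}|lborel. complex_of_real (r powr (x - 1) * (1 - r) powr (y - 1)))"
    by (rule set_integral_cong) (rule beta_weight_of_real)
  then show ?thesis
    by (simp only: set_integral_complex_of_real Beta_real_integral[OF assms] Beta_complex_of_real)
qed

lemma beta_weight_integral:
  assumes a: "Re a > 0" and b: "Re b > 0"
  shows "(LINT r:{0<..<1}|lborel. beta_weight a b r) = Beta a b"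
proof -
  let ?H = "{z. Re z > 0}"
  note halfplane = open_halfspace_Re_gt[of 0] convex_connected[OF convex_halfspace_Re_gt[of 0]]
  have of_real_left: "(LINT r:{0<..<1}|lborel. beta_weight (of_real x) b r) = Beta (of_real x) b"
    if x: "x > 0" for x
  proof (rule analytic_continuation_Ioo[OF _ _ halfplane,
        where f = "\<lambda>b. LINT r:{0<..<1}|lborel. beta_weight (of_real x) b r"
          and g = "Beta (of_real x)" and a = 0 and b = 1])
    show "(\<lambda>b. LINT r:{0<..<1}|lborel. beta_weight (of_real x) b r) holomorphic_on ?H"
      by (rule beta_weight_integral_holomorphic) (use x halfplane in auto)
    show "Beta (complex_of_real x) holomorphic_on ?H"
      by (intro holomorphic_intros Gamma_arg_notin_nonpos_Ints) (use x in auto)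
  qed (use b x beta_weight_integral_of_real in auto)
  show ?thesis
  proof (rule analytic_continuation_Ioo[OF _ _ halfplane,
        where f = "\<lambda>a. LINT r:{0<..<1}|lborel. beta_weight a b r" and g = "\<lambda>a. Beta a b"
          and a = 0 and b = 1])
    show "(\<lambda>a. LINT r:{0<..<1}|lborel. beta_weight a b r) holomorphic_on ?H"
      by (rule beta_weight_integral_holomorphic) (use b halfplane in auto)
    show "(\<lambda>a. Beta a b) holomorphic_on ?H"
      by (intro holomorphic_intros Gamma_arg_notin_nonpos_Ints) (use b in auto)
  qed (use a of_real_left in auto)
qed

lemma
  shows bij_betw_frac_one_plus: "bij_betw (\<lambda>s::real. s / (1 + s)) {0<..} {0<..<1}"
    and DERIV_frac_one_plus:
      "s \<in> {0<..} \<Longrightarrow> ((\<lambda>s. s / (1 + s)) has_field_derivative 1 / (1 + s)\<^sup>2) (at (s::real))"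
    and continuous_on_DERIV_frac_one_plus: "continuous_on {0<..} (\<lambda>s::real. 1 / (1 + s)\<^sup>2)"
proof -
  show "bij_betw (\<lambda>s::real. s / (1 + s)) {0<..} {0<..<1}"
    by (rule bij_betw_byWitness[where f' = "\<lambda>v. v / (1 - v)"]) (auto simp: field_simps)
  show "((\<lambda>s. s / (1 + s)) has_field_derivative 1 / (1 + s)\<^sup>2) (at s)" if "s \<in> {0<..}"
    by (rule derivative_eq_intros refl)+ (use that in \<open>auto simp: field_simps power2_eq_square\<close>)
  show "continuous_on {0<..} (\<lambda>s::real. 1 / (1 + s)\<^sup>2)"
    by (intro continuous_intros) auto
qed

lemma
  assumes ab: "a > 0" "b > (0::real)"
  shows Beta_Ioi_integrable: "set_integrable lborel {0<..}
    (\<lambda>s. s powr (a - 1) * (1 + s) powr (- (a + b)))"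
    and Beta_Ioi_integral:
      "(LINT s:{0<..}|lborel. s powr (a - 1) * (1 + s) powr (- (a + b))) = Beta a b"
proof -
  let ?f = "\<lambda>t::real. t powr (a - 1) * (1 - t) powr (b - 1)"
  have subst: "\<bar>1 / (1 + s)\<^sup>2\<bar> *\<^sub>R ?f (s / (1 + s)) = s powr (a - 1) * (1 + s) powr (- (a + b))"
    if "s \<in> {0<..}" for s
  proof -
    have s: "s > 0" using that by simp
    have "1 - s / (1 + s) = 1 / (1 + s)"
      using s by (simp add: field_simps)
    then have "\<bar>1 / (1 + s)\<^sup>2\<bar> *\<^sub>R ?f (s / (1 + s)) =
        s powr (a - 1) / ((1 + s) powr 2 * ((1 + s) powr (a - 1) * (1 + s) powr (b - 1)))"
      using s by (simp add: powr_divide)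
    also have "(1 + s) powr 2 * ((1 + s) powr (a - 1) * (1 + s) powr (b - 1)) =
        (1 + s) powr (a + b)"
      by (simp flip: powr_add)
    finally show ?thesis
      by (simp only: powr_minus_divide times_divide_eq_right mult_1_right)
  qed
  have cont: "continuous_on {0<..<1} ?f"
    by (intro continuous_intros) auto
  note substitution = set_integral_substitution[OF _ _ bij_betw_frac_one_plus DERIV_frac_one_plus
      continuous_on_DERIV_frac_one_plus cont Beta_real_integrable[OF ab]]
  show "set_integrable lborel {0<..} (\<lambda>s. s powr (a - 1) * (1 + s) powr (- (a + b)))"
    by (rule set_integrable_transform[OF substitution(1) subst]) auto
  show "(LINT s:{0<..}|lborel. s powr (a - 1) * (1 + s) powr (- (a + b))) = Beta a b"
    using substitution(2) Beta_real_integral[OF ab]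
    by (simp only: subst cong: set_integral_cong) simp
qed

section \<open>The basic terminant\<close>

lemma
  assumes p: "p > 0"
  shows chi_integrable: "set_integrable lborel {0<..} (\<lambda>y. (1 + y\<^sup>2) powr (- ((p + 1) / 2)))"
    and chi_integral: "(LINT y:{0<..}|lborel. (1 + y\<^sup>2) powr (- ((p + 1) / 2))) = chi p / p"
proof -
  let ?f = "\<lambda>s::real. s powr (1/2 - 1) * (1 + s) powr (- (1/2 + p/2))"
  have subst: "\<bar>2 * y\<bar> *\<^sub>R ?f (y\<^sup>2) = 2 * (1 + y\<^sup>2) powr (- ((p + 1) / 2))" if "y \<in> {0<..}" for y
  proof -
    have "(y\<^sup>2) powr (1/2 - 1) = inverse y"
      using that by (simp add: powr_minus powr_half_sqrt)
    moreover have "- (1/2 + p/2) = - ((p + 1) / 2)"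
      by (simp add: field_simps)
    ultimately show ?thesis
      using that by simp
  qed
  have bij: "bij_betw (\<lambda>y::real. y\<^sup>2) {0<..} {0<..}"
    by (rule bij_betw_byWitness[where f' = sqrt]) auto
  have "continuous_on {0<..} ?f"
    by (intro continuous_intros) auto
  note substitution = set_integral_substitution[OF _ _ bij, of "\<lambda>y. 2 * y", OF _ _ _ _ this
      Beta_Ioi_integrable[of "1/2" "p/2"]]
  have "set_integrable lborel {0<..} (\<lambda>y. 2 * (1 + y\<^sup>2) powr (- ((p + 1) / 2)))"
    by (rule set_integrable_transform[OF substitution(1) subst])
      (use p in \<open>auto intro!: derivative_eq_intros continuous_intros\<close>)
  then show "set_integrable lborel {0<..} (\<lambda>y. (1 + y\<^sup>2) powr (- ((p + 1) / 2)))"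
    by (subst (asm) set_integrable_mult_right_iff) auto
  have "2 * (LINT y:{0<..}|lborel. (1 + y\<^sup>2) powr (- ((p + 1) / 2))) =
      (LINT y:{0<..}|lborel. \<bar>2 * y\<bar> *\<^sub>R ?f (y\<^sup>2))"
    unfolding set_integral_mult_right[symmetric] by (rule set_integral_cong) (simp only: subst)
  also have "\<dots> = (LINT s:{0<..}|lborel. ?f s)"
    by (rule substitution(2)) (use p in \<open>auto intro!: derivative_eq_intros continuous_intros\<close>)
  also have "\<dots> = Beta (1/2) (p/2)"
    using p by (intro Beta_Ioi_integral) auto
  also have "\<dots> = 2 * (chi p / p)"
  proof -
    have Gamma_rec: "Gamma (p / 2 + 1) = p / 2 * Gamma (p / 2)"
      using p by (intro Gamma_plus1) (auto elim!: nonpos_Ints_cases)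
    show ?thesis
      unfolding Beta_def chi_def Gamma_rec using p
      by (simp add: Gamma_one_half_real add.commute[of "1/2"])
  qed
  finally show "(LINT y:{0<..}|lborel. (1 + y\<^sup>2) powr (- ((p + 1) / 2))) = chi p / p"
    by simp
qed

lemma norm_one_plus_ge_1:
  assumes "Re q \<ge> 0" "u \<ge> 0"
  shows "norm (1 + of_real u * q) \<ge> 1"
proof -
  have "1 \<le> Re (1 + of_real u * q)" using assms by simp
  also have "\<dots> \<le> norm (1 + of_real u * q)" by (rule complex_Re_le_cmod)
  finally show ?thesis .
qed

lemma norm_one_plus_ge_Im:
  assumes "Im q \<noteq> 0"
  shows "norm (1 + of_real u * q) \<ge> \<bar>Im q\<bar> / norm q"
proof -
  have q: "q \<noteq> 0" using assms by auto
  have "\<bar>Im q\<bar> = \<bar>Im ((1 + of_real u * q) * cnj q)\<bar>"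
    by (simp add: algebra_simps)
  also have "\<dots> \<le> norm ((1 + of_real u * q) * cnj q)" by (rule abs_Im_le_cmod)
  finally have "\<bar>Im q\<bar> \<le> norm (1 + of_real u * q) * norm q"
    by (simp only: norm_mult complex_mod_cnj)
  then show ?thesis using q by (simp add: pos_divide_le_eq)
qed

lemma norm_one_plus_locally_bounded_below:
  fixes q :: complex
  assumes "q \<notin> \<real>\<^sub>\<le>\<^sub>0"
  obtains e d where "e > 0" "d > 0" "\<And>w u. w \<in> ball q e \<Longrightarrow> u \<ge> 0 \<Longrightarrow> norm (1 + of_real u * w) \<ge> d"
proof (cases "Im q = 0")
  case True
  then have "Re q > 0" using assms by (auto simp: complex_nonpos_Reals_iff)
  moreover have "Re w \<ge> 0" if "w \<in> ball q (Re q)" for w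
    using that abs_Re_le_cmod[of "q - w"] by (simp add: dist_norm)
  ultimately show ?thesis
    using that[of "Re q" 1] norm_one_plus_ge_1 by auto
next
  case False
  define e where "e = \<bar>Im q\<bar> / 2"
  have "norm (1 + of_real u * w) \<ge> e / (norm q + e)" if "w \<in> ball q e" for w u
  proof -
    have near: "norm (q - w) < e" using that by (simp add: dist_norm)
    then have "\<bar>Im w\<bar> \<ge> e" using abs_Im_le_cmod[of "q - w"] by (simp add: e_def)
    moreover from this False have "Im w \<noteq> 0" by (auto simp: e_def)
    moreover have "norm w \<le> norm q + e" using near norm_triangle_ineq3[of q w] by simp
    ultimately have "e / (norm q + e) \<le> \<bar>Im w\<bar> / norm w"
      by (intro frac_le) (auto simp: e_def)
    also have "\<dots> \<le> norm (1 + of_real u * w)"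
      by (rule norm_one_plus_ge_Im) fact
    finally show ?thesis .
  qed
  then show ?thesis
    using that[of e "e / (norm q + e)"] False by (auto simp: e_def add_nonneg_pos)
qed

lemma one_plus_mult_notin_nonpos_Reals:
  fixes q :: complex
  assumes "q \<notin> \<real>\<^sub>\<le>\<^sub>0" "u \<ge> 0"
  shows "1 + of_real u * q \<notin> \<real>\<^sub>\<le>\<^sub>0"
proof (cases "u = 0")
  case False
  then have "u > 0" using assms by simp
  then have "0 < Re q \<Longrightarrow> 0 < 1 + u * Re q" by (simp add: add_pos_pos)
  with \<open>u > 0\<close> assms show ?thesis
    by (auto simp: complex_nonpos_Reals_iff not_le)
qed simp

lemma one_plus_mult_nonzero:
  fixes q :: complex
  assumes "q \<notin> \<real>\<^sub>\<le>\<^sub>0" "u \<ge> 0"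
  shows "1 + of_real u * q \<noteq> 0"
  using one_plus_mult_notin_nonpos_Reals[OF assms] by auto

definition terminant :: "real \<Rightarrow> complex \<Rightarrow> complex" where
  "terminant p q = (LINT u:{0<..}|lborel. gamma_weight (of_real p) u / (1 + of_real u * q))"

context
  fixes p :: real
  assumes p: "p > 0"
begin

lemma terminant_integrable:
  assumes q: "q \<notin> \<real>\<^sub>\<le>\<^sub>0"
  shows "set_integrable lborel {0<..} (\<lambda>u. gamma_weight (of_real p) u / (1 + of_real u * q))"
proof -
  obtain e d where "e > 0" "d > 0" "\<And>w u. w \<in> ball q e \<Longrightarrow> u \<ge> 0 \<Longrightarrow> norm (1 + of_real u * w) \<ge> d"
    by (rule norm_one_plus_locally_bounded_below[OF q]) blast
  then have "norm (inverse (1 + of_real u * q)) \<le> inverse d" if "u \<in> {0<..}" for u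
    using that by (auto simp: norm_inverse intro!: le_imp_inverse_le)
  then show ?thesis
    unfolding divide_inverse
    by (intro set_integrable_weighted gamma_weight_integrable continuous_intros)
      (use p one_plus_mult_nonzero[OF q] in auto)
qed

lemma norm_terminant_le:
  assumes "d > 0" "\<And>u. u > 0 \<Longrightarrow> norm (1 + of_real u * q) \<ge> d"
  shows "norm (terminant p q) \<le> Gamma p / d"
proof -
  have "norm (terminant p q) \<le>
      inverse d * (LINT u:{0<..}|lborel. norm (gamma_weight (of_real p) u))"
    unfolding terminant_def divide_inverse
    by (rule norm_set_integral_weighted_le)
      (use p assms in \<open>auto intro!: gamma_weight_integrable le_imp_inverse_le simp: norm_inverse\<close>)
  then show ?thesis
    using p by (simp add: gamma_weight_integral_norm divide_inverse mult.commute)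
qed

lemma norm_terminant_le_Re:
  assumes "Re q \<ge> 0"
  shows "norm (terminant p q) \<le> Gamma p"
  using norm_terminant_le[of 1 q] norm_one_plus_ge_1[OF assms] by simp

lemma norm_terminant_le_Im:
  assumes "Im q \<noteq> 0"
  shows "norm (terminant p q) \<le> Gamma p * (norm q / \<bar>Im q\<bar>)"
proof -
  have "q \<noteq> 0" using assms by auto
  then have "\<bar>Im q\<bar> / norm q > 0" using assms by simp
  from norm_terminant_le[OF this] norm_one_plus_ge_Im[OF assms] show ?thesis by simp
qed

lemma terminant_holomorphic: "terminant p holomorphic_on - \<real>\<^sub>\<le>\<^sub>0"
proof -
  have "(\<lambda>q. LINT u:{0<..}|lborel. gamma_weight (of_real p) u * inverse (1 + of_real u * q))
      holomorphic_on - \<real>\<^sub>\<le>\<^sub>0"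
  proof (rule holomorphic_on_set_integral_weighted)
    fix q :: complex assume "q \<in> - \<real>\<^sub>\<le>\<^sub>0"
    then have q: "q \<notin> \<real>\<^sub>\<le>\<^sub>0" by simp
    show "continuous_on {0<..} (\<lambda>u. inverse (1 + of_real u * q))"
      by (intro continuous_intros) (use one_plus_mult_nonzero[OF q] in auto)
    obtain e d where "e > 0" "d > 0" "\<And>w u. w \<in> ball q e \<Longrightarrow> u \<ge> 0 \<Longrightarrow> norm (1 + of_real u * w) \<ge> d"
      by (rule norm_one_plus_locally_bounded_below[OF q]) blast
    then show "\<exists>e>0. \<exists>C. \<forall>w\<in>ball q e \<inter> - \<real>\<^sub>\<le>\<^sub>0. \<forall>u\<in>{0<..}. norm (inverse (1 + of_real u * w)) \<le> C"
      by (intro exI[of _ e] conjI exI[of _ "inverse d"])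
        (auto simp: norm_inverse intro!: le_imp_inverse_le)
  qed (use p one_plus_mult_nonzero in \<open>auto intro!: holomorphic_intros gamma_weight_integrable\<close>)
  then show ?thesis
    by (simp add: terminant_def[abs_def] divide_inverse)
qed

end

lemma terminant_plus1:
  assumes p: "p > 0" and q: "q \<notin> \<real>\<^sub>\<le>\<^sub>0"
  shows "terminant p q = of_real (Gamma p) - q * terminant (p + 1) q"
proof -
  have "terminant p q = (LINT u:{0<..}|lborel. gamma_weight (of_real p) u -
      q * (gamma_weight (of_real (p + 1)) u / (1 + of_real u * q)))"
    unfolding terminant_def
  proof (rule set_integral_cong)
    fix u :: real assume u: "u \<in> {0<..}"
    then have "1 + of_real u * q \<noteq> 0"
      using one_plus_mult_nonzero[OF q, of u] by simp
    then show "gamma_weight (of_real p) u / (1 + of_real u * q) =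
        gamma_weight (of_real p) u - q * (gamma_weight (of_real (p + 1)) u / (1 + of_real u * q))"
      using u gamma_weight_plus1[of u "of_real p"] by (simp add: field_simps)
  qed
  also have "\<dots> = (LINT u:{0<..}|lborel. gamma_weight (of_real p) u) -
      (LINT u:{0<..}|lborel. q * (gamma_weight (of_real (p + 1)) u / (1 + of_real u * q)))"
    using p q by (intro set_integral_diff(2) set_integrable_mult_right
        gamma_weight_integrable terminant_integrable) auto
  also have "\<dots> = of_real (Gamma p) - q * terminant (p + 1) q"
    using p by (simp only: set_integral_mult_right terminant_def gamma_weight_integral
        Re_complex_of_real Gamma_complex_of_real)
  finally show ?thesis .
qed

lemma terminant_cnj: "terminant p (cnj q) = cnj (terminant p q)"
proof -
  have "terminant p (cnj q) =
      (LINT u:{0<..}|lborel. cnj (gamma_weight (of_real p) u / (1 + of_real u * q)))"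
    unfolding terminant_def by (rule set_integral_cong) (simp add: gamma_weight_of_real)
  then show ?thesis
    unfolding terminant_def set_lebesgue_integral_def
    by (subst Bochner_Integration.integral_cnj[symmetric]) simp
qed

lemma
  assumes "Im s > 0"
  shows exp_i_Ioi_integrable: "set_integrable lborel {0<..} (\<lambda>y. exp (\<i> * s * of_real y))"
    and exp_i_Ioi_integral: "(LINT y:{0<..}|lborel. exp (\<i> * s * of_real y)) = \<i> / s"
proof -
  have "Re (- \<i> * s) > 0" using assms by simp
  note exp_Ioi = exp_Ioi_integrable[OF this] exp_Ioi_integral[OF this]
  show "set_integrable lborel {0<..} (\<lambda>y. exp (\<i> * s * of_real y))"
    using exp_Ioi(1) by simp
  show "(LINT y:{0<..}|lborel. exp (\<i> * s * of_real y)) = \<i> / s"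
    using exp_Ioi(2) by (simp add: divide_inverse)
qed

lemma gamma_weight_exp_i_Fubini:
  assumes a: "Re a > 0" and z: "Im z > 0"
  shows "(LINT u:{0<..}|lborel. LINT y:{0<..}|lborel. gamma_weight a u *
      exp (\<i> * (z + of_real u) * of_real y)) =
    (LINT y:{0<..}|lborel. LINT u:{0<..}|lborel. gamma_weight a u *
      exp (\<i> * (z + of_real u) * of_real y))"
proof (rule set_integral_Fubini)
  have "continuous_on ({0<..} \<times> {0<..}) (\<lambda>(u, y::real). gamma_weight a u)"
    unfolding case_prod_unfold
    by (rule continuous_on_compose2[OF continuous_on_gamma_weight]) (auto intro!: continuous_intros)
  then show "continuous_on ({0<..} \<times> {0<..})
      (\<lambda>x. gamma_weight a (fst x) * exp (\<i> * (z + of_real (fst x)) * of_real (snd x)))"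
    by (intro continuous_on_mult continuous_intros) (simp_all add: case_prod_unfold)
  show "set_integrable lborel {0<..}
      (\<lambda>y. gamma_weight a u * exp (\<i> * (z + of_real u) * of_real y))" for u
    by (intro set_integrable_mult_right exp_i_Ioi_integrable) (use z in simp)
  have "(LINT y:{0<..}|lborel. norm (gamma_weight a u * exp (\<i> * (z + of_real u) * of_real y))) =
      norm (gamma_weight a u) * (1 / Im z)" for u
    unfolding exp_Ioi_integral_real[OF z, symmetric] set_integral_mult_right[symmetric]
    by (rule set_integral_cong) (simp add: norm_mult)
  then show "set_integrable lborel {0<..}
      (\<lambda>u. LINT y:{0<..}|lborel. norm (gamma_weight a u * exp (\<i> * (z + of_real u) * of_real y)))"
    using set_integrable_norm[OF gamma_weight_integrable[OF a]] by simp
qed auto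

lemma gamma_weight_stieltjes_laplace:
  assumes a: "Re a > 0" and z: "Im z > 0"
  shows "(LINT u:{0<..}|lborel. gamma_weight a u / (z + of_real u)) =
    - \<i> * Gamma a * (LINT y:{0<..}|lborel. exp (\<i> * z * of_real y) *
      (1 - \<i> * of_real y) powr (- a))"
proof -
  have inner_y: "gamma_weight a u / (z + of_real u) =
      - \<i> * (LINT y:{0<..}|lborel. gamma_weight a u * exp (\<i> * (z + of_real u) * of_real y))" for u
    using z by (subst set_integral_mult_right, subst exp_i_Ioi_integral)
      (auto simp: mult.left_commute[of \<i>])
  have inner_u: "(LINT u:{0<..}|lborel. gamma_weight a u * exp (\<i> * (z + of_real u) * of_real y)) =
      Gamma a * (exp (\<i> * z * of_real y) * (1 - \<i> * of_real y) powr (- a))" for y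
  proof -
    have "(LINT u:{0<..}|lborel. gamma_weight a u * exp (\<i> * (z + of_real u) * of_real y)) =
        (LINT u:{0<..}|lborel. exp (\<i> * z * of_real y) *
          (complex_of_real u powr (a - 1) * exp (- ((1 - \<i> * of_real y) * of_real u))))"
      by (rule set_integral_cong)
        (simp add: gamma_weight_def algebra_simps flip: exp_of_real exp_add)
    also have "\<dots> = exp (\<i> * z * of_real y) * (Gamma a * (1 - \<i> * of_real y) powr (- a))"
      by (subst set_integral_mult_right, subst Gamma_complex_integral_scaled) (use a in auto)
    finally show ?thesis
      by (simp only: mult_ac)
  qed
  have "(LINT u:{0<..}|lborel. gamma_weight a u / (z + of_real u)) = - \<i> *
      (LINT u:{0<..}|lborel. LINT y:{0<..}|lborel. gamma_weight a u *
        exp (\<i> * (z + of_real u) * of_real y))"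
    by (simp only: inner_y set_integral_mult_right)
  also have "\<dots> = - \<i> *
      (LINT y:{0<..}|lborel. LINT u:{0<..}|lborel. gamma_weight a u *
        exp (\<i> * (z + of_real u) * of_real y))"
    by (simp only: gamma_weight_exp_i_Fubini[OF a z])
  finally show ?thesis
    unfolding inner_u set_integral_mult_right by (simp only: mult.assoc)
qed

lemma terminant_plus1_laplace:
  assumes p: "p > 0" and q: "Im q < 0"
  shows "q * terminant (p + 1) q = - \<i> * of_real (Gamma (p + 1)) *
    (LINT y:{0<..}|lborel. exp (\<i> / q * of_real y) * (1 - \<i> * of_real y) powr (- of_real (p + 1)))"
proof -
  have "q \<noteq> 0" and z: "Im (1 / q) > 0"
    using q by (auto simp: Im_divide field_simps sum_power2_gt_zero_iff)
  have "q * terminant (p + 1) q =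
      (LINT u:{0<..}|lborel. q * (gamma_weight (of_real (p + 1)) u / (1 + of_real u * q)))"
    unfolding terminant_def by (rule set_integral_mult_right[symmetric])
  also have "\<dots> = (LINT u:{0<..}|lborel. gamma_weight (of_real (p + 1)) u / (1 / q + of_real u))"
    using \<open>q \<noteq> 0\<close> by (intro set_integral_cong) (simp add: divide_simps mult.commute)
  finally show ?thesis
    using p gamma_weight_stieltjes_laplace[OF _ z, of "of_real (p + 1)"]
    by (simp add: Gamma_complex_of_real del: of_real_add)
qed

lemma chi_nonneg: "p > 0 \<Longrightarrow> chi p \<ge> 0"
  unfolding chi_def by (simp add: Gamma_real_pos less_imp_le)

text \<open>In the Laplace representation the integrand is bounded by
  \<open>(1 + y\<^sup>2) powr (- (p + 1) / 2)\<close>, uniformly in \<open>q\<close>.\<close>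

lemma norm_terminant_le_chi_lower:
  assumes p: "p > 0" and q: "Im q < 0"
  shows "norm (terminant p q) \<le> Gamma p * (1 + chi p)"
proof -
  have "q \<notin> \<real>\<^sub>\<le>\<^sub>0" using q by (auto simp: complex_nonpos_Reals_iff)
  have bound: "norm (exp (\<i> / q * of_real y) * (1 - \<i> * of_real y) powr (- of_real (p + 1))) \<le>
      (1 + y\<^sup>2) powr (- ((p + 1) / 2))" if "y \<in> {0<..}" for y
  proof -
    have "Re (\<i> / q * of_real y) = Im q * y / (norm q)\<^sup>2"
      by (simp add: Re_divide Im_divide cmod_power2 field_simps)
    also have "\<dots> \<le> 0"
      using q that by (intro divide_nonpos_nonneg mult_nonpos_nonneg) auto
    finally have "norm (exp (\<i> / q * of_real y)) \<le> 1"
      by simp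
    moreover have "norm ((1 - \<i> * of_real y) powr (- complex_of_real (p + 1))) =
        (1 + y\<^sup>2) powr (- ((p + 1) / 2))"
      by (subst norm_powr_real_powr')
        (simp_all add: cmod_def powr_half_sqrt[symmetric] powr_powr minus_divide_left)
    ultimately show ?thesis
      by (simp only: norm_mult mult_left_le_one_le norm_ge_zero powr_ge_zero)
  qed
  have "norm (q * terminant (p + 1) q) \<le> Gamma (p + 1) * (chi p / p)"
    unfolding terminant_plus1_laplace[OF p q] norm_mult chi_integral[OF p, symmetric]
    using p norm_set_integral_le[OF chi_integrable[OF p] bound]
    by (simp add: abs_of_pos Gamma_real_pos)
  also have "\<dots> = Gamma p * chi p"
    using p by (subst Gamma_plus1) (auto elim!: nonpos_Ints_cases)
  finally have "norm (of_real (Gamma p) - q * terminant (p + 1) q) \<le> Gamma p + Gamma p * chi p"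
    using p norm_triangle_ineq4[of "of_real (Gamma p)" "q * terminant (p + 1) q"]
    by (simp add: abs_of_pos Gamma_real_pos)
  then show ?thesis
    unfolding terminant_plus1[OF p \<open>q \<notin> \<real>\<^sub>\<le>\<^sub>0\<close>] by (simp add: algebra_simps)
qed

lemma norm_terminant_le_chi:
  assumes p: "p > 0" and q: "q \<notin> \<real>\<^sub>\<le>\<^sub>0"
  shows "norm (terminant p q) \<le> Gamma p * (1 + chi p)"
proof -
  consider "Im q < 0" | "Im q > 0" | "Re q \<ge> 0"
    using q by (force simp: complex_nonpos_Reals_iff)
  then show ?thesis
  proof cases
    case 1
    then show ?thesis by (rule norm_terminant_le_chi_lower[OF p])
  next
    case 2
    then show ?thesis
      using norm_terminant_le_chi_lower[OF p, of "cnj q"] by (simp add: terminant_cnj)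
  next
    case 3
    then have "norm (terminant p q) \<le> Gamma p"
      using p by (intro norm_terminant_le_Re)
    also have "\<dots> \<le> Gamma p * (1 + chi p)"
      using p chi_nonneg[of p] by (simp add: algebra_simps Gamma_real_pos less_imp_le)
    finally show ?thesis .
  qed
qed

section \<open>The remainder function\<close>

lemma of_real_mult_notin_nonpos_Reals:
  assumes "y \<notin> \<real>\<^sub>\<le>\<^sub>0" "c > 0"
  shows "complex_of_real c * y \<notin> \<real>\<^sub>\<le>\<^sub>0"
  using assms by (auto simp: complex_nonpos_Reals_iff mult_le_0_iff)

lemma divide_of_real_notin_nonpos_Reals:
  assumes "x \<notin> \<real>\<^sub>\<le>\<^sub>0" "t > 0"
  shows "x / complex_of_real t \<notin> \<real>\<^sub>\<le>\<^sub>0"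
  using of_real_mult_notin_nonpos_Reals[OF assms(1), of "1 / t"] assms(2) by simp

definition terminant_beta :: "real \<Rightarrow> complex \<Rightarrow> complex \<Rightarrow> complex" where
  "terminant_beta p \<mu> y = (LINT r:{0<..<1}|lborel.
     beta_weight (of_real p + \<mu>) (of_real p - \<mu>) r * terminant p (of_real (2 * r * (1 - r)) * y))"

lemma continuous_on_terminant_ray:
  assumes p: "p > 0" and y: "y \<notin> \<real>\<^sub>\<le>\<^sub>0"
  shows "continuous_on {0<..<1} (\<lambda>r. terminant p (of_real (2 * r * (1 - r)) * y))"
  by (rule continuous_on_compose2[OF holomorphic_on_imp_continuous_on[OF terminant_holomorphic[OF p]]])
    (use of_real_mult_notin_nonpos_Reals[OF y, of "2 * _ * (1 - _)"]
      in \<open>auto intro!: continuous_intros\<close>)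

lemma norm_terminant_ray_le:
  assumes "p > 0" "y \<notin> \<real>\<^sub>\<le>\<^sub>0" "c > 0"
  shows "norm (terminant p (of_real c * y)) \<le> Gamma p * (1 + chi p)"
  by (intro norm_terminant_le_chi of_real_mult_notin_nonpos_Reals assms)

lemma terminant_beta_integrable:
  assumes \<mu>: "\<bar>Re \<mu>\<bar> < p" and y: "y \<notin> \<real>\<^sub>\<le>\<^sub>0"
  shows "set_integrable lborel {0<..<1} (\<lambda>r.
    beta_weight (of_real p + \<mu>) (of_real p - \<mu>) r * terminant p (of_real (2 * r * (1 - r)) * y))"
  by (rule set_integrable_weighted[OF beta_weight_integrable _ continuous_on_terminant_ray
        norm_terminant_ray_le]) (use \<mu> y in auto)

lemma norm_terminant_beta_le:
  assumes \<mu>: "\<bar>Re \<mu>\<bar> < p" and B: "\<And>c. c > 0 \<Longrightarrow> norm (terminant p (of_real c * y)) \<le> B"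
  shows "norm (terminant_beta p \<mu> y) \<le> B * Beta (p + Re \<mu>) (p - Re \<mu>)"
proof -
  have pos: "Re (of_real p + \<mu>) > 0" "Re (of_real p - \<mu>) > 0"
    using \<mu> by auto
  have "norm (terminant_beta p \<mu> y) \<le>
      B * (LINT r:{0<..<1}|lborel. norm (beta_weight (of_real p + \<mu>) (of_real p - \<mu>) r))"
    unfolding terminant_beta_def
    by (rule norm_set_integral_weighted_le[OF beta_weight_integrable[OF pos] B]) auto
  then show ?thesis
    unfolding beta_weight_integral_norm[OF pos] by simp
qed

lemma terminant_beta_holomorphic:
  assumes U: "open U" and hol: "\<mu> holomorphic_on U" "y holomorphic_on U"
    and \<mu>: "\<And>z. z \<in> U \<Longrightarrow> \<bar>Re (\<mu> z)\<bar> < p" and y: "\<And>z. z \<in> U \<Longrightarrow> y z \<notin> \<real>\<^sub>\<le>\<^sub>0"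
  shows "(\<lambda>z. terminant_beta p (\<mu> z) (y z)) holomorphic_on U"
  unfolding terminant_beta_def
proof (rule beta_transform_holomorphic[OF U])
  fix r :: real assume r: "r \<in> {0<..<1}"
  show "(\<lambda>z. terminant p (of_real (2 * r * (1 - r)) * y z)) holomorphic_on U"
  proof (cases "U = {}")
    case False
    then have "p > 0" using \<mu> by force
    show ?thesis
      by (rule holomorphic_on_compose_gen[OF _ terminant_holomorphic[OF \<open>p > 0\<close>], unfolded o_def])
        (use of_real_mult_notin_nonpos_Reals[OF y, of _ "2 * r * (1 - r)"] r
         in \<open>auto intro!: holomorphic_intros hol\<close>)
  qed (simp add: holomorphic_on_def)
next
  fix z assume z: "z \<in> U"
  then have p: "p > 0" using \<mu>[OF z] by linarith
  show "continuous_on {0<..<1} (\<lambda>r. terminant p (of_real (2 * r * (1 - r)) * y z))"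
    using p y[OF z] by (rule continuous_on_terminant_ray)
  have "norm (terminant p (of_real (2 * r * (1 - r)) * y v)) \<le> Gamma p * (1 + chi p)"
    if "v \<in> ball z 1 \<inter> U" "r \<in> {0<..<1}" for v r
    using that by (intro norm_terminant_ray_le p y) auto
  then show "\<exists>e>0. \<exists>C. \<forall>v\<in>ball z e \<inter> U. \<forall>r\<in>{0<..<1}.
      norm (terminant p (of_real (2 * r * (1 - r)) * y v)) \<le> C"
    using zero_less_one by blast
  show "Re (of_real p + \<mu> z) > 0" "Re (of_real p - \<mu> z) > 0"
    using \<mu>[OF z] by auto
qed (intro holomorphic_intros hol)+

lemma terminant_beta_plus1:
  assumes \<mu>: "\<bar>Re \<mu>\<bar> < p" and y: "y \<notin> \<real>\<^sub>\<le>\<^sub>0"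
  shows "terminant_beta p \<mu> y =
    of_real (Gamma p) * Beta (of_real p + \<mu>) (of_real p - \<mu>) - 2 * y * terminant_beta (p + 1) \<mu> y"
proof -
  let ?w = "\<lambda>p. beta_weight (of_real p + \<mu>) (of_real p - \<mu>)"
  let ?f = "\<lambda>p r. ?w p r * terminant p (of_real (2 * r * (1 - r)) * y)"
  have p: "p > 0" using \<mu> by linarith
  have pos: "Re (of_real p + \<mu>) > 0" "Re (of_real p - \<mu>) > 0"
    using \<mu> by auto
  have "terminant_beta p \<mu> y =
      (LINT r:{0<..<1}|lborel. of_real (Gamma p) * ?w p r - 2 * y * ?f (p + 1) r)"
    unfolding terminant_beta_def
  proof (rule set_integral_cong)
    fix r :: real assume r: "r \<in> {0<..<1}"
    have "of_real (2 * r * (1 - r)) * y \<notin> \<real>\<^sub>\<le>\<^sub>0"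
      using r by (intro of_real_mult_notin_nonpos_Reals y) auto
    note terminant_rec = terminant_plus1[OF p this]
    have weight_rec: "?w (p + 1) r = of_real (r * (1 - r)) * ?w p r"
      using beta_weight_plus1[OF r, of "of_real p + \<mu>" "of_real p - \<mu>"] by (simp add: algebra_simps)
    show "?f p r = of_real (Gamma p) * ?w p r - 2 * y * ?f (p + 1) r"
      unfolding terminant_rec weight_rec by (simp add: algebra_simps)
  qed
  also have "\<dots> = (LINT r:{0<..<1}|lborel. of_real (Gamma p) * ?w p r) -
      (LINT r:{0<..<1}|lborel. 2 * y * ?f (p + 1) r)"
    by (intro set_integral_diff(2) set_integrable_mult_right beta_weight_integrable
        terminant_beta_integrable y pos) (use \<mu> in auto)
  also have "\<dots> = of_real (Gamma p) * Beta (of_real p + \<mu>) (of_real p - \<mu>) -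
      2 * y * terminant_beta (p + 1) \<mu> y"
    by (simp only: set_integral_mult_right beta_weight_integral[OF pos] terminant_beta_def)
  finally show ?thesis .
qed

definition legendre_rem :: "nat \<Rightarrow> complex \<Rightarrow> complex \<Rightarrow> complex \<Rightarrow> complex" where
  "legendre_rem N x \<mu> \<nu> = (- 2) ^ N * cos (of_real pi * \<mu>) / of_real (pi powr (3/2)) * x ^ N *
     (LINT t:{0<..}|lborel. gamma_weight (\<nu> - of_nat N + 1/2) t *
        terminant_beta (real N + 1/2) \<mu> (x / of_real t))"

lemma norm_terminant_beta_ray_le:
  assumes \<mu>: "\<bar>Re \<mu>\<bar> < p" and B: "\<And>c. c > 0 \<Longrightarrow> norm (terminant p (of_real c * x)) \<le> B"
    and t: "t > 0"
  shows "norm (terminant_beta p \<mu> (x / of_real t)) \<le> B * Beta (p + Re \<mu>) (p - Re \<mu>)"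
proof (rule norm_terminant_beta_le[OF \<mu>])
  show "norm (terminant p (of_real c * (x / of_real t))) \<le> B" if "c > 0" for c
    using B[of "c / t"] t that by simp
qed

lemma continuous_on_terminant_beta_ray:
  assumes \<mu>: "\<bar>Re \<mu>\<bar> < p" and x: "x \<notin> \<real>\<^sub>\<le>\<^sub>0"
  shows "continuous_on {0<..} (\<lambda>t. terminant_beta p \<mu> (x / of_real t))"
proof (rule continuous_on_compose2[where g = "terminant_beta p \<mu>"])
  show "continuous_on (- \<real>\<^sub>\<le>\<^sub>0) (terminant_beta p \<mu>)"
    by (rule holomorphic_on_imp_continuous_on,
        rule terminant_beta_holomorphic[where \<mu> = "\<lambda>_. \<mu>" and y = "\<lambda>y. y"])
      (use \<mu> in \<open>auto intro: holomorphic_intros\<close>)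
  show "continuous_on {0<..} (\<lambda>t. x / complex_of_real t)"
    by (intro continuous_intros) auto
qed (use divide_of_real_notin_nonpos_Reals[OF x] in auto)

lemma Beta_locally_bounded_above:
  fixes p :: real
  assumes U: "open U" and \<mu>: "\<mu> holomorphic_on U" and z: "z \<in> U" "\<bar>Re (\<mu> z)\<bar> < p"
  obtains e where "e > 0"
    "\<And>v. v \<in> ball z e \<Longrightarrow> Beta (p + Re (\<mu> v)) (p - Re (\<mu> v)) < Beta (p + Re (\<mu> z)) (p - Re (\<mu> z)) + 1"
proof -
  let ?b = "\<lambda>v. Beta (p + Re (\<mu> v)) (p - Re (\<mu> v))"
  have "isCont \<mu> z"
    using \<mu> U z(1) by (meson continuous_on_eq_continuous_at holomorphic_on_imp_continuous_on)
  then have "isCont ?b z"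
    unfolding Beta_def using z(2)
    by (intro continuous_intros) (auto simp: Gamma_eq_zero_iff elim!: nonpos_Ints_cases)
  then have "(?b \<longlongrightarrow> ?b z) (nhds z)"
    using tendsto_at_iff_tendsto_nhds[of ?b z] by (simp only: isCont_def)
  then have "\<forall>\<^sub>F v in nhds z. ?b v < ?b z + 1"
    by (rule order_tendstoD(2)) simp
  then show ?thesis
    using that by (auto simp: eventually_nhds_metric dist_commute)
qed

context
  fixes N :: nat and \<nu> :: complex
  assumes \<nu>: "Re \<nu> > real N - 1/2"
begin

lemma legendre_rem_integrable:
  assumes \<mu>: "\<bar>Re \<mu>\<bar> < real N + 1/2" and x: "x \<notin> \<real>\<^sub>\<le>\<^sub>0"
  shows "set_integrable lborel {0<..} (\<lambda>t. gamma_weight (\<nu> - of_nat N + 1/2) t *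
    terminant_beta (real N + 1/2) \<mu> (x / of_real t))"
proof (rule set_integrable_weighted)
  show "continuous_on {0<..} (\<lambda>t. terminant_beta (real N + 1/2) \<mu> (x / of_real t))"
    using \<mu> x by (rule continuous_on_terminant_beta_ray)
  show "norm (terminant_beta (real N + 1/2) \<mu> (x / of_real t)) \<le>
      Gamma (real N + 1/2) * (1 + chi (real N + 1/2)) *
      Beta (real N + 1/2 + Re \<mu>) (real N + 1/2 - Re \<mu>)"
    if "t \<in> {0<..}" for t
    using that by (intro norm_terminant_beta_ray_le \<mu> norm_terminant_ray_le x) auto
qed (use \<nu> in \<open>auto intro: gamma_weight_integrable\<close>)

lemma legendre_rem_holomorphic:
  assumes U: "open U" and hol: "x holomorphic_on U" "\<mu> holomorphic_on U"
    and x: "\<And>z. z \<in> U \<Longrightarrow> x z \<notin> \<real>\<^sub>\<le>\<^sub>0" and \<mu>: "\<And>z. z \<in> U \<Longrightarrow> \<bar>Re (\<mu> z)\<bar> < real N + 1/2"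
  shows "(\<lambda>z. legendre_rem N (x z) (\<mu> z) \<nu>) holomorphic_on U"
proof -
  define p where "p = real N + 1/2"
  have "(\<lambda>z. LINT t:{0<..}|lborel. gamma_weight (\<nu> - of_nat N + 1/2) t *
      terminant_beta p (\<mu> z) (x z / of_real t)) holomorphic_on U"
  proof (rule holomorphic_on_set_integral_weighted[OF U])
    show "(\<lambda>z. terminant_beta p (\<mu> z) (x z / of_real t)) holomorphic_on U" if "t \<in> {0<..}" for t
      by (intro terminant_beta_holomorphic U hol holomorphic_intros
        divide_of_real_notin_nonpos_Reals x)
        (use \<mu> that in \<open>auto simp: p_def\<close>)
    fix z assume z: "z \<in> U"
    show "continuous_on {0<..} (\<lambda>t. terminant_beta p (\<mu> z) (x z / of_real t))"
      using \<mu>[OF z] x[OF z] unfolding p_def by (rule continuous_on_terminant_beta_ray)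
    let ?b = "\<lambda>v. Beta (p + Re (\<mu> v)) (p - Re (\<mu> v))"
    obtain e where e: "e > 0" and b_less: "\<And>v. v \<in> ball z e \<Longrightarrow> ?b v < ?b z + 1"
      using Beta_locally_bounded_above[OF U hol(2) z \<mu>[OF z]] unfolding p_def by blast
    have "norm (terminant_beta p (\<mu> v) (x v / of_real t)) \<le> Gamma p * (1 + chi p) * (?b z + 1)"
      if "v \<in> ball z e \<inter> U" "t \<in> {0<..}" for v t
    proof -
      have "norm (terminant_beta p (\<mu> v) (x v / of_real t)) \<le> Gamma p * (1 + chi p) * ?b v"
        using that \<mu> x by (intro norm_terminant_beta_ray_le norm_terminant_ray_le)
          (auto simp: p_def)
      also have "\<dots> \<le> Gamma p * (1 + chi p) * (?b z + 1)"
        using that b_less[of v] chi_nonneg[of p]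
        by (intro mult_left_mono mult_nonneg_nonneg) (auto simp: p_def Gamma_real_pos less_imp_le)
      finally show ?thesis .
    qed
    then show "\<exists>e>0. \<exists>C. \<forall>v\<in>ball z e \<inter> U. \<forall>t\<in>{0<..}.
        norm (terminant_beta p (\<mu> v) (x v / of_real t)) \<le> C"
      using e by blast
  qed (use \<nu> in \<open>auto intro: gamma_weight_integrable\<close>)
  then show ?thesis
    unfolding legendre_rem_def p_def by (intro holomorphic_intros hol) auto
qed

end

lemma a_coeff_pochhammer:
  fixes \<mu> :: "'a :: field_char_0"
  shows "a_coeff N \<mu> =
    (-1) ^ N * pochhammer (1/2 - \<mu>) N * pochhammer (1/2 + \<mu>) N / (2 ^ N * fact N)"
proof -
  have "(\<Prod>k=1..N. 4 * \<mu>\<^sup>2 - (2 * of_nat k - 1)\<^sup>2) =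
      (-4) ^ N * pochhammer (1/2 - \<mu>) N * pochhammer (1/2 + \<mu>) N"
  proof (induction N)
    case (Suc N)
    have "4 * \<mu>\<^sup>2 - (2 * of_nat (Suc N) - 1)\<^sup>2 = (-4) * (1/2 - \<mu> + of_nat N) * (1/2 + \<mu> + of_nat N)"
      by (simp add: field_simps power2_eq_square)
    then have "(\<Prod>k=1..Suc N. 4 * \<mu>\<^sup>2 - (2 * of_nat k - 1)\<^sup>2) =
        (-4) ^ N * pochhammer (1/2 - \<mu>) N * pochhammer (1/2 + \<mu>) N *
          ((-4) * (1/2 - \<mu> + of_nat N) * (1/2 + \<mu> + of_nat N))"
      using Suc by simp
    then show ?case
      unfolding pochhammer_Suc power_Suc by (simp only: mult_ac)
  qed simp
  moreover have "(8::'a) ^ N = 4 ^ N * 2 ^ N" "(-4::'a) ^ N = (-1) ^ N * 4 ^ N"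
    by (simp_all add: power_mult_distrib[symmetric])
  ultimately show ?thesis unfolding a_coeff_def by simp
qed

lemma a_coeff_of_real: "a_coeff N (complex_of_real m) = of_real (a_coeff N m)"
  by (simp add: a_coeff_def)

lemma cos_pi_of_real: "cos (complex_of_real pi * of_real m) = of_real (cos (pi * m))"
  by (simp flip: cos_of_real)

lemma Gamma_nat_plus_half: "Gamma (real N + 1/2) = fact (2 * N) * sqrt pi / (4 ^ N * fact N)"
proof -
  have "1/2 \<notin> (\<int>\<^sub>\<le>\<^sub>0 :: real set)"
    by (auto elim!: nonpos_Ints_cases)
  then have "Gamma (1/2 + real N) = pochhammer (1/2) N * sqrt pi"
    by (simp add: pochhammer_Gamma Gamma_one_half_real)
  moreover have "fact (2 * N) = (4 ^ N * pochhammer (1/2) N * fact N :: real)"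
    using fact_double[of N, where 'a = real] by (simp add: power_mult)
  ultimately show ?thesis
    by (simp add: add.commute)
qed

lemma a_coeff_Beta:
  assumes "\<bar>Re \<mu>\<bar> < real N + 1/2"
  shows "a_coeff N \<mu> = (- 2) ^ N * cos (of_real pi * \<mu>) / of_real (pi powr (3/2)) *
    (of_real (Gamma (real N + 1/2)) *
      Beta (of_real (real N + 1/2) + \<mu>) (of_real (real N + 1/2) - \<mu>))"
proof -
  define G where "G = Gamma (1/2 + \<mu> + of_nat N) * Gamma (1/2 - \<mu> + of_nat N)"
  have pochhammer_eq: "pochhammer z N = rGamma z * Gamma (z + of_nat N)"
    if "Re (z + of_nat N) > 0" for z :: complex
    using pochhammer_rGamma[of z N] Gamma_arg_notin_nonpos_Ints[OF that]
    by (simp add: Gamma_def rGamma_eq_zero_iff)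
  have "rGamma (1/2 - \<mu>) * rGamma (1/2 + \<mu>) = cos (of_real pi * \<mu>) / of_real pi"
    using rGamma_reflection_complex[of "1/2 - \<mu>"] by (simp add: cos_sin_eq algebra_simps)
  moreover have "pochhammer (1/2 - \<mu>) N * pochhammer (1/2 + \<mu>) N =
      rGamma (1/2 - \<mu>) * rGamma (1/2 + \<mu>) * G"
    using assms by (subst (1 2) pochhammer_eq) (auto simp: G_def)
  ultimately have "a_coeff N \<mu> =
      (- 1) ^ N * cos (of_real pi * \<mu>) / of_real pi * G / (2 ^ N * fact N)"
    unfolding a_coeff_pochhammer by (simp add: mult.assoc)
  moreover have "Beta (of_real (real N + 1/2) + \<mu>) (of_real (real N + 1/2) - \<mu>) = G / fact (2 * N)"
    using Gamma_fact[of "2 * N", where 'a = complex] by (simp add: Beta_def G_def algebra_simps)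
  moreover have "complex_of_real (Gamma (real N + 1/2)) =
      fact (2 * N) * of_real (sqrt pi) / ((2 ^ N * 2 ^ N) * fact N)"
    by (simp add: Gamma_nat_plus_half flip: power_mult_distrib)
  moreover have "pi powr (3/2) = pi * sqrt pi"
    using powr_add[of pi 1 "1/2"] by (simp add: powr_half_sqrt)
  moreover have "(- 2 :: complex) ^ N = (- 1) ^ N * 2 ^ N"
    by (simp add: power_mult_distrib[symmetric])
  ultimately show ?thesis
    by (simp only: of_real_mult) simp
qed

lemma cos_pi_eq_0_iff: "cos (pi * x) = 0 \<longleftrightarrow> (\<exists>k::int. odd k \<and> 2 * x = of_int k)"
  unfolding cos_zero_iff_int by (intro ex_cong1 conj_cong refl) (auto simp: field_simps)

lemma eventually_cos_pi_nonzero: "\<forall>\<^sub>F t in at x. cos (pi * t) \<noteq> 0"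
proof (cases "cos (pi * x) = 0")
  case False
  have "((\<lambda>t. cos (pi * t)) \<longlongrightarrow> cos (pi * x)) (at x)"
    by (intro tendsto_intros)
  then show ?thesis
    using False by (rule tendsto_imp_eventually_ne)
next
  case True
  then have "pi * - sin (pi * x) \<noteq> 0"
    by (metis abs_0 mult_eq_0_iff neg_equal_0_iff_equal pi_neq_zero sin_zero_abs_cos_one
      zero_neq_one)
  moreover have "((\<lambda>t. cos (pi * t)) has_field_derivative pi * - sin (pi * x)) (at x)"
    by (auto intro!: derivative_eq_intros)
  ultimately have "\<forall>\<^sub>F t in at x. (cos (pi * t) - cos (pi * x)) / (t - x) \<noteq> 0"
    unfolding has_field_derivative_iff by (intro tendsto_imp_eventually_ne)
  then show ?thesis
    by (rule eventually_mono) (use True in auto)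
qed

lemma a_coeff_Beta_real:
  assumes "\<bar>m\<bar> < real N + 1/2"
  shows "a_coeff N m = (- 1) ^ N * cos (pi * m) * (2 ^ N / pi powr (3/2) *
    (Gamma (real N + 1/2) * Beta (real N + 1/2 + m) (real N + 1/2 - m)))"
proof -
  have "complex_of_real (a_coeff N m) = of_real ((- 2) ^ N * cos (pi * m) / pi powr (3/2) *
      (Gamma (real N + 1/2) * Beta (real N + 1/2 + m) (real N + 1/2 - m)))"
    using assms a_coeff_Beta[of "of_real m" N]
    by (simp only: a_coeff_of_real[symmetric] Beta_complex_of_real[symmetric]
      cos_pi_of_real[symmetric]
        of_real_mult of_real_divide of_real_power of_real_add of_real_diff Re_complex_of_real) simp
  moreover have "(- 2 :: real) ^ N = (- 1) ^ N * 2 ^ N"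
    by (simp add: power_mult_distrib[symmetric])
  ultimately show ?thesis
    unfolding of_real_eq_iff by simp
qed

lemma a_cos_ratio_Beta:
  assumes m: "\<bar>m\<bar> < real N + 1/2"
  shows "a_cos_ratio N m =
    2 ^ N / pi powr (3/2) * (Gamma (real N + 1/2) * Beta (real N + 1/2 + m) (real N + 1/2 - m))"
proof -
  define g where "g t = 2 ^ N / pi powr (3/2) *
    (Gamma (real N + 1/2) * Beta (real N + 1/2 + t) (real N + 1/2 - t))" for t
  have ratio: "\<bar>a_coeff N t\<bar> / \<bar>cos (pi * t)\<bar> = g t"
    if t: "\<bar>t\<bar> < real N + 1/2" "cos (pi * t) \<noteq> 0" for t
  proof -
    have "g t > 0"
      using t(1) unfolding g_def Beta_def
      by (intro mult_pos_pos divide_pos_pos Gamma_real_pos) auto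
    then show ?thesis
      using t(2) unfolding a_coeff_Beta_real[OF t(1)] g_def[symmetric] by (simp add: abs_mult)
  qed
  have "a_cos_ratio N m = g m"
  proof (cases "cos (pi * m) = 0")
    case False
    then show ?thesis
      using ratio[OF m] by (auto simp: a_cos_ratio_def cos_pi_eq_0_iff)
  next
    case True
    have "open {t. \<bar>t\<bar> < real N + 1/2}"
      by (intro open_Collect_less continuous_intros)
    then have "\<forall>\<^sub>F t in at m. t \<in> {t. \<bar>t\<bar> < real N + 1/2}"
      using m by (intro eventually_at_in_open') auto
    then have "\<forall>\<^sub>F t in at m. g t = \<bar>a_coeff N t\<bar> / \<bar>cos (pi * t)\<bar>"
      using eventually_cos_pi_nonzero by eventually_elim (use ratio in auto)
    moreover have "(g \<longlongrightarrow> g m) (at m)"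
      unfolding g_def Beta_def
      by (intro tendsto_intros) (use m in \<open>auto simp: Gamma_eq_zero_iff elim!: nonpos_Ints_cases\<close>)
    ultimately have "((\<lambda>t. \<bar>a_coeff N t\<bar> / \<bar>cos (pi * t)\<bar>) \<longlongrightarrow> g m) (at m)"
      by (rule Lim_transform_eventually[rotated])
    then have "Lim (at m) (\<lambda>t. \<bar>a_coeff N t\<bar> / \<bar>cos (pi * t)\<bar>) = g m"
      by (intro tendsto_Lim) auto
    then show ?thesis
      using True by (auto simp: a_cos_ratio_def cos_pi_eq_0_iff)
  qed
  then show ?thesis
    by (simp add: g_def)
qed

lemma a_cos_ratio_pos:
  assumes "\<bar>m\<bar> < real N + 1/2"
  shows "a_cos_ratio N m > 0"
  unfolding a_cos_ratio_Beta[OF assms] Beta_def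
  using assms by (intro mult_pos_pos divide_pos_pos Gamma_real_pos) auto

lemma a_coeff_eq_a_cos_ratio:
  assumes "\<bar>m\<bar> < real N + 1/2"
  shows "a_coeff N m = (- 1) ^ N * cos (pi * m) * a_cos_ratio N m"
  using a_coeff_Beta_real[OF assms] by (simp only: a_cos_ratio_Beta[OF assms])

definition legendre_rem_bound :: "nat \<Rightarrow> complex \<Rightarrow> complex \<Rightarrow> complex \<Rightarrow> real" where
  "legendre_rem_bound N x \<mu> \<nu> =
    norm (cos (of_real pi * \<mu>)) * a_cos_ratio N (Re \<mu>) * Gamma (Re \<nu> - real N + 1/2) * norm x ^ N"

context
  fixes N :: nat and \<mu> \<nu> :: complex
  assumes \<mu>: "\<bar>Re \<mu>\<bar> < real N + 1/2" and \<nu>: "Re \<nu> > real N - 1/2"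
begin

lemma norm_legendre_rem_le:
  assumes B: "\<And>c. c > 0 \<Longrightarrow>
    norm (terminant (real N + 1/2) (of_real c * x)) \<le> Gamma (real N + 1/2) * B"
  shows "norm (legendre_rem N x \<mu> \<nu>) \<le> legendre_rem_bound N x \<mu> \<nu> * B"
proof -
  let ?p = "real N + 1/2"
  let ?w = "gamma_weight (\<nu> - of_nat N + 1/2)"
  have pos: "Re (\<nu> - of_nat N + 1/2) > 0"
    using \<nu> by simp
  have "norm (LINT t:{0<..}|lborel. ?w t * terminant_beta ?p \<mu> (x / of_real t)) \<le>
      Gamma ?p * B * Beta (?p + Re \<mu>) (?p - Re \<mu>) * (LINT t:{0<..}|lborel. norm (?w t))"
    by (intro norm_set_integral_weighted_le gamma_weight_integrable pos
        norm_terminant_beta_ray_le \<mu> B) auto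
  also have "(LINT t:{0<..}|lborel. norm (?w t)) = Gamma (Re \<nu> - real N + 1/2)"
    using gamma_weight_integral_norm[OF pos] by simp
  finally have "norm (LINT t:{0<..}|lborel. ?w t * terminant_beta ?p \<mu> (x / of_real t)) \<le>
      Gamma ?p * B * Beta (?p + Re \<mu>) (?p - Re \<mu>) * Gamma (Re \<nu> - real N + 1/2)" .
  then have "norm (legendre_rem N x \<mu> \<nu>) \<le>
      2 ^ N * norm (cos (of_real pi * \<mu>)) / pi powr (3/2) * norm x ^ N *
      (Gamma ?p * B * Beta (?p + Re \<mu>) (?p - Re \<mu>) * Gamma (Re \<nu> - real N + 1/2))"
    unfolding legendre_rem_def norm_mult norm_divide norm_power
    by (intro mult_mono) (auto simp: norm_mult)
  then show ?thesis
    unfolding legendre_rem_bound_def a_cos_ratio_Beta[OF \<mu>] by (simp add: mult_ac)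
qed

lemma norm_legendre_rem_le_Re:
  assumes "Re x \<ge> 0"
  shows "norm (legendre_rem N x \<mu> \<nu>) \<le> legendre_rem_bound N x \<mu> \<nu>"
  using norm_legendre_rem_le[of x 1] norm_terminant_le_Re[of "real N + 1/2"] assms by simp

lemma norm_legendre_rem_le_chi:
  assumes "x \<notin> \<real>\<^sub>\<le>\<^sub>0"
  shows "norm (legendre_rem N x \<mu> \<nu>) \<le> legendre_rem_bound N x \<mu> \<nu> * (1 + chi (real N + 1/2))"
  by (rule norm_legendre_rem_le, rule norm_terminant_ray_le) (use assms in auto)

lemma norm_legendre_rem_le_Im:
  assumes x: "Im x \<noteq> 0"
  shows "norm (legendre_rem N x \<mu> \<nu>) \<le> legendre_rem_bound N x \<mu> \<nu> * (norm x / \<bar>Im x\<bar>)"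
proof (rule norm_legendre_rem_le)
  fix c :: real assume c: "c > 0"
  have "norm (of_real c * x) / \<bar>Im (of_real c * x)\<bar> = norm x / \<bar>Im x\<bar>"
    using c by (simp add: norm_mult abs_mult)
  moreover have "Im (of_real c * x) \<noteq> 0"
    using c x by simp
  ultimately show "norm (terminant (real N + 1/2) (of_real c * x)) \<le>
      Gamma (real N + 1/2) * (norm x / \<bar>Im x\<bar>)"
    using norm_terminant_le_Im[of "real N + 1/2" "of_real c * x"] by simp
qed

end

lemma legendre_rem_Suc:
  assumes \<mu>: "\<bar>Re \<mu>\<bar> < real N + 1/2" and x: "x \<notin> \<real>\<^sub>\<le>\<^sub>0" and \<nu>: "Re \<nu> > real (Suc N) - 1/2"
  shows "legendre_rem N x \<mu> \<nu> =
    a_coeff N \<mu> * Gamma (\<nu> - of_nat N + 1/2) * x ^ N + legendre_rem (Suc N) x \<mu> \<nu>"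
proof -
  define K where "K = of_real (Gamma (real N + 1/2)) *
    Beta (of_real (real N + 1/2) + \<mu>) (of_real (real N + 1/2) - \<mu>)"
  let ?w = "\<lambda>N. gamma_weight (\<nu> - of_nat N + 1/2)"
  let ?f = "\<lambda>N t. ?w N t * terminant_beta (real N + 1/2) \<mu> (x / of_real t)"
  have pos: "Re (\<nu> - of_nat N + 1/2) > 0"
    using \<nu> by simp
  have "(LINT t:{0<..}|lborel. ?f N t) = (LINT t:{0<..}|lborel. K * ?w N t - 2 * x * ?f (Suc N) t)"
  proof (rule set_integral_cong)
    fix t :: real assume t: "t \<in> {0<..}"
    have "x / of_real t \<notin> \<real>\<^sub>\<le>\<^sub>0"
      using divide_of_real_notin_nonpos_Reals[OF x] t by auto
    from terminant_beta_plus1[OF \<mu> this]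
    have beta_rec: "terminant_beta (real N + 1/2) \<mu> (x / of_real t) =
        K - 2 * x / of_real t * terminant_beta (real (Suc N) + 1/2) \<mu> (x / of_real t)"
      by (simp add: K_def add_ac)
    have "?w N t = of_real t * ?w (Suc N) t"
      using t gamma_weight_plus1[of t "\<nu> - of_nat (Suc N) + 1/2"] by (simp add: algebra_simps)
    then show "?f N t = K * ?w N t - 2 * x * ?f (Suc N) t"
      unfolding beta_rec using t by (simp add: algebra_simps)
  qed
  also have "\<dots> = (LINT t:{0<..}|lborel. K * ?w N t) - (LINT t:{0<..}|lborel. 2 * x * ?f (Suc N) t)"
    by (intro set_integral_diff(2) set_integrable_mult_right gamma_weight_integrable pos
        legendre_rem_integrable x \<nu>) (use \<mu> in auto)
  also have "\<dots> = K * Gamma (\<nu> - of_nat N + 1/2) - 2 * x * (LINT t:{0<..}|lborel. ?f (Suc N) t)"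
    by (simp only: set_integral_mult_right gamma_weight_integral[OF pos])
  finally have integral_rec: "(LINT t:{0<..}|lborel. ?f N t) =
      K * Gamma (\<nu> - of_nat N + 1/2) - 2 * x * (LINT t:{0<..}|lborel. ?f (Suc N) t)" .
  show ?thesis
    unfolding legendre_rem_def integral_rec a_coeff_Beta[OF \<mu>] K_def[symmetric]
    by (simp add: algebra_simps)
qed

definition legendre_sum :: "nat \<Rightarrow> complex \<Rightarrow> complex \<Rightarrow> complex \<Rightarrow> complex" where
  "legendre_sum N x \<mu> \<nu> =
    (\<Sum>n<N. a_coeff n \<mu> * Gamma (\<nu> - of_nat n + 1/2) * x ^ n) + legendre_rem N x \<mu> \<nu>"

lemma legendre_sum_independent:
  assumes x: "x \<notin> \<real>\<^sub>\<le>\<^sub>0"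
    and "\<bar>Re \<mu>\<bar> < real N + 1/2" "Re \<nu> > real N - 1/2" "\<bar>Re \<mu>\<bar> < real M + 1/2" "Re \<nu> > real M - 1/2"
  shows "legendre_sum N x \<mu> \<nu> = legendre_sum M x \<mu> \<nu>"
proof -
  have add: "legendre_sum (N + k) x \<mu> \<nu> = legendre_sum N x \<mu> \<nu>"
    if "\<bar>Re \<mu>\<bar> < real N + 1/2" "Re \<nu> > real (N + k) - 1/2" for N k
    using that(2)
  proof (induction k)
    case (Suc k)
    then have "legendre_sum (N + k) x \<mu> \<nu> = legendre_sum N x \<mu> \<nu>"
      by simp
    then show ?case
      using legendre_rem_Suc[of \<mu> "N + k" x \<nu>] Suc.prems that(1) x
      by (simp add: legendre_sum_def add.assoc)
  qed simp
  show ?thesis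
    using assms add[of N "M - N"] add[of M "N - M"] by (cases "N \<le> M") simp_all
qed

lemma legendre_sum_holomorphic:
  assumes "Re \<nu> > real N - 1/2" "open U" "x holomorphic_on U" "\<mu> holomorphic_on U"
    and "\<And>z. z \<in> U \<Longrightarrow> x z \<notin> \<real>\<^sub>\<le>\<^sub>0" "\<And>z. z \<in> U \<Longrightarrow> \<bar>Re (\<mu> z)\<bar> < real N + 1/2"
  shows "(\<lambda>z. legendre_sum N (x z) (\<mu> z) \<nu>) holomorphic_on U"
  unfolding legendre_sum_def a_coeff_def
  by (intro holomorphic_intros legendre_rem_holomorphic assms) (use assms in auto)

section \<open>Euler's integral for the remainder\<close>

lemma terminant_integrable_real:
  fixes q :: real
  assumes p: "p > 0" and q: "q > 0"
  shows "set_integrable lborel {0<..} (\<lambda>u. u powr (p - 1) * exp (- u) / (1 + u * q))"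
proof (rule set_integrable_transform)
  show "set_integrable lborel {0<..}
      (\<lambda>u. norm (gamma_weight (of_real p) u / (1 + of_real u * of_real q)))"
    using q by (intro set_integrable_norm terminant_integrable p)
      (simp add: complex_nonpos_Reals_iff)
  fix u :: real assume u: "u \<in> {0<..}"
  then have "norm (1 + of_real u * complex_of_real q) = 1 + u * q"
    using q norm_of_real[of "1 + u * q", where 'a = complex] by (simp add: add_pos_pos)
  then show "norm (gamma_weight (of_real p) u / (1 + of_real u * of_real q)) =
      u powr (p - 1) * exp (- u) / (1 + u * q)"
    using u by (simp add: norm_divide norm_gamma_weight)
qed

lemma terminant_laplace:
  assumes p: "p > 0" and q: "q > 0"
  shows "terminant p (of_real q) =
    of_real (Gamma p * (LINT s:{0<..}|lborel. exp (- s) * (1 + s * q) powr (- p)))"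
proof -
  let ?w = "\<lambda>u::real. u powr (p - 1) * exp (- u)"
  define f where "f u s = ?w u * exp (- ((1 + u * q) * s))" for u s
  have pos: "1 + u * q > 0" if "u > 0" for u
    using that q by (simp add: add_pos_pos)
  have inner: "(LINT s:{0<..}|lborel. f u s) = ?w u / (1 + u * q)" if "u \<in> {0<..}" for u
    using exp_Ioi_integral_real[OF pos] that
    by (simp only: f_def set_integral_mult_right greaterThan_iff) simp
  have "(LINT u:{0<..}|lborel. LINT s:{0<..}|lborel. f u s) =
      (LINT s:{0<..}|lborel. LINT u:{0<..}|lborel. f u s)"
  proof (rule set_integral_Fubini)
    show "continuous_on ({0<..} \<times> {0<..}) (\<lambda>x. f (fst x) (snd x))"
      unfolding f_def by (intro continuous_intros) auto
    show "set_integrable lborel {0<..} (f u)" if "u \<in> {0<..}" for u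
      unfolding f_def by (intro set_integrable_mult_right exp_Ioi_integrable_real)
        (use pos that in auto)
    show "set_integrable lborel {0<..} (\<lambda>u. LINT s:{0<..}|lborel. norm (f u s))"
      by (rule set_integrable_transform[OF terminant_integrable_real[OF p q]])
        (simp add: inner[symmetric] f_def abs_mult)
  qed auto
  also have "\<dots> = (LINT s:{0<..}|lborel. Gamma p * (exp (- s) * (1 + s * q) powr (- p)))"
  proof (rule set_integral_cong)
    fix s :: real assume s: "s \<in> {0<..}"
    have "(LINT u:{0<..}|lborel. f u s) =
        (LINT u:{0<..}|lborel. exp (- s) * (u powr (p - 1) * exp (- ((1 + s * q) * u))))"
      by (rule set_integral_cong)
        (auto simp: f_def exp_add[symmetric] exp_diff[symmetric] algebra_simps)
    also have "\<dots> = exp (- s) * (Gamma p * (1 + s * q) powr (- p))"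
      by (subst set_integral_mult_right, subst Gamma_real_integral_scaled)
        (use p pos[of s] s in auto)
    finally show "(LINT u:{0<..}|lborel. f u s) = Gamma p * (exp (- s) * (1 + s * q) powr (- p))"
      by simp
  qed
  finally have "(LINT u:{0<..}|lborel. ?w u / (1 + u * q)) =
      Gamma p * (LINT s:{0<..}|lborel. exp (- s) * (1 + s * q) powr (- p))"
    by (simp only: set_integral_mult_right inner cong: set_integral_cong)
  moreover have "terminant p (of_real q) = of_real (LINT u:{0<..}|lborel. ?w u / (1 + u * q))"
    unfolding terminant_def set_integral_complex_of_real[symmetric]
    by (rule set_integral_cong) (simp add: gamma_weight_of_real)
  ultimately show ?thesis by simp
qed

definition gauss_laplace :: "real \<Rightarrow> real" where
  "gauss_laplace q = (LINT h:{0<..}|lborel. exp (- h - q / 4 * h\<^sup>2))"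

lemma bij_betw_quadratic:
  assumes q: "q > (0::real)"
  shows "bij_betw (\<lambda>h. h + q / 4 * h\<^sup>2) {0<..} {0<..}"
proof (rule bij_betw_byWitness[where f' = "\<lambda>s. 2 * (sqrt (1 + s * q) - 1) / q"])
  have square: "1 + (h + q / 4 * h\<^sup>2) * q = (1 + q / 2 * h)\<^sup>2" for h
    by (simp add: power2_eq_square algebra_simps)
  show "\<forall>h\<in>{0<..}. 2 * (sqrt (1 + (h + q / 4 * h\<^sup>2) * q) - 1) / q = h"
    unfolding square using q by simp
  show "(\<lambda>s. 2 * (sqrt (1 + s * q) - 1) / q) ` {0<..} \<subseteq> {0<..}"
    using q by (auto simp: real_sqrt_gt_1_iff)
  show "(\<lambda>h. h + q / 4 * h\<^sup>2) ` {0<..} \<subseteq> {0<..}"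
    using q by (auto intro!: add_pos_pos)
  show "\<forall>s\<in>{0<..}. 2 * (sqrt (1 + s * q) - 1) / q + q / 4 * (2 * (sqrt (1 + s * q) - 1) / q)\<^sup>2 = s"
  proof
    fix s :: real assume s: "s \<in> {0<..}"
    define R where "R = sqrt (1 + s * q)"
    have "2 * (R - 1) / q + q / 4 * (2 * (R - 1) / q)\<^sup>2 = (R\<^sup>2 - 1) / q"
      using q by (simp add: power2_eq_square field_simps)
    also have "\<dots> = s"
      using s q by (simp add: R_def)
    finally show "2 * (sqrt (1 + s * q) - 1) / q + q / 4 * (2 * (sqrt (1 + s * q) - 1) / q)\<^sup>2 = s"
      unfolding R_def .
  qed
qed

text \<open>The substitution \<open>s = h + q h\<^sup>2 / 4\<close> turns \<open>1 + s q\<close> into the square \<open>(1 + q h / 2)\<^sup>2\<close>.\<close>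

lemma gauss_laplace_eq_laplace:
  assumes q: "q > 0"
  shows "gauss_laplace q = (LINT s:{0<..}|lborel. exp (- s) * (1 + s * q) powr (- (1/2)))"
proof -
  let ?f = "\<lambda>s. exp (- s) * (1 + s * q) powr (- (1/2))"
  have pos: "1 + u * q > 0" if "u > 0" for u
    using that q by (simp add: add_pos_pos)
  have cont: "continuous_on {0<..} ?f"
    by (intro continuous_intros) (auto dest: pos)
  have integrable: "set_integrable lborel {0<..} ?f"
  proof (rule set_integrable_continuous_bound[OF _ cont exp_Ioi_integrable_real[of 1]])
    fix s :: real assume s: "s \<in> {0<..}"
    have "(1 + s * q) powr (- (1/2)) \<le> 1 powr (- (1/2))"
      using s q by (intro powr_mono2') auto
    then show "norm (?f s) \<le> exp (- (1 * s))" by simp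
  qed auto
  have subst: "\<bar>1 + q / 2 * h\<bar> *\<^sub>R ?f (h + q / 4 * h\<^sup>2) = exp (- h - q / 4 * h\<^sup>2)"
    if "h \<in> {0<..}" for h
  proof -
    have c: "1 + q / 2 * h > 0"
      using that q by (simp add: add_pos_pos)
    have "1 + (h + q / 4 * h\<^sup>2) * q = (1 + q / 2 * h)\<^sup>2"
      by (simp add: power2_eq_square algebra_simps)
    then have "(1 + (h + q / 4 * h\<^sup>2) * q) powr (- (1/2)) = inverse (1 + q / 2 * h)"
      using c by (simp add: powr_minus powr_half_sqrt)
    then show ?thesis
      using c by simp
  qed
  have "(LINT h:{0<..}|lborel. \<bar>1 + q / 2 * h\<bar> *\<^sub>R ?f (h + q / 4 * h\<^sup>2)) =
      (LINT s:{0<..}|lborel. ?f s)"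
    by (rule set_integral_substitution(2)[OF _ _ bij_betw_quadratic[OF q] _ _ cont integrable])
      (auto intro!: derivative_eq_intros continuous_intros)
  then show ?thesis
    unfolding gauss_laplace_def by (simp only: subst cong: set_integral_cong)
qed

lemma terminant_half:
  assumes "q > 0"
  shows "terminant (1/2) (of_real q) = of_real (sqrt pi * gauss_laplace q)"
  using terminant_laplace[of "1/2" q] gauss_laplace_eq_laplace[OF assms] assms
  by (simp add: Gamma_one_half_real)

lemma continuous_on_gauss_laplace: "continuous_on {0<..} gauss_laplace"
proof -
  have "continuous_on {0<..} (\<lambda>q. terminant (1/2) (complex_of_real q))"
    by (rule continuous_on_compose2[OF holomorphic_on_imp_continuous_on[OF terminant_holomorphic]])
      (auto intro!: continuous_intros simp: complex_nonpos_Reals_iff)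
  then have "continuous_on {0<..} (\<lambda>q. Re (terminant (1/2) (complex_of_real q)) / sqrt pi)"
    by (intro continuous_intros) auto
  then show ?thesis
    by (rule continuous_on_eq) (simp add: terminant_half)
qed

lemma
  assumes m: "\<bar>m\<bar> < 1/2" and y: "y > 0"
  defines "f \<equiv> \<lambda>r. r powr (m - 1/2) * (1 - r) powr (- m - 1/2) *
    gauss_laplace (2 * r * (1 - r) * y)"
  shows gauss_laplace_beta_integrable: "set_integrable lborel {0<..<1} f"
    and terminant_beta_half: "terminant_beta (1/2) (of_real m) (of_real y) =
      of_real (sqrt pi * (LINT r:{0<..<1}|lborel. f r))"
proof -
  let ?F = "\<lambda>r. beta_weight (of_real (1/2) + of_real m) (of_real (1/2) - of_real m) r *
    terminant (1/2) (of_real (2 * r * (1 - r)) * of_real y)"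
  have integrand_eq: "?F r = of_real (sqrt pi * f r)" if r: "r \<in> {0<..<1}" for r
  proof -
    have exponents: "1/2 + m - 1 = m - 1/2" "1/2 - m - 1 = - m - 1/2"
      by auto
    show ?thesis
      using beta_weight_of_real[OF r, of "1/2 + m" "1/2 - m", unfolded exponents]
        terminant_half[of "2 * r * (1 - r) * y"] r y
      by (simp add: f_def mult_ac)
  qed
  have "set_integrable lborel {0<..<1} (\<lambda>r. complex_of_real (sqrt pi * f r))"
    by (rule set_integrable_transform[OF terminant_beta_integrable integrand_eq]) (use m y in auto)
  then have "set_integrable lborel {0<..<1} (\<lambda>r. sqrt pi * f r)"
    unfolding set_integrable_def by (drule_tac integrable_Re) simp
  then show "set_integrable lborel {0<..<1} f"
    by (subst (asm) set_integrable_mult_right_iff) auto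
  show "terminant_beta (1/2) (of_real m) (of_real y) =
      of_real (sqrt pi * (LINT r:{0<..<1}|lborel. f r))"
    unfolding terminant_beta_def set_integral_mult_right[symmetric]
      set_integral_complex_of_real[symmetric]
    by (rule set_integral_cong) (rule integrand_eq)
qed

lemma gauss_laplace_frac_one_plus:
  assumes k: "k > 0"
  shows "\<bar>1 / (1 + k)\<^sup>2\<bar> * ((k / (1 + k)) powr (m - 1/2) * (1 - k / (1 + k)) powr (- m - 1/2) *
      gauss_laplace (2 * (k / (1 + k)) * (1 - k / (1 + k)) * y)) =
    (LINT u:{0<..}|lborel. k powr (m - 1/2) * exp (- ((1 + k) * u) - k * y / 2 * u\<^sup>2))"
proof -
  have one_minus: "1 - k / (1 + k) = 1 / (1 + k)"
    using k by (simp add: field_simps)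
  have weight: "(k / (1 + k)) powr (m - 1/2) * (1 / (1 + k)) powr (- m - 1/2) =
      k powr (m - 1/2) * (1 + k)"
  proof -
    have "(k / (1 + k)) powr (m - 1/2) * (1 / (1 + k)) powr (- m - 1/2) =
        k powr (m - 1/2) / ((1 + k) powr (m - 1/2) * (1 + k) powr (- m - 1/2))"
      using k by (simp add: powr_divide)
    also have "(1 + k) powr (m - 1/2) * (1 + k) powr (- m - 1/2) = (1 + k) powr (- 1)"
      by (simp flip: powr_add)
    finally show ?thesis
      using k by (simp add: powr_minus field_simps)
  qed
  have "2 * (k / c) * (1 / c) * y / 4 * (c * u)\<^sup>2 = k * y / 2 * u\<^sup>2" if "c \<noteq> 0" for c u :: real
    using that by (simp add: power2_eq_square)
  then have exponent: "2 * (k / (1 + k)) * (1 / (1 + k)) * y / 4 * ((1 + k) * u)\<^sup>2 =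
      k * y / 2 * u\<^sup>2" for u
    using k by simp
  have "gauss_laplace (2 * (k / (1 + k)) * (1 / (1 + k)) * y) =
      (1 + k) * (LINT u:{0<..}|lborel. exp (- ((1 + k) * u) - k * y / 2 * u\<^sup>2))"
    unfolding gauss_laplace_def
    using k by (subst set_integral_Ioi_scale[of "1 + k"]) (simp_all only: exponent, simp_all)
  then show ?thesis
    unfolding one_minus weight set_integral_mult_right using k by (simp add: power2_eq_square)
qed

lemma gauss_laplace_integrand_integrable:
  assumes "q \<ge> 0" "a > (0::real)"
  shows "set_integrable lborel {0<..} (\<lambda>h. exp (- (a * h) - q * h\<^sup>2))"
proof (rule set_integrable_continuous_bound[OF _ _ exp_Ioi_integrable_real[OF assms(2)]])
  show "continuous_on {0<..} (\<lambda>h. exp (- (a * h) - q * h\<^sup>2))"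
    by (intro continuous_intros)
qed (use assms in auto)

lemma gauss_kernel_gamma_integral:
  fixes m y u :: real
  assumes m: "m > - 1/2" and y: "y > 0" and u: "u > 0"
  shows "(LINT k:{0<..}|lborel. k powr (m - 1/2) * exp (- ((1 + k) * u) - k * y / 2 * u\<^sup>2)) =
    Gamma (1/2 + m) * (u powr (- m - 1/2) * exp (- u) * (1 + u * (y / 2)) powr (- m - 1/2))"
proof -
  define a where "a = u * (1 + u * (y / 2))"
  have pos: "1 + u * (y / 2) > 0" and a: "a > 0"
    using u y by (simp_all add: a_def add_pos_pos)
  have "(LINT k:{0<..}|lborel. k powr (m - 1/2) * exp (- ((1 + k) * u) - k * y / 2 * u\<^sup>2)) =
      (LINT k:{0<..}|lborel. exp (- u) * (k powr ((1/2 + m) - 1) * exp (- (a * k))))"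
    by (rule set_integral_cong)
      (auto simp: a_def exp_add[symmetric] exp_diff[symmetric] algebra_simps power2_eq_square)
  also have "\<dots> = exp (- u) * (Gamma (1/2 + m) * a powr (- (1/2 + m)))"
    by (subst set_integral_mult_right, subst Gamma_real_integral_scaled) (use m a in auto)
  also have "a powr (- (1/2 + m)) = u powr (- m - 1/2) * (1 + u * (y / 2)) powr (- m - 1/2)"
    unfolding a_def using u pos by (subst powr_mult) (auto simp: algebra_simps)
  finally show ?thesis
    by (simp only: mult_ac)
qed

text \<open>With \<open>r = k / (1 + k)\<close> and \<open>h = (1 + k) u\<close> the integral over \<open>k\<close> becomes a gamma integral.\<close>

lemma gauss_laplace_beta_integral:
  assumes m: "\<bar>m\<bar> < 1/2" and y: "y > 0"
  shows "(LINT r:{0<..<1}|lborel. r powr (m - 1/2) * (1 - r) powr (- m - 1/2) *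
      gauss_laplace (2 * r * (1 - r) * y)) =
    Gamma (1/2 + m) *
      (LINT u:{0<..}|lborel. u powr (- m - 1/2) * exp (- u) * (1 + u * (y / 2)) powr (- m - 1/2))"
    (is "?lhs = ?rhs")
proof -
  let ?f = "\<lambda>r. r powr (m - 1/2) * (1 - r) powr (- m - 1/2) * gauss_laplace (2 * r * (1 - r) * y)"
  define F where "F k u = k powr (m - 1/2) * exp (- ((1 + k) * u) - k * y / 2 * u\<^sup>2)" for k u :: real
  have subst: "\<bar>1 / (1 + k)\<^sup>2\<bar> *\<^sub>R ?f (k / (1 + k)) = (LINT u:{0<..}|lborel. F k u)"
    if "k \<in> {0<..}" for k
    unfolding F_def real_scaleR_def using that by (intro gauss_laplace_frac_one_plus) simp
  have "continuous_on {0<..<1} ?f"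
    by (intro continuous_intros continuous_on_compose2[OF continuous_on_gauss_laplace])
      (use y in auto)
  note substitution = set_integral_substitution[OF _ _ bij_betw_frac_one_plus DERIV_frac_one_plus
      continuous_on_DERIV_frac_one_plus this gauss_laplace_beta_integrable[OF m y]]
  have "?lhs = (LINT k:{0<..}|lborel. \<bar>1 / (1 + k)\<^sup>2\<bar> *\<^sub>R ?f (k / (1 + k)))"
    by (rule substitution(2)[symmetric]) auto
  also have "\<dots> = (LINT k:{0<..}|lborel. LINT u:{0<..}|lborel. F k u)"
    by (rule set_integral_cong) (rule subst)
  also have "\<dots> = (LINT u:{0<..}|lborel. LINT k:{0<..}|lborel. F k u)"
  proof (rule set_integral_Fubini)
    show "continuous_on ({0<..} \<times> {0<..}) (\<lambda>p. F (fst p) (snd p))"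
      unfolding F_def by (intro continuous_intros) auto
    show "set_integrable lborel {0<..} (F k)" if "k \<in> {0<..}" for k
      unfolding F_def
      by (intro set_integrable_mult_right gauss_laplace_integrand_integrable) (use that y in auto)
    show "set_integrable lborel {0<..} (\<lambda>k. LINT u:{0<..}|lborel. norm (F k u))"
      by (rule set_integrable_transform[OF substitution(1)])
        (simp_all only: subst greaterThan_iff, simp_all add: F_def abs_mult)
  qed auto
  also have "\<dots> = ?rhs"
    unfolding set_integral_mult_right[symmetric] F_def
    by (intro set_integral_cong gauss_kernel_gamma_integral) (use m y in auto)
  finally show ?thesis .
qed

lemma terminant_beta_half_scaled:
  assumes m: "\<bar>m\<bar> < 1/2" and x: "x > 0" and t: "t > 0"
  shows "terminant_beta (1/2) (of_real m) (of_real x / of_real t) =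
    of_real (sqrt pi * Gamma (1/2 + m) * t powr (1/2 - m) *
      (LINT s:{0<..}|lborel. s powr (- m - 1/2) * (1 + s * (x / 2)) powr (- m - 1/2) *
        exp (- (t * s))))"
proof -
  have y: "x / t > 0" using x t by simp
  have "(LINT u:{0<..}|lborel. u powr (- m - 1/2) * exp (- u) *
        (1 + u * (x / t / 2)) powr (- m - 1/2)) =
      t * (LINT s:{0<..}|lborel. (t * s) powr (- m - 1/2) * exp (- (t * s)) *
        (1 + (t * s) * (x / t / 2)) powr (- m - 1/2))"
    by (subst set_integral_Ioi_scale[OF t]) simp
  also have "\<dots> = t * (LINT s:{0<..}|lborel. t powr (- m - 1/2) *
      (s powr (- m - 1/2) * (1 + s * (x / 2)) powr (- m - 1/2) * exp (- (t * s))))"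
    using t by (simp add: powr_mult mult_ac)
  also have "\<dots> = t powr (1 + (- m - 1/2)) *
      (LINT s:{0<..}|lborel. s powr (- m - 1/2) * (1 + s * (x / 2)) powr (- m - 1/2) *
        exp (- (t * s)))"
    using t by (simp only: set_integral_mult_right powr_add) simp
  also have "1 + (- m - 1/2) = 1/2 - m"
    by simp
  finally show ?thesis
    using terminant_beta_half[OF m y] gauss_laplace_beta_integral[OF m y] by simp
qed

definition euler_weight :: "real \<Rightarrow> complex \<Rightarrow> real \<Rightarrow> complex" where
  "euler_weight m \<nu> s = of_real (s powr (- m - 1/2)) * of_real (1 + s) powr (of_real m - \<nu> - 1)"

definition euler_kernel :: "real \<Rightarrow> complex \<Rightarrow> real \<Rightarrow> complex" where
  "euler_kernel m x s = (1 + of_real s * (x / 2)) powr of_real (- m - 1/2)"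

definition euler_integral :: "real \<Rightarrow> complex \<Rightarrow> complex \<Rightarrow> complex" where
  "euler_integral m \<nu> x = (LINT s:{0<..}|lborel. euler_weight m \<nu> s * euler_kernel m x s)"

lemma continuous_on_euler_weight: "continuous_on {0<..} (euler_weight m \<nu>)"
  unfolding euler_weight_def
  by (intro continuous_intros continuous_on_powr_slit) (auto simp: complex_nonpos_Reals_iff)

lemma norm_euler_weight:
  assumes "s \<in> {0<..}"
  shows "norm (euler_weight m \<nu> s) = s powr (- m - 1/2) * (1 + s) powr (m - Re \<nu> - 1)"
  using assms norm_of_real_powr[of "1 + s"] by (simp add: euler_weight_def norm_mult)

lemma continuous_on_euler_kernel:
  fixes x :: complex
  assumes "x \<notin> \<real>\<^sub>\<le>\<^sub>0"
  shows "continuous_on {0<..} (euler_kernel m x)"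
  unfolding euler_kernel_def
proof (rule continuous_on_powr_slit)
  show "1 + of_real s * (x / 2) \<notin> \<real>\<^sub>\<le>\<^sub>0" if "s \<in> {0<..}" for s
    by (rule one_plus_mult_notin_nonpos_Reals)
      (use that divide_of_real_notin_nonpos_Reals[OF assms, of 2] in auto)
qed (intro continuous_intros)

context
  fixes m :: real and \<nu> :: complex
  assumes m: "\<bar>m\<bar> < 1/2" and \<nu>: "Re \<nu> > - 1/2"
begin

lemma euler_weight_integrable: "set_integrable lborel {0<..} (euler_weight m \<nu>)"
proof (rule set_integrable_continuous_bound[OF _ continuous_on_euler_weight])
  show "set_integrable lborel {0<..} (\<lambda>s. s powr (- m - 1/2) * (1 + s) powr (m - Re \<nu> - 1))"
    using Beta_Ioi_integrable[of "1/2 - m" "Re \<nu> + 1/2"] m \<nu> by (simp add: algebra_simps)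
qed (simp_all add: norm_euler_weight)

lemma euler_kernel_locally_bounded:
  fixes x :: complex
  assumes "x \<notin> \<real>\<^sub>\<le>\<^sub>0"
  shows "\<exists>e>0. \<exists>C. \<forall>v\<in>ball x e. \<forall>s\<in>{0<..}. norm (euler_kernel m v s) \<le> C"
proof -
  have "x / 2 \<notin> \<real>\<^sub>\<le>\<^sub>0"
    using divide_of_real_notin_nonpos_Reals[OF assms, of 2] by simp
  then obtain e d where e: "e > 0" "d > 0" and lower:
    "\<And>w s. w \<in> ball (x / 2) e \<Longrightarrow> s \<ge> 0 \<Longrightarrow> norm (1 + of_real s * w) \<ge> d"
    using norm_one_plus_locally_bounded_below by blast
  have "norm (euler_kernel m v s) \<le> d powr (- m - 1/2)"
    if "v \<in> ball x e" "s \<in> {0<..}" for v s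
  proof -
    have "dist (x / 2) (v / 2) = dist x v / 2"
      by (simp add: dist_norm norm_divide flip: diff_divide_distrib)
    then have "norm (1 + of_real s * (v / 2)) \<ge> d"
      using that zero_le_dist[of x v] by (intro lower) (auto simp del: zero_le_dist)
    then have "norm (1 + of_real s * (v / 2)) powr (- m - 1/2) \<le> d powr (- m - 1/2)"
      using m e by (intro powr_mono2') auto
    then show ?thesis
      unfolding euler_kernel_def by (subst norm_powr_real_powr') auto
  qed
  then show ?thesis
    using e(1) by blast
qed

lemma euler_integrable:
  assumes x: "x \<notin> \<real>\<^sub>\<le>\<^sub>0"
  shows "set_integrable lborel {0<..} (\<lambda>s. euler_weight m \<nu> s * euler_kernel m x s)"
proof -
  obtain e C where "e > 0"
    "\<And>v s. v \<in> ball x e \<Longrightarrow> s \<in> {0<..} \<Longrightarrow> norm (euler_kernel m v s) \<le> C"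
    using euler_kernel_locally_bounded[OF x] by blast
  then show ?thesis
    by (intro set_integrable_weighted[where C = C] euler_weight_integrable
      continuous_on_euler_kernel x) auto
qed

lemma euler_integral_holomorphic: "euler_integral m \<nu> holomorphic_on - \<real>\<^sub>\<le>\<^sub>0"
proof -
  have "(\<lambda>x. LINT s:{0<..}|lborel. euler_weight m \<nu> s * euler_kernel m x s) holomorphic_on - \<real>\<^sub>\<le>\<^sub>0"
  proof (rule holomorphic_on_set_integral_weighted)
    show "(\<lambda>x. euler_kernel m x s) holomorphic_on - \<real>\<^sub>\<le>\<^sub>0" if "s \<in> {0<..}" for s
      unfolding euler_kernel_def
      using that divide_of_real_notin_nonpos_Reals[of _ 2]
      by (intro holomorphic_intros one_plus_mult_notin_nonpos_Reals) auto
    fix x :: complex assume x: "x \<in> - \<real>\<^sub>\<le>\<^sub>0"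
    then show "continuous_on {0<..} (euler_kernel m x)"
      by (intro continuous_on_euler_kernel) simp
    show "\<exists>e>0. \<exists>C. \<forall>v\<in>ball x e \<inter> - \<real>\<^sub>\<le>\<^sub>0. \<forall>s\<in>{0<..}.
        norm (euler_kernel m v s) \<le> C"
      using euler_kernel_locally_bounded[of x] x by blast
  qed (auto intro: euler_weight_integrable)
  then show ?thesis
    by (simp add: euler_integral_def[abs_def])
qed

end

definition euler_laplace_kernel :: "real \<Rightarrow> complex \<Rightarrow> real \<Rightarrow> real \<Rightarrow> real \<Rightarrow> complex" where
  "euler_laplace_kernel m \<nu> x s t =
    of_real (s powr (- m - 1/2) * (1 + s * (x / 2)) powr (- m - 1/2)) *
      (of_real t powr (\<nu> - of_real m) * exp (- (of_real (1 + s) * of_real t)))"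

lemma
  assumes s: "s > 0" and z: "Re (\<nu> + 1 - of_real m) > 0"
  shows euler_laplace_kernel_integrable:
    "set_integrable lborel {0<..} (euler_laplace_kernel m \<nu> x s)"
    and euler_laplace_kernel_integral: "(LINT t:{0<..}|lborel. euler_laplace_kernel m \<nu> x s t) =
      Gamma (\<nu> + 1 - of_real m) *
      (euler_weight m \<nu> s * of_real ((1 + s * (x / 2)) powr (- m - 1/2)))"
    and euler_laplace_kernel_integral_norm:
      "(LINT t:{0<..}|lborel. norm (euler_laplace_kernel m \<nu> x s t)) =
      Gamma (Re (\<nu> + 1 - of_real m)) *
      norm (euler_weight m \<nu> s * of_real ((1 + s * (x / 2)) powr (- m - 1/2)))"
proof -
  have exponents: "\<nu> - of_real m = (\<nu> + 1 - of_real m) - 1"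
    "- (\<nu> + 1 - of_real m) = of_real m - \<nu> - 1"
    by simp_all
  have Re: "Re (complex_of_real (1 + s)) > 0"
    using s by simp
  show "set_integrable lborel {0<..} (euler_laplace_kernel m \<nu> x s)"
    unfolding euler_laplace_kernel_def exponents(1)
    by (intro set_integrable_mult_right Gamma_complex_integrable_scaled z Re)
  show "(LINT t:{0<..}|lborel. euler_laplace_kernel m \<nu> x s t) =
      Gamma (\<nu> + 1 - of_real m) *
      (euler_weight m \<nu> s * of_real ((1 + s * (x / 2)) powr (- m - 1/2)))"
    unfolding euler_laplace_kernel_def exponents(1) set_integral_mult_right
      Gamma_complex_integral_scaled[OF z Re] exponents(2)
    by (simp add: euler_weight_def mult_ac)
  have "(LINT t:{0<..}|lborel. norm (euler_laplace_kernel m \<nu> x s t)) =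
      (LINT t:{0<..}|lborel. s powr (- m - 1/2) * (1 + s * (x / 2)) powr (- m - 1/2) *
        (t powr (Re (\<nu> + 1 - of_real m) - 1) * exp (- ((1 + s) * t))))"
    by (rule set_integral_cong)
      (simp add: euler_laplace_kernel_def norm_mult norm_of_real_powr abs_mult)
  also have "\<dots> = s powr (- m - 1/2) * (1 + s * (x / 2)) powr (- m - 1/2) *
      (Gamma (Re (\<nu> + 1 - of_real m)) * (1 + s) powr (- Re (\<nu> + 1 - of_real m)))"
    by (subst set_integral_mult_right, subst Gamma_real_integral_scaled) (use z s in auto)
  finally show "(LINT t:{0<..}|lborel. norm (euler_laplace_kernel m \<nu> x s t)) =
      Gamma (Re (\<nu> + 1 - of_real m)) *
      norm (euler_weight m \<nu> s * of_real ((1 + s * (x / 2)) powr (- m - 1/2)))"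
    using s by (simp add: norm_mult norm_euler_weight diff_diff_eq)
qed

context
  fixes m :: real and \<nu> :: complex and x :: real
  assumes m: "\<bar>m\<bar> < 1/2" and \<nu>: "Re \<nu> > - 1/2" and x: "x > 0"
begin

lemma euler_laplace_kernel_iterated_integral:
  "(LINT t:{0<..}|lborel. LINT s:{0<..}|lborel. euler_laplace_kernel m \<nu> x s t) =
    Gamma (\<nu> + 1 - of_real m) * euler_integral m \<nu> (of_real x)"
proof -
  have z: "Re (\<nu> + 1 - of_real m) > 0"
    using m \<nu> by auto
  have pos: "1 + s * (x / 2) > 0" if "s > 0" for s
    using that x by (simp add: add_pos_pos)
  have kernel_of_real: "euler_kernel m (of_real x) s =
      of_real ((1 + s * (x / 2)) powr (- m - 1/2))" if "s \<in> {0<..}" for s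
    using powr_of_real[of "1 + s * (x / 2)" "- m - 1/2"] pos[of s] that
    by (simp add: euler_kernel_def)
  have "(LINT t:{0<..}|lborel. LINT s:{0<..}|lborel. euler_laplace_kernel m \<nu> x s t) =
      (LINT s:{0<..}|lborel. LINT t:{0<..}|lborel. euler_laplace_kernel m \<nu> x s t)"
  proof (rule set_integral_Fubini[symmetric])
    have "continuous_on ({0<..} \<times> {0<..}) (\<lambda>p. complex_of_real (snd p) powr (\<nu> - of_real m))"
      by (rule continuous_on_powr_slit)
        (auto intro!: continuous_intros simp: complex_nonpos_Reals_iff)
    then show "continuous_on ({0<..} \<times> {0<..}) (\<lambda>p. euler_laplace_kernel m \<nu> x (fst p) (snd p))"
      unfolding euler_laplace_kernel_def by (intro continuous_intros) (auto dest: pos)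
    have "set_integrable lborel {0<..} (\<lambda>s. Gamma (Re (\<nu> + 1 - of_real m)) *
        norm (euler_weight m \<nu> s * euler_kernel m (of_real x) s))"
      by (intro set_integrable_mult_right set_integrable_norm euler_integrable m \<nu>) (use x in simp)
    then show "set_integrable lborel {0<..}
        (\<lambda>s. LINT t:{0<..}|lborel. norm (euler_laplace_kernel m \<nu> x s t))"
      by (rule set_integrable_transform)
        (simp only: euler_laplace_kernel_integral_norm[OF _ z] kernel_of_real greaterThan_iff)
  qed (use z in \<open>auto intro: euler_laplace_kernel_integrable\<close>)
  also have "\<dots> = Gamma (\<nu> + 1 - of_real m) * euler_integral m \<nu> (of_real x)"
    unfolding euler_integral_def set_integral_mult_right[symmetric]
    by (rule set_integral_cong)
      (simp only: euler_laplace_kernel_integral[OF _ z] kernel_of_real greaterThan_iff)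
  finally show ?thesis .
qed

lemma gamma_weight_times_terminant_beta_half:
  assumes t: "t > 0"
  shows "gamma_weight (\<nu> + 1/2) t * terminant_beta (1/2) (of_real m) (of_real x / of_real t) =
    of_real (sqrt pi * Gamma (1/2 + m)) * (LINT s:{0<..}|lborel. euler_laplace_kernel m \<nu> x s t)"
proof -
  let ?S = "\<lambda>s. s powr (- m - 1/2) * (1 + s * (x / 2)) powr (- m - 1/2)"
  have powr_split: "of_real t powr (\<nu> - of_real m) =
      complex_of_real t powr (\<nu> - 1/2) * of_real (t powr (1/2 - m))"
    using t powr_add[of "complex_of_real t" "\<nu> - 1/2" "of_real (1/2 - m)"]
      powr_of_real[of t "1/2 - m"]
    by (simp add: algebra_simps)
  have exp_split: "exp (- (of_real (1 + s) * of_real t)) =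
      complex_of_real (exp (- t)) * of_real (exp (- (t * s)))" for s
    by (simp add: algebra_simps flip: exp_of_real exp_add)
  have "euler_laplace_kernel m \<nu> x s t =
      (gamma_weight (\<nu> + 1/2) t * of_real (t powr (1/2 - m))) *
      of_real (?S s * exp (- (t * s)))" for s
    unfolding euler_laplace_kernel_def gamma_weight_def powr_split exp_split by simp
  then have "(LINT s:{0<..}|lborel. euler_laplace_kernel m \<nu> x s t) =
      gamma_weight (\<nu> + 1/2) t * of_real (t powr (1/2 - m)) *
        of_real (LINT s:{0<..}|lborel. ?S s * exp (- (t * s)))"
    by (simp only: set_integral_mult_right set_integral_complex_of_real)
  then show ?thesis
    using terminant_beta_half_scaled[OF m x t] by (simp add: mult_ac)
qed

end

lemma connected_slit: "connected (- \<real>\<^sub>\<le>\<^sub>0 :: complex set)"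
proof -
  have "\<real>\<^sub>\<le>\<^sub>0 = complex_of_real ` {..0}"
    by (auto simp: nonpos_Reals_def)
  then show ?thesis
    using starlike_slotted_complex_plane_left[of 0] by (simp add: starlike_imp_connected)
qed

lemma cos_pi_eq_Gamma_quotient:
  assumes "\<bar>m\<bar> < 1/2"
  shows "cos (pi * m) / pi powr (3/2) * (sqrt pi * Gamma (1/2 + m)) = 1 / Gamma (1/2 - m)"
proof -
  have "Gamma (1/2 - m) > 0"
    using assms by (intro Gamma_real_pos) auto
  have "cos (pi * m) / pi powr (3/2) * (sqrt pi * Gamma (1/2 + m)) * Gamma (1/2 - m) =
      cos (pi * m) * a_cos_ratio 0 m"
    using a_cos_ratio_Beta[of m 0] assms by (simp add: Beta_def Gamma_one_half_real)
  also have "\<dots> = 1"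
    using a_coeff_eq_a_cos_ratio[of m 0] assms by (simp add: a_coeff_def)
  finally show ?thesis
    by (rule nonzero_eq_divide_eq[THEN iffD2, rotated])
      (use \<open>Gamma (1/2 - m) > 0\<close> in simp)
qed

context
  fixes m :: real and \<nu> :: complex
  assumes m: "\<bar>m\<bar> < 1/2" and \<nu>: "Re \<nu> > - 1/2"
begin

lemma legendre_rem_0_euler_of_real:
  fixes x :: real
  assumes x: "x > 0"
  shows "legendre_rem 0 (of_real x) (of_real m) \<nu> =
     Gamma (\<nu> + 1 - of_real m) / of_real (Gamma (1/2 - m)) * euler_integral m \<nu> (of_real x)"
proof -
  have "(LINT t:{0<..}|lborel. gamma_weight (\<nu> + 1/2) t *
      terminant_beta (1/2) (of_real m) (of_real x / of_real t)) =
      of_real (sqrt pi * Gamma (1/2 + m)) *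
        (LINT t:{0<..}|lborel. LINT s:{0<..}|lborel. euler_laplace_kernel m \<nu> x s t)"
    using gamma_weight_times_terminant_beta_half[OF m \<nu> x]
    unfolding set_integral_mult_right[symmetric]
    by (intro set_integral_cong) simp
  also have "\<dots> = of_real (sqrt pi * Gamma (1/2 + m)) *
      (Gamma (\<nu> + 1 - of_real m) * euler_integral m \<nu> (of_real x))"
    unfolding euler_laplace_kernel_iterated_integral[OF m \<nu> x] ..
  finally have "legendre_rem 0 (of_real x) (of_real m) \<nu> =
      of_real (cos (pi * m) / pi powr (3/2) * (sqrt pi * Gamma (1/2 + m))) *
      (Gamma (\<nu> + 1 - of_real m) * euler_integral m \<nu> (of_real x))"
    unfolding legendre_rem_def by (simp add: cos_pi_of_real)
  then show ?thesis
    unfolding cos_pi_eq_Gamma_quotient[OF m] by simp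
qed

lemma legendre_rem_0_euler:
  assumes x: "x \<notin> \<real>\<^sub>\<le>\<^sub>0"
  shows "legendre_rem 0 x (of_real m) \<nu> =
     Gamma (\<nu> + 1 - of_real m) / of_real (Gamma (1/2 - m)) * euler_integral m \<nu> x"
proof (rule analytic_continuation_Ioo[where f = "\<lambda>x. legendre_rem 0 x (of_real m) \<nu>"
      and S = "- \<real>\<^sub>\<le>\<^sub>0" and a = 0 and b = 1])
  show "(\<lambda>x. legendre_rem 0 x (of_real m) \<nu>) holomorphic_on - \<real>\<^sub>\<le>\<^sub>0"
    by (rule legendre_rem_holomorphic) (use m \<nu> in \<open>auto intro: holomorphic_intros\<close>)
  show "(\<lambda>x. Gamma (\<nu> + 1 - of_real m) / of_real (Gamma (1/2 - m)) * euler_integral m \<nu> x)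
      holomorphic_on - \<real>\<^sub>\<le>\<^sub>0"
    by (intro holomorphic_intros euler_integral_holomorphic m \<nu>) auto
qed (use x connected_slit in \<open>auto simp: complex_nonpos_Reals_iff legendre_rem_0_euler_of_real\<close>)

end

section \<open>A contour identity\<close>

lemma Re_cosh_complex: "Re (cosh z) = cosh (Re z) * cos (Im z)"
  and Im_cosh_complex: "Im (cosh z) = sinh (Re z) * sin (Im z)"
  and Re_sinh_complex: "Re (sinh z) = sinh (Re z) * cos (Im z)"
  and Im_sinh_complex: "Im (sinh z) = cosh (Re z) * sin (Im z)"
  by (simp_all add: cosh_def sinh_def Re_exp Im_exp algebra_simps)

lemma cosh_i_times_of_real: "cosh (\<i> * complex_of_real c) = of_real (cos c)"
  and sinh_i_times_of_real: "sinh (\<i> * complex_of_real c) = \<i> * of_real (sin c)"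
  by (simp_all add: complex_eq_iff Re_cosh_complex Im_cosh_complex Re_sinh_complex Im_sinh_complex)

lemma norm_cosh_minus_cos_sq:
  "(norm (cosh t - of_real (cos b)))\<^sup>2 =
    (cosh (Re t) - cos (Im t - b)) * (cosh (Re t) - cos (Im t + b))"
proof -
  have "(norm (cosh t - of_real (cos b)))\<^sup>2 =
      (cosh (Re t) * cos (Im t) - cos b)\<^sup>2 + (sinh (Re t) * sin (Im t))\<^sup>2"
    by (simp add: cmod_power2 Re_cosh_complex Im_cosh_complex)
  also have "\<dots> = (cosh (Re t) - cos (Im t) * cos b)\<^sup>2 - (1 - (cos (Im t))\<^sup>2) * (1 - (cos b)\<^sup>2)"
    unfolding power_mult_distrib sinh_square_eq sin_squared_eq
    by (simp add: power2_eq_square algebra_simps)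
  also have "\<dots> = (cosh (Re t) - cos (Im t) * cos b)\<^sup>2 - (sin (Im t) * sin b)\<^sup>2"
    unfolding power_mult_distrib sin_squared_eq ..
  also have "\<dots> = (cosh (Re t) - cos (Im t - b)) * (cosh (Re t) - cos (Im t + b))"
    by (simp add: cos_add cos_diff power2_eq_square algebra_simps)
  finally show ?thesis .
qed

lemma cos_le_cosh: "cos x \<le> cosh y" for x y :: real
  using cos_le_one[of x] cosh_real_ge_1[of y] by linarith

lemma norm_cosh_minus_cos_ge_cos: "cos (Im t) - cos b \<le> norm (cosh t - of_real (cos b))"
proof -
  have "(cos (Im t) - cos b)\<^sup>2 = (1 - cos (Im t - b)) * (1 - cos (Im t + b))"
    using norm_cosh_minus_cos_sq[of "\<i> * of_real (Im t)" b]
    unfolding cosh_i_times_of_real by (simp flip: of_real_diff)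
  also have "\<dots> \<le> (norm (cosh t - of_real (cos b)))\<^sup>2"
    unfolding norm_cosh_minus_cos_sq by (intro mult_mono) (auto simp: cosh_real_ge_1 cos_le_cosh)
  finally show ?thesis
    by (rule power2_le_imp_le) simp
qed

lemma cosh_minus_one_ge: "x\<^sup>2 / 2 \<le> cosh x - 1" for x :: real
proof -
  have "(x / 2)\<^sup>2 \<le> (sinh (x / 2))\<^sup>2"
    using real_le_abs_sinh[of "x / 2"]
    by (simp only: abs_le_square_iff[symmetric] sinh_field_def exp_minus)
  moreover have "cosh x = 2 * (sinh (x / 2))\<^sup>2 + 1"
    using cosh_double[of "x / 2"] cosh_square_eq[of "x / 2"] by simp
  ultimately show ?thesis
    by (simp add: power_divide)
qed

lemma norm_cosh_minus_cos_ge_square: "(Re t)\<^sup>2 / 2 \<le> norm (cosh t - of_real (cos b))"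
proof -
  have "(cosh (Re t) - 1)\<^sup>2 \<le> (norm (cosh t - of_real (cos b)))\<^sup>2"
    unfolding norm_cosh_minus_cos_sq power2_eq_square[of "_ - _"]
    by (intro mult_mono) (auto simp: cosh_real_ge_1 cos_le_cosh)
  then have "cosh (Re t) - 1 \<le> norm (cosh t - of_real (cos b))"
    by (rule power2_le_imp_le) simp
  then show ?thesis
    using cosh_minus_one_ge[of "Re t"] by linarith
qed

definition mehler_kernel :: "real \<Rightarrow> real \<Rightarrow> complex \<Rightarrow> complex \<Rightarrow> complex" where
  "mehler_kernel b m \<nu> t =
    exp ((\<nu> + 1/2) * t) * (cosh t - of_real (cos b)) powr of_real (- m - 1/2)"

lemma norm_mehler_kernel_le:
  assumes t: "\<bar>Im t\<bar> \<le> b" and m: "m > - 1/2" and d: "d > 0" "d \<le> norm (cosh t - of_real (cos b))"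
  shows "norm (mehler_kernel b m \<nu> t) \<le>
    exp (\<bar>Im \<nu>\<bar> * b) * (exp ((Re \<nu> + 1/2) * Re t) * d powr (- m - 1/2))"
proof -
  have "- (Im \<nu> * Im t) \<le> \<bar>Im \<nu>\<bar> * \<bar>Im t\<bar>"
    by (metis abs_ge_minus_self abs_mult)
  also have "\<dots> \<le> \<bar>Im \<nu>\<bar> * b"
    using t by (intro mult_left_mono) auto
  finally have norm_exp: "norm (exp ((\<nu> + 1/2) * t)) \<le> exp (\<bar>Im \<nu>\<bar> * b) * exp ((Re \<nu> + 1/2) * Re t)"
    by (simp flip: exp_add)
  have norm_powr: "norm ((cosh t - of_real (cos b)) powr of_real (- m - 1/2)) \<le> d powr (- m - 1/2)"
    using m d by (subst norm_powr_real_powr') (auto intro!: powr_mono2')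
  show ?thesis
    unfolding mehler_kernel_def norm_mult mult.assoc[symmetric]
    by (rule mult_mono[OF norm_exp norm_powr]) auto
qed

definition punctured_strip :: "real \<Rightarrow> complex set" where
  "punctured_strip b = {t. \<bar>Im t\<bar> \<le> b \<and> (Re t \<noteq> 0 \<or> \<bar>Im t\<bar> < b)}"

lemma cos_less_cos_abs: "0 < b \<Longrightarrow> b < pi \<Longrightarrow> \<bar>\<eta>\<bar> < b \<Longrightarrow> cos b < cos \<eta>"
  using cos_monotone_0_pi[of "\<bar>\<eta>\<bar>" b] by simp

lemma
  assumes "0 < b" "b < pi"
  shows one_minus_cos_pos: "0 < 1 - cos b"
    and one_plus_cos_pos: "0 < 1 + cos b"
  using assms cos_monotone_0_pi[of 0 b] cos_monotone_0_pi[of b pi] by auto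

lemma norm_half_one_minus_cos_less_1:
  assumes "0 < b" "b < pi"
  shows "norm (complex_of_real ((1 - cos b) / 2)) < 1"
  unfolding norm_of_real using one_minus_cos_pos[OF assms] one_plus_cos_pos[OF assms] by simp

lemma integral_affine_primitive:
  fixes A f :: "complex \<Rightarrow> complex"
  assumes "l \<le> u" and der: "\<And>x. x \<in> {l..u} \<Longrightarrow>
    (A has_field_derivative f (p + of_real x * q)) (at (p + of_real x * q))"
  shows "integral {l..u} (\<lambda>x. q * f (p + of_real x * q)) =
    A (p + of_real u * q) - A (p + of_real l * q)"
proof (rule integral_unique, rule fundamental_theorem_of_calculus[OF assms(1)])
  fix x assume x: "x \<in> {l..u}"
  have "((\<lambda>z. p + z * q) has_field_derivative q) (at (of_real x))"
    by (auto intro!: derivative_eq_intros)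
  then have "((\<lambda>z. A (p + z * q)) has_field_derivative f (p + of_real x * q) * q) (at (of_real x))"
    by (rule DERIV_chain2[where f = A and g = "\<lambda>z. p + z * q", OF der[OF x]])
  then show "((\<lambda>x. A (p + of_real x * q)) has_vector_derivative q *
        f (p + of_real x * q)) (at x within {l..u})"
    by (subst mult.commute) (rule has_vector_derivative_real_field)
qed

lemma integral_exhaustion_tendsto:
  fixes f :: "nat \<Rightarrow> real \<Rightarrow> 'b::euclidean_space"
  assumes sub: "\<And>n. {l n..u n} \<subseteq> A" and cont: "\<And>n. continuous_on {l n..u n} (f n)"
    and g: "set_integrable lborel A g" and bound: "\<And>n x. x \<in> {l n..u n} \<Longrightarrow> norm (f n x) \<le> g x"
    and exhaust: "\<And>x. x \<in> A \<Longrightarrow> \<forall>\<^sub>F n in sequentially. x \<in> {l n..u n}"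
    and lim: "\<And>x. x \<in> A \<Longrightarrow> (\<lambda>n. f n x) \<longlonglongrightarrow> F x"
  shows "(\<lambda>n. integral {l n..u n} (f n)) \<longlonglongrightarrow> (LINT x:A|lborel. F x)"
proof -
  let ?f = "\<lambda>n x. indicator {l n..u n} x *\<^sub>R f n x"
  have absorb: "(\<lambda>x. indicator A x *\<^sub>R ?f n x) = ?f n" for n
    using sub[of n] by (auto simp: indicator_def fun_eq_iff)
  have integrable: "set_integrable lborel {l n..u n} (f n)" for n
    using cont by (rule borel_integrable_atLeastAtMost')
  have "(\<lambda>n. LINT x:A|lborel. ?f n x) \<longlonglongrightarrow> (LINT x:A|lborel. F x)"
  proof (rule set_integral_dominated_convergence[OF g])
    show "set_borel_measurable lborel A (?f n)" for n
      unfolding set_borel_measurable_def absorb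
      using integrable[of n] by (simp only: set_integrable_def borel_measurable_integrable)
    fix x assume x: "x \<in> A"
    obtain k where "x \<in> {l k..u k}"
      using exhaust[OF x] by (auto simp: eventually_sequentially)
    then have "0 \<le> g x"
      using bound norm_ge_zero order_trans by blast
    then show "norm (?f n x) \<le> g x" for n
      using bound by (auto simp: indicator_def)
    show "(\<lambda>n. ?f n x) \<longlonglongrightarrow> F x"
      by (rule Lim_transform_eventually[OF lim[OF x]])
        (use exhaust[OF x] in \<open>eventually_elim, simp\<close>)
  qed
  moreover have "(LINT x:A|lborel. ?f n x) = integral {l n..u n} (f n)" for n
    using set_borel_integral_eq_integral(2)[OF integrable, of n]
    unfolding set_lebesgue_integral_def absorb by simp
  ultimately show ?thesis by simp
qed

lemma bij_betw_one_minus_cos_ratio: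
  assumes b: "0 < b" "b < pi"
  shows "bij_betw (\<lambda>\<eta>. (1 - cos \<eta>) / (1 - cos b)) {0<..<b} {0<..<1}"
proof (rule bij_betw_byWitness[where f' = "\<lambda>v. arccos (1 - v * (1 - cos b))"])
  have D: "0 < 1 - cos b" "1 - cos b < 2"
    using one_minus_cos_pos[OF b] one_plus_cos_pos[OF b] by auto
  show "\<forall>\<eta>\<in>{0<..<b}. arccos (1 - (1 - cos \<eta>) / (1 - cos b) * (1 - cos b)) = \<eta>"
    using D b by (auto simp: arccos_cos)
  have range: "cos b < 1 - v * (1 - cos b)" "1 - v * (1 - cos b) < 1" if "v \<in> {0<..<1}" for v
  proof -
    have "0 < v * (1 - cos b)" "v * (1 - cos b) < 1 * (1 - cos b)"
      using that D by (intro mult_pos_pos mult_strict_right_mono; simp)+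
    then show "cos b < 1 - v * (1 - cos b)" "1 - v * (1 - cos b) < 1"
      by simp_all
  qed
  have "(1 - cos (arccos (1 - v * (1 - cos b)))) / (1 - cos b) = v" if "v \<in> {0<..<1}" for v
  proof -
    have "cos (arccos (1 - v * (1 - cos b))) = 1 - v * (1 - cos b)"
      using range[OF that] cos_ge_minus_one[of b] by (intro cos_arccos) linarith+
    then show ?thesis
      using D by simp
  qed
  then show "\<forall>v\<in>{0<..<1}. (1 - cos (arccos (1 - v * (1 - cos b)))) / (1 - cos b) = v" ..
  show "(\<lambda>\<eta>. (1 - cos \<eta>) / (1 - cos b)) ` {0<..<b} \<subseteq> {0<..<1}"
    using D b by (auto intro!: cos_monotone_0_pi simp: cos_monotone_0_pi[of 0, simplified])
  show "(\<lambda>v. arccos (1 - v * (1 - cos b))) ` {0<..<1} \<subseteq> {0<..<b}"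
  proof safe
    fix v :: real assume v: "v \<in> {0<..<1}"
    have "arccos (1 - v * (1 - cos b)) < arccos (cos b)" "arccos 1 < arccos (1 - v * (1 - cos b))"
      using range[OF v] cos_ge_minus_one[of b] by (intro arccos_less_arccos; linarith)+
    then show "arccos (1 - v * (1 - cos b)) \<in> {0<..<b}"
      using b by (simp add: arccos_cos)
  qed
qed

lemma one_minus_cos_ratio_weight:
  assumes b: "b < pi" and \<eta>: "\<eta> \<in> {0<..<b}"
  shows "\<bar>sin \<eta> / (1 - cos b)\<bar> * (((1 - cos \<eta>) / (1 - cos b)) powr (1/2 - 1) *
      (1 - (1 - cos \<eta>) / (1 - cos b)) powr ((1/2 - m) - 1)) =
    (1 - cos b) powr m * (sqrt (1 + cos \<eta>) * (cos \<eta> - cos b) powr (- m - 1/2))"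
proof -
  define D where "D = 1 - cos b"
  have cos_less: "cos b < cos \<eta>" "cos \<eta> < 1" "sin \<eta> > 0"
    using b \<eta> cos_monotone_0_pi[of \<eta> b] cos_monotone_0_pi[of 0 \<eta>] by (auto intro: sin_gt_zero)
  then have D: "D > 0"
    by (simp add: D_def)
  have "(sin \<eta>)\<^sup>2 = (1 - cos \<eta>) * (1 + cos \<eta>)"
    unfolding sin_squared_eq by (simp add: power2_eq_square algebra_simps)
  then have sin: "sin \<eta> = sqrt (1 - cos \<eta>) * sqrt (1 + cos \<eta>)"
    using cos_less(3) by (metis abs_of_pos real_sqrt_abs real_sqrt_mult)
  have deriv: "\<bar>sin \<eta> / D\<bar> = sqrt (1 - cos \<eta>) * sqrt (1 + cos \<eta>) / D"
    using cos_less(3) D by (simp flip: sin)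
  have sqrt_D: "sqrt D * (x * sqrt D) / D = x" for x
    using D by (simp add: field_simps flip: mult.assoc)
  have powr_ratio: "((1 - cos \<eta>) / D) powr (1/2 - 1) = sqrt D / sqrt (1 - cos \<eta>)"
    using cos_less(2) D powr_minus[of "(1 - cos \<eta>) / D" "1/2"]
    by (simp add: powr_half_sqrt real_sqrt_divide)
  have one_minus: "1 - (1 - cos \<eta>) / D = (cos \<eta> - cos b) / D"
    using D by (simp add: D_def field_simps)
  have exponents: "(1/2 - m) - 1 = - (m + 1/2)" "- m - 1/2 = - (m + 1/2)"
    by simp_all
  have "((cos \<eta> - cos b) / D) powr (- (m + 1/2)) =
      (cos \<eta> - cos b) powr (- (m + 1/2)) * D powr (m + 1/2)"
    using cos_less(1) D by (simp add: powr_divide powr_minus field_simps)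
  also have "D powr (m + 1/2) = D powr m * sqrt D"
    using D by (simp add: powr_add powr_half_sqrt)
  finally have "\<bar>sin \<eta> / D\<bar> *
      (sqrt D / sqrt (1 - cos \<eta>) * ((cos \<eta> - cos b) / D) powr (- (m + 1/2))) =
      sqrt (1 + cos \<eta>) * (sqrt D * ((cos \<eta> - cos b) powr (- (m + 1/2)) * D powr m * sqrt D) / D)"
    unfolding deriv using cos_less(2) by simp
  then show ?thesis
    unfolding D_def[symmetric] one_minus powr_ratio exponents sqrt_D by (simp only: mult_ac)
qed

lemma cos_minus_cos_powr_integrable:
  assumes b: "0 < b" "b < pi" and m: "m < 1/2"
  shows "set_integrable lborel {0<..<b} (\<lambda>\<eta>. (cos \<eta> - cos b) powr (- m - 1/2))"
proof (rule set_integrable_continuous_bound)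
  let ?f = "\<lambda>v::real. v powr (1/2 - 1) * (1 - v) powr ((1/2 - m) - 1)"
  let ?c = "(1 - cos b) powr m * sqrt (1 + cos b)"
  have "set_integrable lborel {0<..<b}
      (\<lambda>\<eta>. \<bar>sin \<eta> / (1 - cos b)\<bar> *\<^sub>R ?f ((1 - cos \<eta>) / (1 - cos b)))"
  proof (rule set_integral_substitution(1)[OF _ _ bij_betw_one_minus_cos_ratio[OF b]])
    show "set_integrable lborel {0<..<1} ?f"
      by (rule Beta_real_integrable) (use m in auto)
  qed (use b one_minus_cos_pos[OF b] in \<open>auto intro!: derivative_eq_intros continuous_intros\<close>)
  then show "set_integrable lborel {0<..<b}
      (\<lambda>\<eta>. inverse ?c * (\<bar>sin \<eta> / (1 - cos b)\<bar> *\<^sub>R ?f ((1 - cos \<eta>) / (1 - cos b))))"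
    by (rule set_integrable_mult_right)
  fix \<eta> assume \<eta>: "\<eta> \<in> {0<..<b}"
  have pos: "0 < 1 + cos b" "0 < 1 - cos b" "cos b < cos \<eta>"
    using one_plus_cos_pos[OF b] one_minus_cos_pos[OF b] cos_less_cos_abs[OF b, of \<eta>] \<eta> by auto
  have "?c * (cos \<eta> - cos b) powr (- m - 1/2) \<le>
      (1 - cos b) powr m * (sqrt (1 + cos \<eta>) * (cos \<eta> - cos b) powr (- m - 1/2))"
    unfolding mult.assoc using pos by (intro mult_left_mono mult_right_mono) auto
  then show "norm ((cos \<eta> - cos b) powr (- m - 1/2)) \<le>
      inverse ?c * (\<bar>sin \<eta> / (1 - cos b)\<bar> *\<^sub>R ?f ((1 - cos \<eta>) / (1 - cos b)))"
    unfolding real_scaleR_def one_minus_cos_ratio_weight[OF b(2) \<eta>]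
    using pos by (simp add: field_simps)
next
  show "continuous_on {0<..<b} (\<lambda>\<eta>. (cos \<eta> - cos b) powr (- m - 1/2))"
    by (intro continuous_intros)
      (metis cos_less_cos_abs[OF b] abs_of_pos greaterThanLessThan_iff less_irrefl right_minus_eq)
qed simp

lemma exp_square_powr_integrable:
  assumes "m < 0" "a > (0::real)"
  shows "set_integrable lborel {..<0} (\<lambda>\<theta>. exp (a * \<theta>) * (\<theta>\<^sup>2 / 2) powr (- m - 1/2))"
proof -
  have "set_integrable lborel {0<..}
      (\<lambda>t. (1/2) powr (- m - 1/2) * (t powr ((- 2 * m) - 1) * exp (- (a * t))))"
    by (intro set_integrable_mult_right Gamma_real_integrable_scaled) (use assms in auto)
  moreover have "(1/2) powr (- m - 1/2) * (t powr ((- 2 * m) - 1) * exp (- (a * t))) =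
      exp (a * - t) * ((- t)\<^sup>2 / 2) powr (- m - 1/2)" if "t \<in> {0<..}" for t
  proof -
    have "t powr ((- 2 * m) - 1) = (t powr 2) powr (- m - 1/2)"
      by (simp add: powr_powr algebra_simps)
    also have "\<dots> = (t\<^sup>2) powr (- m - 1/2)"
      using that by simp
    finally show ?thesis
      by (simp add: powr_divide mult_ac)
  qed
  ultimately have "set_integrable lborel {0<..} (\<lambda>t. exp (a * - t) * ((- t)\<^sup>2 / 2) powr (- m - 1/2))"
    by (rule set_integrable_transform)
  moreover have "{0<..} = {x::real. - x \<in> {..<0}}"
    by auto
  ultimately show ?thesis
    using set_integrable_reflect[of "{..<0}" "\<lambda>\<theta>. exp (a * \<theta>) * (\<theta>\<^sup>2 / 2) powr (- m - 1/2)"]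
    by (simp only:)
qed

lemma mult_powr_Re_nonneg:
  assumes "w \<noteq> 0" "Re w \<ge> 0" "Re y > 0"
  shows "(w * y) powr a = w powr a * y powr a"
proof -
  have y: "y \<noteq> 0"
    using assms(3) by auto
  have "\<bar>Im (Ln w)\<bar> \<le> pi / 2" "\<bar>Im (Ln y)\<bar> < pi / 2"
    using Re_Ln_pos_le[OF assms(1)] Re_Ln_pos_lt[OF y] assms by simp_all
  then have "Ln (w * y) = Ln w + Ln y"
    by (intro Ln_times_simple) (use assms y in \<open>auto simp: abs_le_iff abs_less_iff\<close>)
  then show ?thesis
    using assms(1) y by (simp add: powr_def exp_add[symmetric] algebra_simps)
qed

definition legendre_arg :: "complex \<Rightarrow> complex" where
  "legendre_arg \<xi> = exp \<xi> / sinh \<xi>"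

lemma legendre_arg_i_times_of_real:
  assumes "sin c \<noteq> 0"
  shows "legendre_arg (\<i> * of_real c) = 1 - \<i> * of_real (cot c)"
proof -
  have "exp (\<i> * complex_of_real c) = of_real (cos c) + \<i> * of_real (sin c)"
    by (simp add: exp_Euler cos_of_real sin_of_real)
  then show ?thesis
    using assms by (simp add: legendre_arg_def sinh_i_times_of_real cot_def field_simps)
qed

lemma cosh_add_minus_cosh:
  assumes "sinh \<xi> \<noteq> 0" and "exp (- \<theta>) = 1 + s" "1 + s \<noteq> 0"
  shows "cosh (\<theta> + \<xi>) - cosh \<xi> = s / (1 + s) * (- sinh \<xi> * (1 + s * (legendre_arg (- \<xi>) / 2)))"
proof -
  have exp_\<theta>: "exp \<theta> = 1 / (1 + s)"
    using assms(2,3) by (simp add: exp_minus field_simps)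
  have "- sinh \<xi> * (1 + s * (legendre_arg (- \<xi>) / 2)) = (exp (- \<xi>) * (1 + s) - exp \<xi>) / 2"
    using assms(1) by (simp add: legendre_arg_def sinh_field_def field_simps)
  moreover have "cosh (\<theta> + \<xi>) - cosh \<xi> = s / (1 + s) * ((exp (- \<xi>) * (1 + s) - exp \<xi>) / 2)"
  proof -
    have "(1 / T * E + T * F) / 2 - (E + F) / 2 = (T - 1) / T * ((F * T - E) / 2)"
      if "T \<noteq> 0" for T E F :: complex
      using that by (simp add: field_simps)
    from this[OF assms(3), of "exp \<xi>" "exp (- \<xi>)"] show ?thesis
      unfolding cosh_field_def minus_add_distrib exp_add assms(2) exp_\<theta> by simp
  qed
  ultimately show ?thesis
    by (simp only:)
qed

lemma bij_betw_exp_minus_one: "bij_betw (\<lambda>\<theta>::real. exp (- \<theta>) - 1) {..<0} {0<..}"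
  by (rule bij_betw_byWitness[where f' = "\<lambda>s. - ln (1 + s)"]) auto

definition mehler_angle_integral :: "real \<Rightarrow> real \<Rightarrow> complex \<Rightarrow> complex" where
  "mehler_angle_integral b m \<nu> =
    (LINT \<eta>:{0<..<b}|lborel. cos ((\<nu> + 1/2) * of_real \<eta>) *
      of_real ((cos \<eta> - cos b) powr (- m - 1/2)))"

context
  fixes b :: real
  assumes b: "0 < b" "b < pi"
begin

lemma cosh_minus_cos_notin_nonpos_Reals:
  assumes t: "t \<in> punctured_strip b"
  shows "cosh t - of_real (cos b) \<notin> \<real>\<^sub>\<le>\<^sub>0"
proof
  assume "cosh t - of_real (cos b) \<in> \<real>\<^sub>\<le>\<^sub>0"
  then have Re_le: "cosh (Re t) * cos (Im t) \<le> cos b" and "sinh (Re t) * sin (Im t) = 0"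
    by (auto simp: complex_nonpos_Reals_iff Re_cosh_complex Im_cosh_complex)
  then consider "Re t = 0" | "sin (Im t) = 0"
    by auto
  then show False
  proof cases
    case 1
    then show False
      using t Re_le cos_less_cos_abs[OF b, of "Im t"] by (simp add: punctured_strip_def)
  next
    case 2
    then have "Im t = 0"
      by (rule sin_eq_0_pi[rotated 2]) (use t b in \<open>auto simp: punctured_strip_def\<close>)
    then show False
      using Re_le cos_less_cos_abs[OF b, of 0] b cosh_real_ge_1[of "Re t"] by simp
  qed
qed

lemma continuous_on_mehler_kernel: "continuous_on (punctured_strip b) (mehler_kernel b m \<nu>)"
  unfolding mehler_kernel_def
  by (intro continuous_intros continuous_on_powr_slit cosh_minus_cos_notin_nonpos_Reals)
    (simp add: cosh_field_def continuous_intros)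

lemma mehler_kernel_primitive:
  obtains A where "\<And>t. Re t < 0 \<Longrightarrow> \<bar>Im t\<bar> < b \<Longrightarrow>
      (A has_field_derivative mehler_kernel b m \<nu> t) (at t)"
proof -
  let ?H = "{t. Re t < 0} \<inter> {t. Im t < b} \<inter> {t. Im t > - b}"
  have H: "open ?H" "convex ?H"
    by (intro open_Int open_halfspace_Re_lt open_halfspace_Im_lt open_halfspace_Im_gt
        convex_Int convex_halfspace_Re_lt convex_halfspace_Im_lt convex_halfspace_Im_gt)+
  have "cosh t - of_real (cos b) \<notin> \<real>\<^sub>\<le>\<^sub>0" if "t \<in> ?H" for t
    by (rule cosh_minus_cos_notin_nonpos_Reals) (use that in \<open>auto simp: punctured_strip_def\<close>)
  then have "mehler_kernel b m \<nu> holomorphic_on ?H"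
    unfolding mehler_kernel_def cosh_field_def by (intro holomorphic_intros) auto
  then obtain A where A: "\<And>t. t \<in> ?H \<Longrightarrow>
      (A has_field_derivative mehler_kernel b m \<nu> t) (at t within ?H)"
    using holomorphic_convex_primitive'[OF H(2,1)] by metis
  show thesis
  proof (rule that)
    fix t assume "Re t < 0" "\<bar>Im t\<bar> < b"
    then have "t \<in> ?H" by auto
    then show "(A has_field_derivative mehler_kernel b m \<nu> t) (at t)"
      using A H(1) at_within_open by metis
  qed
qed

lemma mehler_kernel_rectangle:
  assumes \<sigma>: "\<bar>\<sigma>\<bar> = 1" and c: "0 < c" "c \<le> d" "d < b" and e: "0 < e" "e \<le> L"
  shows "integral {- L..- e} (\<lambda>\<theta>. mehler_kernel b m \<nu> (of_real \<theta> + \<i> * of_real (\<sigma> * d))) -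
      integral {- L..- e} (\<lambda>\<theta>. mehler_kernel b m \<nu> (of_real \<theta> + \<i> * of_real (\<sigma> * c))) =
    integral {c..d} (\<lambda>\<eta>. \<i> * of_real \<sigma> *
      mehler_kernel b m \<nu> (of_real (- e) + \<i> * of_real (\<sigma> * \<eta>))) -
      integral {c..d} (\<lambda>\<eta>. \<i> * of_real \<sigma> *
        mehler_kernel b m \<nu> (of_real (- L) + \<i> * of_real (\<sigma> * \<eta>)))"
proof -
  obtain A where A: "\<And>t. Re t < 0 \<Longrightarrow> \<bar>Im t\<bar> < b \<Longrightarrow>
      (A has_field_derivative mehler_kernel b m \<nu> t) (at t)"
    using mehler_kernel_primitive by metis
  have horizontal: "integral {- L..- e} (\<lambda>\<theta>. mehler_kernel b m \<nu> (of_real \<theta> + \<i> * of_real y)) =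
      A (of_real (- e) + \<i> * of_real y) - A (of_real (- L) + \<i> * of_real y)" if "\<bar>y\<bar> < b" for y
    using integral_affine_primitive[of "- L" "- e" A "mehler_kernel b m \<nu>" "\<i> * of_real y" 1,
      OF _ A] that e
    by (simp add: add.commute)
  have vertical: "integral {c..d}
      (\<lambda>\<eta>. \<i> * of_real \<sigma> * mehler_kernel b m \<nu> (of_real (- h) + \<i> * of_real (\<sigma> * \<eta>))) =
      A (of_real (- h) + \<i> * of_real (\<sigma> * d)) - A (of_real (- h) + \<i> * of_real (\<sigma> * c))"
    if "h > 0" for h
    using integral_affine_primitive[of c d A "mehler_kernel b m \<nu>" "of_real (- h)"
      "\<i> * of_real \<sigma>", OF _ A]
      that c \<sigma> by (simp add: abs_mult mult_ac)
  have "\<bar>\<sigma> * c\<bar> < b" "\<bar>\<sigma> * d\<bar> < b"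
    using \<sigma> c by (simp_all add: abs_mult)
  then show ?thesis
    using horizontal[of "\<sigma> * c"] horizontal[of "\<sigma> * d"] vertical[of e] vertical[of L] e by simp
qed

lemma mehler_kernel_horizontal_tendsto:
  assumes m: "- 1/2 < m" "m < 0" and \<nu>: "Re \<nu> > - 1/2"
    and d: "\<And>n. \<bar>d n\<bar> < b" "d \<longlonglongrightarrow> c"
  shows "(\<lambda>n. integral {- (real n + 1)..- (1 / (real n + 2))}
      (\<lambda>\<theta>. mehler_kernel b m \<nu> (of_real \<theta> + \<i> * of_real (d n))))
    \<longlonglongrightarrow> (LINT \<theta>:{..<0}|lborel. mehler_kernel b m \<nu> (of_real \<theta> + \<i> * of_real c))"
proof (rule integral_exhaustion_tendsto)
  show "set_integrable lborel {..<0}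
      (\<lambda>\<theta>. exp (\<bar>Im \<nu>\<bar> * b) * (exp ((Re \<nu> + 1/2) * \<theta>) * (\<theta>\<^sup>2 / 2) powr (- m - 1/2)))"
    by (intro set_integrable_mult_right exp_square_powr_integrable) (use m \<nu> in auto)
  show interval: "{- (real n + 1)..- (1 / (real n + 2))} \<subseteq> {..<0}" for n
    by (auto intro: le_less_trans)
  fix n
  show "continuous_on {- (real n + 1)..- (1 / (real n + 2))}
      (\<lambda>\<theta>. mehler_kernel b m \<nu> (of_real \<theta> + \<i> * of_real (d n)))"
    by (rule continuous_on_compose2[OF continuous_on_mehler_kernel])
      (use d(1)[of n] interval[of n] in \<open>auto intro!: continuous_intros simp: punctured_strip_def\<close>)
  fix \<theta> assume "\<theta> \<in> {- (real n + 1)..- (1 / (real n + 2))}"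
  then have "\<theta> < 0"
    using interval[of n] by blast
  then show "norm (mehler_kernel b m \<nu> (of_real \<theta> + \<i> * of_real (d n))) \<le>
      exp (\<bar>Im \<nu>\<bar> * b) * (exp ((Re \<nu> + 1/2) * \<theta>) * (\<theta>\<^sup>2 / 2) powr (- m - 1/2))"
    using norm_mehler_kernel_le[of "of_real \<theta> + \<i> * of_real (d n)" b m "\<theta>\<^sup>2 / 2"]
      norm_cosh_minus_cos_ge_square[of "of_real \<theta> + \<i> * of_real (d n)" b] d(1)[of n] m
    by simp
next
  fix \<theta> :: real assume \<theta>: "\<theta> \<in> {..<0}"
  have "filterlim (\<lambda>n. - (real n + 1)) at_bot sequentially" "(\<lambda>n. - (1 / (real n + 2))) \<longlonglongrightarrow> 0"
    by real_asymp+
  then have "\<forall>\<^sub>F n in sequentially. - (real n + 1) \<le> \<theta>"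
    "\<forall>\<^sub>F n in sequentially. \<theta> < - (1 / (real n + 2))"
    using \<theta> by (auto simp: filterlim_at_bot intro: order_tendstoD)
  then show "\<forall>\<^sub>F n in sequentially. \<theta> \<in> {- (real n + 1)..- (1 / (real n + 2))}"
    by eventually_elim auto
  have "\<bar>c\<bar> \<le> b"
    by (rule tendsto_upperbound[OF tendsto_rabs[OF d(2)]])
      (use d(1) in \<open>auto intro!: always_eventually less_imp_le\<close>)
  then show "(\<lambda>n. mehler_kernel b m \<nu> (of_real \<theta> + \<i> * of_real (d n))) \<longlonglongrightarrow>
      mehler_kernel b m \<nu> (of_real \<theta> + \<i> * of_real c)"
    by (intro continuous_on_tendsto_compose[OF continuous_on_mehler_kernel] tendsto_intros d
      always_eventually allI)
      (use d(1) \<theta> in \<open>auto simp: punctured_strip_def less_imp_le\<close>)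
qed

lemma norm_mehler_kernel_vertical_le:
  assumes m: "m > - 1/2" and \<sigma>: "\<bar>\<sigma>\<bar> = 1" and \<eta>: "0 \<le> \<eta>" "\<eta> < b"
  shows "norm (\<i> * of_real \<sigma> * mehler_kernel b m \<nu> (of_real h + \<i> * of_real (\<sigma> * \<eta>))) \<le>
    exp (\<bar>Im \<nu>\<bar> * b) * (exp ((Re \<nu> + 1/2) * h) * (cos \<eta> - cos b) powr (- m - 1/2))"
proof -
  have \<sigma>_cases: "\<sigma> = 1 \<or> \<sigma> = - 1"
    using \<sigma> by auto
  then have "cos (\<sigma> * \<eta>) = cos \<eta>"
    by auto
  then show ?thesis
    using norm_mehler_kernel_le[of "of_real h + \<i> * of_real (\<sigma> * \<eta>)" b m "cos \<eta> - cos b" \<nu>]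
      norm_cosh_minus_cos_ge_cos[of "of_real h + \<i> * of_real (\<sigma> * \<eta>)" b]
      cos_less_cos_abs[OF b, of \<eta>] \<eta> \<sigma>_cases m
    by (auto simp: norm_mult)
qed

lemma mehler_kernel_vertical_tendsto:
  assumes m: "- 1/2 < m" "m < 1/2" and \<nu>: "Re \<nu> > - 1/2" and \<sigma>: "\<bar>\<sigma>\<bar> = 1" and h: "\<And>n. h n < 0"
    and lim: "\<And>\<eta>. \<eta> \<in> {0<..<b} \<Longrightarrow>
      (\<lambda>n. \<i> * of_real \<sigma> * mehler_kernel b m \<nu> (of_real (h n) + \<i> * of_real (\<sigma> * \<eta>))) \<longlonglongrightarrow> F \<eta>"
  shows "(\<lambda>n. integral {b / (real n + 2)..b - b / (real n + 2)}
      (\<lambda>\<eta>. \<i> * of_real \<sigma> * mehler_kernel b m \<nu> (of_real (h n) + \<i> * of_real (\<sigma> * \<eta>))))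
    \<longlonglongrightarrow> (LINT \<eta>:{0<..<b}|lborel. F \<eta>)"
proof (rule integral_exhaustion_tendsto[OF _ _ _ _ _ lim])
  show "set_integrable lborel {0<..<b} (\<lambda>\<eta>. exp (\<bar>Im \<nu>\<bar> * b) * (cos \<eta> - cos b) powr (- m - 1/2))"
    by (intro set_integrable_mult_right cos_minus_cos_powr_integrable b m)
  show interval: "{b / (real n + 2)..b - b / (real n + 2)} \<subseteq> {0<..<b}" for n
  proof -
    have "0 < b / (real n + 2)"
      using b by simp
    then show ?thesis
      by auto
  qed
  fix n
  show "continuous_on {b / (real n + 2)..b - b / (real n + 2)}
      (\<lambda>\<eta>. \<i> * of_real \<sigma> * mehler_kernel b m \<nu> (of_real (h n) + \<i> * of_real (\<sigma> * \<eta>)))"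
    by (intro continuous_intros continuous_on_compose2[OF continuous_on_mehler_kernel])
      (use interval[of n] h[of n] \<sigma>
        in \<open>auto intro!: continuous_intros simp: punctured_strip_def abs_mult\<close>)
  fix \<eta> assume "\<eta> \<in> {b / (real n + 2)..b - b / (real n + 2)}"
  then have \<eta>: "0 \<le> \<eta>" "\<eta> < b"
    using interval[of n] by auto
  have "exp ((Re \<nu> + 1/2) * h n) \<le> 1"
    using \<nu> h[of n] by (auto simp: mult_le_0_iff)
  then have "exp ((Re \<nu> + 1/2) * h n) * (cos \<eta> - cos b) powr (- m - 1/2) \<le>
      1 * (cos \<eta> - cos b) powr (- m - 1/2)"
    by (rule mult_right_mono) simp
  then show "norm (\<i> * of_real \<sigma> * mehler_kernel b m \<nu> (of_real (h n) + \<i> * of_real (\<sigma> * \<eta>))) \<le>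
      exp (\<bar>Im \<nu>\<bar> * b) * (cos \<eta> - cos b) powr (- m - 1/2)"
    using norm_mehler_kernel_vertical_le[OF m(1) \<sigma> \<eta>, of \<nu> "h n"]
    by (simp add: mult_left_mono order_trans)
next
  fix \<eta> assume \<eta>: "\<eta> \<in> {0<..<b}"
  have "(\<lambda>n. b / (real n + 2)) \<longlonglongrightarrow> 0"
    by real_asymp
  then have "\<forall>\<^sub>F n in sequentially. b / (real n + 2) < \<eta>"
    "\<forall>\<^sub>F n in sequentially. b / (real n + 2) < b - \<eta>"
    using \<eta> by (auto intro: order_tendstoD)
  then show "\<forall>\<^sub>F n in sequentially. \<eta> \<in> {b / (real n + 2)..b - b / (real n + 2)}"
    by eventually_elim auto
qed

lemma mehler_kernel_vertical_tendsto_0: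
  assumes m: "- 1/2 < m" "m < 1/2" and \<nu>: "Re \<nu> > - 1/2" and \<sigma>: "\<bar>\<sigma>\<bar> = 1"
  shows "(\<lambda>n. integral {b / (real n + 2)..b - b / (real n + 2)}
      (\<lambda>\<eta>. \<i> * of_real \<sigma> *
        mehler_kernel b m \<nu> (of_real (- (1 / (real n + 2))) + \<i> * of_real (\<sigma> * \<eta>))))
    \<longlonglongrightarrow> (LINT \<eta>:{0<..<b}|lborel. \<i> * of_real \<sigma> * mehler_kernel b m \<nu> (\<i> * of_real (\<sigma> * \<eta>)))"
proof (rule mehler_kernel_vertical_tendsto[OF m \<nu> \<sigma>])
  fix \<eta> assume \<eta>: "\<eta> \<in> {0<..<b}"
  have "(\<lambda>n. - (1 / (real n + 2))) \<longlonglongrightarrow> 0"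
    by real_asymp
  then have "(\<lambda>n. of_real (- (1 / (real n + 2))) + \<i> * of_real (\<sigma> * \<eta>)) \<longlonglongrightarrow>
      of_real 0 + \<i> * of_real (\<sigma> * \<eta>)"
    by (intro tendsto_intros)
  then show "(\<lambda>n. \<i> * of_real \<sigma> *
        mehler_kernel b m \<nu> (of_real (- (1 / (real n + 2))) + \<i> * of_real (\<sigma> * \<eta>)))
      \<longlonglongrightarrow> \<i> * of_real \<sigma> * mehler_kernel b m \<nu> (\<i> * of_real (\<sigma> * \<eta>))"
    using \<eta> \<sigma> b
    by (intro tendsto_intros continuous_on_tendsto_compose[OF continuous_on_mehler_kernel])
      (auto simp: punctured_strip_def abs_mult)
qed simp

lemma mehler_kernel_vertical_tendsto_at_bot:
  assumes m: "- 1/2 < m" "m < 1/2" and \<nu>: "Re \<nu> > - 1/2" and \<sigma>: "\<bar>\<sigma>\<bar> = 1"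
  shows "(\<lambda>n. integral {b / (real n + 2)..b - b / (real n + 2)}
      (\<lambda>\<eta>. \<i> * of_real \<sigma> * mehler_kernel b m \<nu> (of_real (- (real n + 1)) + \<i> * of_real (\<sigma> * \<eta>))))
    \<longlonglongrightarrow> 0"
proof -
  have "(\<lambda>n. \<i> * of_real \<sigma> *
      mehler_kernel b m \<nu> (of_real (- (real n + 1)) + \<i> * of_real (\<sigma> * \<eta>))) \<longlonglongrightarrow> 0"
    if \<eta>: "\<eta> \<in> {0<..<b}" for \<eta>
  proof (rule Lim_null_comparison)
    show "\<forall>\<^sub>F n in sequentially.
        norm (\<i> * of_real \<sigma> *
          mehler_kernel b m \<nu> (of_real (- (real n + 1)) + \<i> * of_real (\<sigma> * \<eta>))) \<le>
        exp (\<bar>Im \<nu>\<bar> * b) * (exp ((Re \<nu> + 1/2) * - (real n + 1)) * (cos \<eta> - cos b) powr (- m - 1/2))"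
      by (intro always_eventually allI norm_mehler_kernel_vertical_le[OF m(1) \<sigma>]) (use \<eta> in auto)
    show "(\<lambda>n. exp (\<bar>Im \<nu>\<bar> * b) *
          (exp ((Re \<nu> + 1/2) * - (real n + 1)) * (cos \<eta> - cos b) powr (- m - 1/2))) \<longlonglongrightarrow> 0"
      using \<nu> by real_asymp
  qed
  then show ?thesis
    using mehler_kernel_vertical_tendsto[OF m \<nu> \<sigma>, of "\<lambda>n. - (real n + 1)" "\<lambda>_. 0"] by simp
qed

lemma mehler_kernel_contour:
  assumes m: "- 1/2 < m" "m < 0" and \<nu>: "Re \<nu> > - 1/2" and \<sigma>: "\<bar>\<sigma>\<bar> = 1"
  shows "(LINT \<theta>:{..<0}|lborel. mehler_kernel b m \<nu> (of_real \<theta> + \<i> * of_real (\<sigma> * b))) -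
      (LINT \<theta>:{..<0}|lborel. mehler_kernel b m \<nu> (of_real \<theta>)) =
    (LINT \<eta>:{0<..<b}|lborel. \<i> * of_real \<sigma> * mehler_kernel b m \<nu> (\<i> * of_real (\<sigma> * \<eta>)))"
proof (rule LIMSEQ_unique)
  define l u where "l n = b / (real n + 2)" and "u n = b - b / (real n + 2)" for n
  have l: "0 < l n" "l n \<le> u n" "u n < b"
    and width: "0 < 1 / (real n + 2)" "1 / (real n + 2) \<le> real n + 1" for n
    using b by (simp_all add: l_def u_def field_simps)
  have lim: "(\<lambda>n. \<sigma> * l n) \<longlonglongrightarrow> 0" "(\<lambda>n. \<sigma> * u n) \<longlonglongrightarrow> \<sigma> * b"
    unfolding l_def u_def by real_asymp+
  have abs: "\<bar>\<sigma> * l n\<bar> < b" "\<bar>\<sigma> * u n\<bar> < b" for n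
    using \<sigma> l[of n] by (simp_all add: abs_mult)
  let ?I = "\<lambda>n c. integral {- (real n + 1)..- (1 / (real n + 2))}
    (\<lambda>\<theta>. mehler_kernel b m \<nu> (of_real \<theta> + \<i> * of_real (\<sigma> * c)))"
  show "(\<lambda>n. ?I n (u n) - ?I n (l n)) \<longlonglongrightarrow>
      (LINT \<theta>:{..<0}|lborel. mehler_kernel b m \<nu> (of_real \<theta> + \<i> * of_real (\<sigma> * b))) -
      (LINT \<theta>:{..<0}|lborel. mehler_kernel b m \<nu> (of_real \<theta>))"
    using mehler_kernel_horizontal_tendsto[OF m \<nu> abs(2) lim(2)]
      mehler_kernel_horizontal_tendsto[OF m \<nu> abs(1) lim(1)]
    by (intro tendsto_diff) simp_all
  have "m < 1/2"
    using m by simp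
  then show "(\<lambda>n. ?I n (u n) - ?I n (l n)) \<longlonglongrightarrow>
      (LINT \<eta>:{0<..<b}|lborel. \<i> * of_real \<sigma> * mehler_kernel b m \<nu> (\<i> * of_real (\<sigma> * \<eta>)))"
    unfolding mehler_kernel_rectangle[OF \<sigma> l width] unfolding l_def u_def
    using tendsto_diff[OF mehler_kernel_vertical_tendsto_0[OF m(1) _ \<nu> \<sigma>]
        mehler_kernel_vertical_tendsto_at_bot[OF m(1) _ \<nu> \<sigma>]] by simp
qed

lemma exp_ln_times_euler_weight:
  assumes s: "s > 0"
  shows "exp (- ((\<nu> + 1/2) * of_real (ln (1 + s)))) *
    of_real (s / (1 + s)) powr of_real (- m - 1/2) =
    of_real (1 + s) * euler_weight m \<nu> s"
proof -
  let ?T = "complex_of_real (1 + s)"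
  have T: "?T \<noteq> 0"
    using s by (simp only: of_real_eq_0_iff)
  have T_powr: "?T powr z = exp (z * of_real (ln (1 + s)))" for z
    using s T Ln_of_real[of "1 + s"] by (simp add: powr_def)
  have "complex_of_real (s / (1 + s)) powr of_real (- m - 1/2) =
      of_real ((s / (1 + s)) powr (- m - 1/2))"
    using s by (intro powr_of_real) simp
  also have "\<dots> = of_real (s powr (- m - 1/2)) / of_real ((1 + s) powr (- m - 1/2))"
    using s by (simp add: powr_divide)
  also have "complex_of_real ((1 + s) powr (- m - 1/2)) = ?T powr of_real (- m - 1/2)"
    using s by (intro powr_of_real[symmetric]) simp
  finally have "exp (- ((\<nu> + 1/2) * of_real (ln (1 + s)))) *
      of_real (s / (1 + s)) powr of_real (- m - 1/2) =
      of_real (s powr (- m - 1/2)) *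
      (exp (- ((\<nu> + 1/2) * of_real (ln (1 + s)))) / ?T powr of_real (- m - 1/2))"
    by simp
  also have "exp (- ((\<nu> + 1/2) * of_real (ln (1 + s)))) / ?T powr of_real (- m - 1/2) =
      ?T powr (1 + (of_real m - \<nu> - 1))"
    unfolding T_powr exp_diff[symmetric] by (rule arg_cong[where f = exp]) (simp add: algebra_simps)
  also have "\<dots> = ?T * ?T powr (of_real m - \<nu> - 1)"
    unfolding powr_add using T by simp
  finally show ?thesis
    by (simp only: euler_weight_def mult_ac)
qed

lemma mehler_kernel_ray:
  assumes c: "\<bar>c\<bar> = b" and \<theta>: "\<theta> < 0"
  defines "\<xi> \<equiv> \<i> * complex_of_real c" and "s \<equiv> exp (- \<theta>) - 1"
  shows "mehler_kernel b m \<nu> (of_real \<theta> + \<xi>) =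
    exp ((\<nu> + 1/2) * \<xi>) * (- sinh \<xi>) powr of_real (- m - 1/2) *
      (exp (- \<theta>) *\<^sub>R (euler_weight m \<nu> s * euler_kernel m (legendre_arg (- \<xi>)) s))"
proof -
  define y where "y = 1 + of_real s * (legendre_arg (- \<xi>) / 2)"
  have s: "s > 0" "exp (- \<theta>) = 1 + s" "\<theta> = - ln (1 + s)"
    using \<theta> by (simp_all add: s_def)
  have one_plus_s: "complex_of_real (1 + s) \<noteq> 0" "exp (- complex_of_real \<theta>) = of_real (1 + s)"
    using s by (simp_all only: of_real_eq_0_iff exp_of_real flip: of_real_minus)
  have "sin c \<noteq> 0"
    using c b sin_eq_0_pi[of c] by auto
  then have sinh: "sinh \<xi> \<noteq> 0" "Re (- sinh \<xi>) = 0" and y: "Re y > 0"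
    using legendre_arg_i_times_of_real[of "- c"] s(1)
    by (simp_all add: \<xi>_def y_def sinh_i_times_of_real)
  have "complex_of_real (cos b) = cosh \<xi>"
    using c by (metis \<xi>_def cos_abs_real cosh_i_times_of_real)
  then have base: "cosh (of_real \<theta> + \<xi>) - of_real (cos b) = of_real (s / (1 + s)) * (- sinh \<xi> * y)"
    using cosh_add_minus_cosh[OF sinh(1), of "of_real \<theta>" "of_real s"] one_plus_s
    by (simp add: y_def)
  have "(- sinh \<xi> * y) powr of_real (- m - 1/2) =
      (- sinh \<xi>) powr of_real (- m - 1/2) * y powr of_real (- m - 1/2)"
    by (rule mult_powr_Re_nonneg) (use sinh y in auto)
  moreover have "(of_real (s / (1 + s)) * (- sinh \<xi> * y)) powr of_real (- m - 1/2) =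
      of_real (s / (1 + s)) powr of_real (- m - 1/2) * (- sinh \<xi> * y) powr of_real (- m - 1/2)"
    by (rule powr_times_real_left) (use s in auto)
  ultimately have "mehler_kernel b m \<nu> (of_real \<theta> + \<xi>) =
      exp ((\<nu> + 1/2) * \<xi>) * (- sinh \<xi>) powr of_real (- m - 1/2) *
      (exp ((\<nu> + 1/2) * of_real \<theta>) * of_real (s / (1 + s)) powr of_real (- m - 1/2) *
        y powr of_real (- m - 1/2))"
    unfolding mehler_kernel_def distrib_left exp_add base by (simp only: mult_ac)
  also have "exp ((\<nu> + 1/2) * of_real \<theta>) * of_real (s / (1 + s)) powr of_real (- m - 1/2) =
      of_real (1 + s) * euler_weight m \<nu> s"
    using exp_ln_times_euler_weight[OF s(1)] s(3) by simp
  finally show ?thesis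
    unfolding euler_kernel_def y_def[symmetric] s(2) scaleR_conv_of_real by (simp only: mult.assoc)
qed

lemma mehler_kernel_ray_integral:
  assumes m: "\<bar>m\<bar> < 1/2" and \<nu>: "Re \<nu> > - 1/2" and c: "\<bar>c\<bar> = b"
  defines "\<xi> \<equiv> \<i> * of_real c"
  shows "(LINT \<theta>:{..<0}|lborel. mehler_kernel b m \<nu> (of_real \<theta> + \<xi>)) =
    exp ((\<nu> + 1/2) * \<xi>) * (- sinh \<xi>) powr of_real (- m - 1/2) *
    euler_integral m \<nu> (legendre_arg (- \<xi>))"
proof -
  let ?x = "legendre_arg (- \<xi>)"
  let ?C = "exp ((\<nu> + 1/2) * \<xi>) * (- sinh \<xi>) powr of_real (- m - 1/2)"
  let ?f = "\<lambda>s. euler_weight m \<nu> s * euler_kernel m ?x s"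
  have "sin c \<noteq> 0"
    using c b sin_eq_0_pi[of c] by auto
  then have x: "?x \<notin> \<real>\<^sub>\<le>\<^sub>0"
    using legendre_arg_i_times_of_real[of "- c"] by (simp add: \<xi>_def complex_nonpos_Reals_iff)
  have cont: "continuous_on {0<..} ?f"
    by (intro continuous_on_mult continuous_on_euler_weight continuous_on_euler_kernel x)
  have "(LINT \<theta>:{..<0}|lborel. mehler_kernel b m \<nu> (of_real \<theta> + \<xi>)) =
      (LINT \<theta>:{..<0}|lborel. ?C * (\<bar>- exp (- \<theta>)\<bar> *\<^sub>R ?f (exp (- \<theta>) - 1)))"
    unfolding \<xi>_def by (rule set_integral_cong)
      (simp only: mehler_kernel_ray[OF c] lessThan_iff abs_minus_cancel abs_exp_cancel)
  also have "(LINT \<theta>:{..<0}|lborel. ?C * (\<bar>- exp (- \<theta>)\<bar> *\<^sub>R ?f (exp (- \<theta>) - 1))) =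
      ?C * (LINT s:{0<..}|lborel. ?f s)"
    unfolding set_integral_mult_right
    by (subst set_integral_substitution(2)[OF _ _ bij_betw_exp_minus_one _ _ cont
      euler_integrable[OF m \<nu> x]])
      (auto intro!: derivative_eq_intros continuous_intros)
  finally show ?thesis
    unfolding euler_integral_def .
qed

lemma mehler_kernel_imaginary:
  assumes \<sigma>: "\<bar>\<sigma>\<bar> = 1" and \<eta>: "\<eta> \<in> {0<..<b}"
  shows "mehler_kernel b m \<nu> (\<i> * of_real (\<sigma> * \<eta>)) =
    exp (\<i> * of_real \<sigma> * ((\<nu> + 1/2) * of_real \<eta>)) * of_real ((cos \<eta> - cos b) powr (- m - 1/2))"
proof -
  have "\<sigma> = 1 \<or> \<sigma> = - 1"
    using \<sigma> by auto
  then have "cosh (\<i> * of_real (\<sigma> * \<eta>)) = complex_of_real (cos \<eta>)"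
    unfolding cosh_i_times_of_real by auto
  moreover have "complex_of_real (cos \<eta> - cos b) powr of_real (- m - 1/2) =
      of_real ((cos \<eta> - cos b) powr (- m - 1/2))"
    using cos_less_cos_abs[OF b, of \<eta>] \<eta> by (intro powr_of_real) auto
  ultimately show ?thesis
    unfolding mehler_kernel_def by (simp add: mult_ac)
qed

lemma mehler_kernel_imaginary_integrable:
  assumes m: "- 1/2 < m" "m < 1/2" and \<sigma>: "\<bar>\<sigma>\<bar> = 1"
  shows "set_integrable lborel {0<..<b}
    (\<lambda>\<eta>. \<i> * of_real \<sigma> * mehler_kernel b m \<nu> (\<i> * of_real (\<sigma> * \<eta>)))"
proof (rule set_integrable_continuous_bound)
  show "set_integrable lborel {0<..<b} (\<lambda>\<eta>. exp (\<bar>Im \<nu>\<bar> * b) * (cos \<eta> - cos b) powr (- m - 1/2))"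
    by (intro set_integrable_mult_right cos_minus_cos_powr_integrable b m)
  show "continuous_on {0<..<b} (\<lambda>\<eta>. \<i> * of_real \<sigma> * mehler_kernel b m \<nu> (\<i> * of_real (\<sigma> * \<eta>)))"
    by (intro continuous_intros continuous_on_compose2[OF continuous_on_mehler_kernel])
      (use \<sigma> in \<open>auto intro!: continuous_intros simp: punctured_strip_def abs_mult\<close>)
  show "norm (\<i> * of_real \<sigma> * mehler_kernel b m \<nu> (\<i> * of_real (\<sigma> * \<eta>))) \<le>
      exp (\<bar>Im \<nu>\<bar> * b) * (cos \<eta> - cos b) powr (- m - 1/2)" if "\<eta> \<in> {0<..<b}" for \<eta>
    using norm_mehler_kernel_vertical_le[OF m(1) \<sigma>, of \<eta> \<nu> 0] that by simp
qed simp

lemma mehler_connection: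
  assumes m: "- 1/2 < m" "m < 0" and \<nu>: "Re \<nu> > - 1/2" and \<sigma>: "\<bar>\<sigma>\<bar> = 1"
  defines "\<xi> \<equiv> \<i> * of_real (\<sigma> * b)"
  shows "exp ((\<nu> + 1/2) * \<xi>) * (- sinh \<xi>) powr of_real (- m - 1/2) *
    euler_integral m \<nu> (legendre_arg (- \<xi>)) -
      exp (- ((\<nu> + 1/2) * \<xi>)) * sinh \<xi> powr of_real (- m - 1/2) *
      euler_integral m \<nu> (legendre_arg \<xi>) =
    2 * \<i> * of_real \<sigma> * mehler_angle_integral b m \<nu>"
proof -
  let ?K = "mehler_kernel b m \<nu>"
  let ?V = "\<lambda>\<sigma> \<eta>. \<i> * of_real \<sigma> * ?K (\<i> * of_real (\<sigma> * \<eta>))"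
  define ray where "ray \<xi> = (LINT \<theta>:{..<0}|lborel. ?K (of_real \<theta> + \<xi>))" for \<xi>
  have \<sigma>': "\<bar>- \<sigma>\<bar> = 1" and m': "\<bar>m\<bar> < 1/2" "m < 1/2" and abs_b: "\<bar>\<sigma> * b\<bar> = b" "\<bar>- (\<sigma> * b)\<bar> = b"
    using m \<sigma> b by (auto simp: abs_mult)
  have "ray \<xi> - ray (- \<xi>) = (LINT \<eta>:{0<..<b}|lborel. ?V \<sigma> \<eta>) - (LINT \<eta>:{0<..<b}|lborel. ?V (- \<sigma>) \<eta>)"
    using mehler_kernel_contour[OF m \<nu> \<sigma>] mehler_kernel_contour[OF m \<nu> \<sigma>']
    by (simp add: ray_def \<xi>_def diff_eq_eq)
  also have "\<dots> = (LINT \<eta>:{0<..<b}|lborel. ?V \<sigma> \<eta> - ?V (- \<sigma>) \<eta>)"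
    by (rule set_integral_diff(2)[symmetric])
      (intro mehler_kernel_imaginary_integrable m(1) m' \<sigma> \<sigma>')+
  also have "\<dots> = (LINT \<eta>:{0<..<b}|lborel. 2 * \<i> * of_real \<sigma> *
      (cos ((\<nu> + 1/2) * of_real \<eta>) * of_real ((cos \<eta> - cos b) powr (- m - 1/2))))"
  proof (rule set_integral_cong)
    fix \<eta> assume \<eta>: "\<eta> \<in> {0<..<b}"
    have "\<sigma> = 1 \<or> \<sigma> = - 1"
      using \<sigma> by auto
    then show "?V \<sigma> \<eta> - ?V (- \<sigma>) \<eta> = 2 * \<i> * of_real \<sigma> *
        (cos ((\<nu> + 1/2) * of_real \<eta>) * of_real ((cos \<eta> - cos b) powr (- m - 1/2)))"
      unfolding mehler_kernel_imaginary[OF \<sigma> \<eta>] mehler_kernel_imaginary[OF \<sigma>' \<eta>] cos_exp_eq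
      by (auto simp: algebra_simps)
  qed
  also have "\<dots> = 2 * \<i> * of_real \<sigma> * mehler_angle_integral b m \<nu>"
    unfolding mehler_angle_integral_def by (rule set_integral_mult_right)
  finally show ?thesis
    using mehler_kernel_ray_integral[OF m'(1) \<nu> abs_b(1)]
      mehler_kernel_ray_integral[OF m'(1) \<nu> abs_b(2)]
    by (simp add: ray_def \<xi>_def)
qed

end

section \<open>The regularised hypergeometric series\<close>

definition hyp2F1_reg_coeff :: "complex \<Rightarrow> complex \<Rightarrow> complex \<Rightarrow> nat \<Rightarrow> complex" where
  "hyp2F1_reg_coeff a b c n = pochhammer a n * pochhammer b n / fact n * rGamma (c + of_nat n)"

lemma hyp2F1_reg_series_eq: "hyp2F1_reg_series a b c w = (\<Sum>n. hyp2F1_reg_coeff a b c n * w ^ n)"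
  by (simp add: hyp2F1_reg_series_def hyp2F1_reg_coeff_def)

lemma norm_pochhammer_ge_fact:
  fixes z :: complex
  assumes "Re z \<ge> 1"
  shows "fact n \<le> norm (pochhammer z n)"
proof (induction n)
  case (Suc n)
  have "real (Suc n) \<le> Re (z + of_nat n)"
    using assms by simp
  also have "\<dots> \<le> norm (z + of_nat n)"
    by (rule complex_Re_le_cmod)
  finally have "fact n * real (Suc n) \<le> norm (pochhammer z n) * norm (z + of_nat n)"
    using Suc by (intro mult_mono) auto
  then show ?case
    unfolding pochhammer_Suc norm_mult fact_Suc by (simp only: mult.commute)
qed simp

lemma norm_rGamma_add_of_nat_le:
  fixes c :: complex
  obtains k C where "\<And>z n. z \<in> cball c 1 \<Longrightarrow> n \<ge> k \<Longrightarrow> norm (rGamma (z + of_nat n)) \<le> C / fact (n - k)"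
proof -
  obtain k :: nat where k: "real k \<ge> norm c + 2"
    using real_arch_simple by blast
  have "continuous_on (cball c 1) (\<lambda>z. rGamma (z + of_nat k))"
    by (intro holomorphic_on_imp_continuous_on holomorphic_intros)
  then have "bounded ((\<lambda>z. rGamma (z + of_nat k)) ` cball c 1)"
    by (intro compact_imp_bounded compact_continuous_image compact_cball)
  then obtain C where C: "\<And>z. z \<in> cball c 1 \<Longrightarrow> norm (rGamma (z + of_nat k)) \<le> C"
    unfolding bounded_iff by (meson imageI)
  show ?thesis
  proof (rule that)
    fix z n assume z: "z \<in> cball c 1" and n: "n \<ge> k"
    have "norm z \<le> norm c + 1"
      using z norm_triangle_ineq2[of z c] by (simp add: dist_norm norm_minus_commute)
    then have "Re (z + of_nat k) \<ge> 1"
      using k abs_Re_le_cmod[of z] by simp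
    then have "fact (n - k) * norm (rGamma (z + of_nat n)) \<le>
        norm (pochhammer (z + of_nat k) (n - k)) * norm (rGamma (z + of_nat n))"
      by (intro mult_right_mono norm_pochhammer_ge_fact) auto
    also have "\<dots> = norm (rGamma (z + of_nat k))"
      using pochhammer_rGamma[of "z + of_nat k" "n - k"] n by (simp add: norm_mult of_nat_diff)
    also have "\<dots> \<le> C"
      by (rule C[OF z])
    finally show "norm (rGamma (z + of_nat n)) \<le> C / fact (n - k)"
      by (simp add: pos_le_divide_eq mult.commute)
  qed
qed

lemma add_of_nat_ratio_tendsto_1: "(\<lambda>n. (a + of_nat n) / (c + of_nat n)) \<longlonglongrightarrow> (1 :: complex)"
proof (rule Lim_transform_eventually)
  have "(\<lambda>n. (a * (1 / of_nat n) + 1) / (c * (1 / of_nat n) + 1)) \<longlonglongrightarrow> (a * 0 + 1) / (c * 0 + 1)"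
    by (intro tendsto_intros lim_1_over_n) simp
  then show "(\<lambda>n. (a * (1 / of_nat n) + 1) / (c * (1 / of_nat n) + 1)) \<longlonglongrightarrow> 1"
    by simp
  show "\<forall>\<^sub>F n in sequentially. (a * (1 / of_nat n) + 1) / (c * (1 / of_nat n) + 1) =
      (a + of_nat n) / (c + of_nat n)"
    using eventually_gt_at_top[of 0]
  proof eventually_elim
    case (elim n)
    have "(a * (1 / x) + 1) / (c * (1 / x) + 1) = (a + x) / (c + x)" if "x \<noteq> 0" for x
    proof -
      have "(a * (1 / x) + 1) / (c * (1 / x) + 1) = ((a + x) / x) / ((c + x) / x)"
        using that by (simp add: add_divide_distrib)
      then show ?thesis
        using that by simp
    qed
    then show ?case
      using elim by simp
  qed
qed

lemma summable_pochhammer_majorant: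
  fixes a b :: complex
  assumes x: "0 \<le> x" "x < 1"
  shows "summable (\<lambda>n. norm (pochhammer a n * pochhammer b n) / (fact n * fact (n - k)) * x ^ n)"
    (is "summable ?f")
proof -
  define r where "r n = norm ((a + of_nat n) / (1 + of_nat n)) *
      norm ((b + of_nat n) / (1 - of_nat k + of_nat n)) * x" for n
  have f_Suc: "?f (Suc n) = r n * ?f n" if "n \<ge> k" for n
  proof -
    have fact: "fact (Suc n - k) = (1 - real k + real n) * fact (n - k)"
      using that by (simp add: Suc_diff_le of_nat_diff)
    have "norm (1 - of_nat k + of_nat n :: complex) = 1 - real k + real n"
      using that norm_of_real[of "1 - real k + real n", where 'a = complex] by simp
    moreover have "norm (1 + of_nat n :: complex) = real (Suc n)"
      using norm_of_real[of "1 + real n", where 'a = complex] by simp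
    ultimately show ?thesis
      unfolding r_def pochhammer_Suc fact fact_Suc norm_divide norm_mult power_Suc
      by (simp add: mult_ac)
  qed
  have "r \<longlonglongrightarrow> norm (1 :: complex) * norm (1 :: complex) * x"
    unfolding r_def by (intro tendsto_intros add_of_nat_ratio_tendsto_1)
  then have "\<forall>\<^sub>F n in sequentially. r n < (1 + x) / 2"
    using x by (intro order_tendstoD(2)) auto
  then obtain N where N: "\<And>n. n \<ge> N \<Longrightarrow> r n < (1 + x) / 2"
    by (auto simp: eventually_sequentially)
  show ?thesis
  proof (rule summable_ratio_test[of "(1 + x) / 2" "max N k"])
    fix n assume n: "n \<ge> max N k"
    have "r n \<ge> 0" "?f n \<ge> 0"
      using x by (simp_all add: r_def)
    then have "norm (?f (Suc n)) = r n * norm (?f n)"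
      using f_Suc[of n] n by (simp add: abs_mult)
    also have "\<dots> \<le> (1 + x) / 2 * norm (?f n)"
      using N[of n] n by (intro mult_right_mono) auto
    finally show "norm (?f (Suc n)) \<le> (1 + x) / 2 * norm (?f n)" .
  qed (use x in auto)
qed

lemma hyp2F1_reg_coeff_locally_dominated:
  obtains h k where "\<And>x. 0 \<le> x \<Longrightarrow> x < 1 \<Longrightarrow> summable (\<lambda>n. h n * x ^ n)"
    and "\<And>z n. z \<in> cball c 1 \<Longrightarrow> n \<ge> k \<Longrightarrow> norm (hyp2F1_reg_coeff a b z n) \<le> h n"
proof -
  obtain k C where C: "\<And>z n. z \<in> cball c 1 \<Longrightarrow> n \<ge> k \<Longrightarrow>
      norm (rGamma (z + of_nat n)) \<le> C / fact (n - k)"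
    using norm_rGamma_add_of_nat_le by blast
  define h where "h n =
      C * (norm (pochhammer a n * pochhammer b n) / (fact n * fact (n - k)))" for n
  show ?thesis
  proof (rule that)
    show "summable (\<lambda>n. h n * x ^ n)" if "0 \<le> x" "x < 1" for x
      unfolding h_def mult.assoc[of C] by (intro summable_mult summable_pochhammer_majorant that)
    show "norm (hyp2F1_reg_coeff a b z n) \<le> h n" if "z \<in> cball c 1" "n \<ge> k" for z n
      using mult_left_mono[OF C[OF that], of "norm (pochhammer a n * pochhammer b n) / fact n"]
      by (simp add: hyp2F1_reg_coeff_def h_def norm_mult norm_divide mult_ac)
  qed
qed

lemma hyp2F1_reg_summable_norm:
  assumes "norm w < 1"
  shows "summable (\<lambda>n. norm (hyp2F1_reg_coeff a b c n * w ^ n))"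
proof -
  obtain h k where h: "\<And>x. 0 \<le> x \<Longrightarrow> x < 1 \<Longrightarrow> summable (\<lambda>n. h n * x ^ n)"
    "\<And>z n. z \<in> cball c 1 \<Longrightarrow> n \<ge> k \<Longrightarrow> norm (hyp2F1_reg_coeff a b z n) \<le> h n"
    using hyp2F1_reg_coeff_locally_dominated by blast
  show ?thesis
  proof (rule summable_comparison_test'[OF h(1)])
    show "norm (norm (hyp2F1_reg_coeff a b c n * w ^ n)) \<le> h n * norm w ^ n" if "n \<ge> k" for n
      using mult_right_mono[OF h(2)[of c n], of "norm w ^ n"] that
      by (simp add: norm_mult norm_power)
  qed (use assms in auto)
qed

lemmas hyp2F1_reg_summable = summable_norm_cancel[OF hyp2F1_reg_summable_norm]

lemma hyp2F1_reg_series_holomorphic_parameter: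
  assumes w: "norm w < 1"
  shows "(\<lambda>c. hyp2F1_reg_series a b c w) holomorphic_on UNIV"
proof (rule holomorphic_uniform_sequence[where f = "\<lambda>N c. \<Sum>n<N. hyp2F1_reg_coeff a b c n * w ^ n"])
  show "(\<lambda>c. \<Sum>n<N. hyp2F1_reg_coeff a b c n * w ^ n) holomorphic_on UNIV" for N
    unfolding hyp2F1_reg_coeff_def by (intro holomorphic_intros) auto
  fix c :: complex
  obtain h k where h: "\<And>x. 0 \<le> x \<Longrightarrow> x < 1 \<Longrightarrow> summable (\<lambda>n. h n * x ^ n)"
    "\<And>z n. z \<in> cball c 1 \<Longrightarrow> n \<ge> k \<Longrightarrow> norm (hyp2F1_reg_coeff a b z n) \<le> h n"
    using hyp2F1_reg_coeff_locally_dominated by blast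
  have "uniform_limit (cball c 1) (\<lambda>N c. \<Sum>n<N. hyp2F1_reg_coeff a b c n * w ^ n)
      (\<lambda>c. hyp2F1_reg_series a b c w) sequentially"
    unfolding hyp2F1_reg_series_eq
  proof (rule Weierstrass_m_test_ev)
    have "\<forall>z\<in>cball c 1. norm (hyp2F1_reg_coeff a b z n * w ^ n) \<le> h n * norm w ^ n" if "n \<ge> k" for n
      using that by (auto simp: norm_mult norm_power intro!: mult_right_mono h(2))
    then show "\<forall>\<^sub>F n in sequentially. \<forall>z\<in>cball c 1. norm (hyp2F1_reg_coeff a b z n * w ^ n) \<le>
        h n * norm w ^ n"
      unfolding eventually_sequentially by blast
  qed (use h(1) w in auto)
  then show "\<exists>d. 0 < d \<and> cball c d \<subseteq> UNIV \<and> uniform_limit (cball c d)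
      (\<lambda>N c. \<Sum>n<N. hyp2F1_reg_coeff a b c n * w ^ n) (\<lambda>c. hyp2F1_reg_series a b c w) sequentially"
    by (intro exI[of _ 1]) auto
qed simp

lemma hyp2F1_reg_series_0: "hyp2F1_reg_series a b c 0 = rGamma c"
  unfolding hyp2F1_reg_series_eq powser_zero by (simp add: hyp2F1_reg_coeff_def)

lemma hyp2F1_reg_series_sums:
  "norm w < 1 \<Longrightarrow> (\<lambda>n. hyp2F1_reg_coeff a b c n * w ^ n) sums hyp2F1_reg_series a b c w"
  unfolding hyp2F1_reg_series_eq by (rule summable_sums) (rule hyp2F1_reg_summable)

lemma one_plus_of_nat_nonzero: "1 + of_nat n \<noteq> (0 :: complex)"
  by (metis of_nat_Suc of_nat_neq_0)

lemma diffs_hyp2F1_reg_coeff: "diffs (hyp2F1_reg_coeff a b c) n =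
  a * b * hyp2F1_reg_coeff (a + 1) (b + 1) (c + 1) n"
  unfolding diffs_def hyp2F1_reg_coeff_def pochhammer_rec fact_Suc
  by (simp add: one_plus_of_nat_nonzero add_ac mult_ac)

lemma DERIV_hyp2F1_reg_series:
  assumes w: "norm w < 1"
  shows "(hyp2F1_reg_series a b c has_field_derivative
      a * b * hyp2F1_reg_series (a + 1) (b + 1) (c + 1) w) (at w)"
proof -
  obtain K where K: "norm w < K" "K < 1"
    using dense[OF w] by blast
  then have "K > 0"
    using norm_ge_zero[of w] by linarith
  then have "((\<lambda>w. \<Sum>n. hyp2F1_reg_coeff a b c n * w ^ n) has_field_derivative
      (\<Sum>n. diffs (hyp2F1_reg_coeff a b c) n * w ^ n)) (at w)"
    using K by (intro termdiffs_strong[where K = "of_real K"] hyp2F1_reg_summable) auto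
  moreover have "(\<lambda>n. diffs (hyp2F1_reg_coeff a b c) n * w ^ n) sums
      (a * b * hyp2F1_reg_series (a + 1) (b + 1) (c + 1) w)"
    using sums_mult[OF hyp2F1_reg_series_sums[OF w], of "a * b" "a + 1" "b + 1" "c + 1"]
    by (simp only: diffs_hyp2F1_reg_coeff mult.assoc)
  ultimately show ?thesis
    unfolding hyp2F1_reg_series_eq[abs_def] by (simp only: sums_unique[symmetric])
qed

lemma hyp2F1_reg_series_holomorphic: "hyp2F1_reg_series a b c holomorphic_on ball 0 1"
  unfolding holomorphic_on_open[OF open_ball] by (auto intro!: exI DERIV_hyp2F1_reg_series)

lemma times_deriv_hyp2F1_reg_series_sums:
  assumes w: "norm w < 1"
  shows "(\<lambda>n. of_nat n * hyp2F1_reg_coeff a b c n * w ^ n) sums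
    (w * (a * b * hyp2F1_reg_series (a + 1) (b + 1) (c + 1) w))"
proof -
  have "(\<lambda>n. w * (a * b * (hyp2F1_reg_coeff (a + 1) (b + 1) (c + 1) n * w ^ n))) sums
      (w * (a * b * hyp2F1_reg_series (a + 1) (b + 1) (c + 1) w))"
    by (intro sums_mult hyp2F1_reg_series_sums w)
  then have "(\<lambda>n. of_nat (Suc n) * hyp2F1_reg_coeff a b c (Suc n) * w ^ Suc n) sums
      (w * (a * b * hyp2F1_reg_series (a + 1) (b + 1) (c + 1) w))"
    using diffs_hyp2F1_reg_coeff[of a b c] by (simp add: diffs_def mult_ac)
  then show ?thesis
    by (subst (asm) sums_Suc_iff) simp
qed

lemma hyp2F1_reg_series_lower:
  assumes w: "norm w < 1"
  shows "c * hyp2F1_reg_series a b (c + 1) w +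
    w * (a * b * hyp2F1_reg_series (a + 1) (b + 1) (c + 2) w) =
    hyp2F1_reg_series a b c w"
proof (rule sums_unique2)
  have "rGamma (c + of_nat n) = (c + of_nat n) * rGamma (c + 1 + of_nat n)" for n
    using rGamma_plus1[of "c + of_nat n"] by (simp add: add_ac)
  then have "c * hyp2F1_reg_coeff a b (c + 1) n + of_nat n * hyp2F1_reg_coeff a b (c + 1) n =
      hyp2F1_reg_coeff a b c n" for n
    by (simp add: hyp2F1_reg_coeff_def algebra_simps add_divide_distrib)
  then have "c * (hyp2F1_reg_coeff a b (c + 1) n * w ^ n) +
      of_nat n * hyp2F1_reg_coeff a b (c + 1) n * w ^ n =
      hyp2F1_reg_coeff a b c n * w ^ n" for n
    by (metis distrib_right mult.assoc)
  then show "(\<lambda>n. hyp2F1_reg_coeff a b c n * w ^ n) sums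
      (c * hyp2F1_reg_series a b (c + 1) w +
        w * (a * b * hyp2F1_reg_series (a + 1) (b + 1) (c + 2) w))"
    using sums_add[OF sums_mult[OF hyp2F1_reg_series_sums[OF w], of c a b "c + 1"]
        times_deriv_hyp2F1_reg_series_sums[OF w, of a b "c + 1"]]
    by (simp add: add.assoc)
qed (rule hyp2F1_reg_series_sums[OF w])

lemma hyp2F1_reg_coeff_shift:
  "hyp2F1_reg_coeff (a + 1) (b + 1) c (Suc n) -
    (of_nat n + (a + b + 1)) * hyp2F1_reg_coeff (a + 1) (b + 1) (c + 1) n =
    hyp2F1_reg_coeff a b c (Suc n)"
proof -
  define X where "X = pochhammer (a + 1) n * pochhammer (b + 1) n / fact n *
      rGamma (c + 1 + of_nat n)"
  have "hyp2F1_reg_coeff (a + 1) (b + 1) c (Suc n) =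
      X * ((a + 1 + of_nat n) * (b + 1 + of_nat n) / (1 + of_nat n))"
    unfolding hyp2F1_reg_coeff_def X_def pochhammer_Suc fact_Suc by (simp add: add_ac mult_ac)
  moreover have "hyp2F1_reg_coeff a b c (Suc n) = X * (a * b / (1 + of_nat n))"
    unfolding hyp2F1_reg_coeff_def X_def pochhammer_rec fact_Suc by (simp add: add_ac mult_ac)
  moreover have "(a + 1 + of_nat n) * (b + 1 + of_nat n) / (1 + of_nat n) -
      (of_nat n + (a + b + 1)) = a * b / (1 + of_nat n)"
    using one_plus_of_nat_nonzero[of n] by (simp add: field_simps)
  ultimately show ?thesis
    unfolding X_def hyp2F1_reg_coeff_def by (metis mult.commute right_diff_distrib)
qed

lemma hyp2F1_reg_series_ODE:
  assumes w: "norm w < 1"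
  shows "w * (1 - w) * ((a + 1) * (b + 1) * hyp2F1_reg_series (a + 2) (b + 2) (c + 2) w) +
      (c - (a + b + 1) * w) * hyp2F1_reg_series (a + 1) (b + 1) (c + 1) w =
    hyp2F1_reg_series a b c w"
proof -
  define G where "G = hyp2F1_reg_series (a + 1) (b + 1) (c + 1) w"
  define G1 where "G1 = (a + 1) * (b + 1) * hyp2F1_reg_series (a + 2) (b + 2) (c + 2) w"
  have tail: "(\<lambda>n. hyp2F1_reg_coeff a' b' c (Suc n) * w ^ Suc n) sums
      (hyp2F1_reg_series a' b' c w - rGamma c)" for a' b'
    by (subst sums_Suc_iff)
      (use hyp2F1_reg_series_sums[OF w, of a' b' c] in \<open>simp add: hyp2F1_reg_coeff_def\<close>)
  define g where "g = hyp2F1_reg_coeff (a + 1) (b + 1) (c + 1)"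
  have "(\<lambda>n. w * (of_nat n * g n * w ^ n + (a + b + 1) * (g n * w ^ n))) sums
      (w * (w * G1 + (a + b + 1) * G))"
    using times_deriv_hyp2F1_reg_series_sums[OF w, of "a + 1" "b + 1" "c + 1"]
      hyp2F1_reg_series_sums[OF w, of "a + 1" "b + 1" "c + 1"]
    unfolding G_def G1_def g_def by (intro sums_mult sums_add) (simp_all add: add.assoc)
  note sums_diff[OF tail[of "a + 1" "b + 1"] this]
  moreover have "hyp2F1_reg_coeff (a + 1) (b + 1) c (Suc n) * w ^ Suc n -
      w * (of_nat n * g n * w ^ n + (a + b + 1) * (g n * w ^ n)) =
      hyp2F1_reg_coeff a b c (Suc n) * w ^ Suc n" for n
    unfolding hyp2F1_reg_coeff_shift[of a b c, symmetric] g_def[symmetric]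
    by (simp add: algebra_simps)
  ultimately have "hyp2F1_reg_series (a + 1) (b + 1) c w - rGamma c -
      w * (w * G1 + (a + b + 1) * G) =
      hyp2F1_reg_series a b c w - rGamma c"
    using tail[of a b] by (simp only: sums_unique2)
  moreover have "c * G + w * G1 = hyp2F1_reg_series (a + 1) (b + 1) c w"
    using hyp2F1_reg_series_lower[OF w, of c "a + 1" "b + 1"] by (simp add: G_def G1_def add.assoc)
  ultimately show ?thesis
    unfolding G_def[symmetric] G1_def[symmetric] by (simp add: algebra_simps)
qed

lemma harmonic_ODE_solution:
  fixes S S1 :: "complex \<Rightarrow> complex"
  assumes A: "convex A" "0 \<in> A" "z \<in> A"
    and dS: "\<And>y. y \<in> A \<Longrightarrow> (S has_field_derivative S1 y) (at y within A)"
    and dS1: "\<And>y. y \<in> A \<Longrightarrow> (S1 has_field_derivative - (l\<^sup>2 * S y)) (at y within A)"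
  shows "l * S z = l * S 0 * cos (l * z) + S1 0 * sin (l * z)"
proof -
  define P Q where "P y = l * S y * cos (l * y) - S1 y * sin (l * y)"
    and "Q y = l * S y * sin (l * y) + S1 y * cos (l * y)" for y
  have "(P has_field_derivative 0) (at y within A)" "(Q has_field_derivative 0) (at y within A)"
    if "y \<in> A" for y
    unfolding P_def Q_def
    by (rule derivative_eq_intros refl dS[OF that] dS1[OF that] | simp add: algebra_simps
      power2_eq_square)+
  then have "P z = P 0" "Q z = Q 0"
    using has_field_derivative_zero_constant[OF A(1)] A(2,3) by metis+
  then have "P z = l * S 0" "Q z = S1 0"
    by (simp_all add: P_def Q_def)
  moreover have "l * S z = P z * cos (l * z) + Q z * sin (l * z)"
  proof -
    have "P z * cos (l * z) + Q z * sin (l * z) = l * S z * ((cos (l * z))\<^sup>2 + (sin (l * z))\<^sup>2)"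
      unfolding P_def Q_def by algebra
    then show ?thesis by simp
  qed
  ultimately show ?thesis by simp
qed

section \<open>Mehler's integral\<close>

definition cheb_series :: "complex \<Rightarrow> complex \<Rightarrow> complex" where
  "cheb_series \<nu> w = of_real (sqrt pi) * hyp2F1_reg_series (\<nu> + 1) (- \<nu>) (1/2) w"

lemma cheb_series_ODE:
  fixes \<nu> :: complex
  obtains E1 E2 where "\<And>w. norm w < 1 \<Longrightarrow> (cheb_series \<nu> has_field_derivative E1 w) (at w)"
    and "\<And>w. norm w < 1 \<Longrightarrow> (E1 has_field_derivative E2 w) (at w)"
    and "\<And>w. norm w < 1 \<Longrightarrow>
      w * (1 - w) * E2 w + (1/2 - 2 * w) * E1 w = - (\<nu> * (\<nu> + 1)) * cheb_series \<nu> w"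
proof
  define F F1 F2 where "F = hyp2F1_reg_series (\<nu> + 1) (- \<nu>) (1/2)"
    and "F1 = hyp2F1_reg_series (\<nu> + 2) (1 - \<nu>) (3/2)"
    and "F2 = hyp2F1_reg_series (\<nu> + 3) (2 - \<nu>) (5/2)"
  let ?K = "- (\<nu> * (\<nu> + 1)) * of_real (sqrt pi)"
  fix w :: complex assume w: "norm w < 1"
  show "(cheb_series \<nu> has_field_derivative ?K * F1 w) (at w)"
    using DERIV_cmult[OF DERIV_hyp2F1_reg_series[OF w, of "\<nu> + 1" "- \<nu>" "1/2"],
      of "of_real (sqrt pi)"]
    by (simp add: F1_def cheb_series_def[abs_def] algebra_simps)
  show "((\<lambda>w. ?K * F1 w) has_field_derivative ?K * ((\<nu> + 2) * (1 - \<nu>) * F2 w)) (at w)"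
    using DERIV_hyp2F1_reg_series[OF w, of "\<nu> + 2" "1 - \<nu>" "3/2"]
    by (intro DERIV_cmult) (simp add: F1_def F2_def add.assoc)
  have "w * (1 - w) * ((\<nu> + 2) * (1 - \<nu>) * F2 w) + (1/2 - 2 * w) * F1 w = F w"
    using hyp2F1_reg_series_ODE[OF w, of "\<nu> + 1" "- \<nu>" "1/2"]
    by (simp add: F_def F1_def F2_def add.assoc)
  then have "?K * (w * (1 - w) * ((\<nu> + 2) * (1 - \<nu>) * F2 w) + (1/2 - 2 * w) * F1 w) =
      - (\<nu> * (\<nu> + 1)) * cheb_series \<nu> w"
    by (simp add: F_def cheb_series_def)
  then show "w * (1 - w) * (?K * ((\<nu> + 2) * (1 - \<nu>) * F2 w)) + (1/2 - 2 * w) * (?K * F1 w) =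
      - (\<nu> * (\<nu> + 1)) * cheb_series \<nu> w"
    by (simp only: distrib_left mult_ac)
qed

lemma DERIV_sin_squared: "((\<lambda>y. (sin y)\<^sup>2) has_field_derivative 2 * sin y * cos y) (at y)"
  for y :: complex
  by (auto intro!: derivative_eq_intros)

lemma DERIV_cos_times_comp_sin_squared:
  fixes y :: complex
  assumes "(f has_field_derivative f' ((sin y)\<^sup>2)) (at ((sin y)\<^sup>2))"
  shows "((\<lambda>y. cos y * f ((sin y)\<^sup>2)) has_field_derivative
    - sin y * f ((sin y)\<^sup>2) + 2 * sin y * (cos y)\<^sup>2 * f' ((sin y)\<^sup>2)) (at y)"
  by (rule DERIV_cong[OF DERIV_mult'[OF DERIV_cos DERIV_chain2[OF assms DERIV_sin_squared[of y]]]])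
    (simp add: power2_eq_square)

lemma DERIV2_cos_times_comp_sin_squared:
  fixes y \<nu> :: complex and f f' f'' :: "complex \<Rightarrow> complex"
  defines "w \<equiv> (sin y)\<^sup>2"
  assumes df: "(f has_field_derivative f' w) (at w)" "(f' has_field_derivative f'' w) (at w)"
    and ODE: "w * (1 - w) * f'' w + (1/2 - 2 * w) * f' w = - (\<nu> * (\<nu> + 1)) * f w"
  shows "((\<lambda>y. - sin y * f ((sin y)\<^sup>2) + 2 * sin y * (cos y)\<^sup>2 * f' ((sin y)\<^sup>2)) has_field_derivative
    - ((2 * \<nu> + 1)\<^sup>2 * (cos y * f w))) (at y)"
proof -
  note chain = DERIV_chain2[OF df(1)[unfolded w_def] DERIV_sin_squared[of y]]
    DERIV_chain2[OF df(2)[unfolded w_def] DERIV_sin_squared[of y]]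
  have cos_sq: "(cos y)\<^sup>2 = 1 - w"
    by (simp add: w_def cos_squared_eq)
  have dcoeff: "((\<lambda>y. 2 * sin y * (cos y)\<^sup>2) has_field_derivative
        2 * cos y * ((cos y)\<^sup>2 - 2 * (sin y)\<^sup>2)) (at y)"
    by (rule DERIV_cong, (rule derivative_eq_intros refl)+)
      (simp add: power2_eq_square algebra_simps)
  have "((\<lambda>y. - sin y * f ((sin y)\<^sup>2) + 2 * sin y * (cos y)\<^sup>2 * f' ((sin y)\<^sup>2)) has_field_derivative
      cos y * (4 * (w * (cos y)\<^sup>2 * f'' w) + (2 * (cos y)\<^sup>2 - 6 * w) * f' w - f w)) (at y)"
    unfolding w_def
    by (rule DERIV_cong[OF DERIV_add[OF DERIV_mult'[OF DERIV_minus[OF DERIV_sin] chain(1)]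
          DERIV_mult'[OF dcoeff chain(2)]]])
      (simp add: power2_eq_square algebra_simps)
  also have "4 * (w * (cos y)\<^sup>2 * f'' w) + (2 * (cos y)\<^sup>2 - 6 * w) * f' w =
      4 * (w * (1 - w) * f'' w + (1/2 - 2 * w) * f' w)"
    unfolding cos_sq by (simp add: algebra_simps)
  also have "cos y * (4 * (w * (1 - w) * f'' w + (1/2 - 2 * w) * f' w) - f w) =
      - ((2 * \<nu> + 1)\<^sup>2 * (cos y * f w))"
    unfolding ODE by (simp add: power2_eq_square algebra_simps)
  finally show ?thesis .
qed

lemma cos_times_cheb_series:
  fixes z \<nu> :: complex
  assumes \<nu>: "2 * \<nu> + 1 \<noteq> 0" and z: "\<And>y. y \<in> closed_segment 0 z \<Longrightarrow> norm (sin y) < 1"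
  shows "cos z * cheb_series \<nu> ((sin z)\<^sup>2) = cos ((2 * \<nu> + 1) * z)"
proof -
  obtain E1 E2 where dE: "\<And>w. norm w < 1 \<Longrightarrow> (cheb_series \<nu> has_field_derivative E1 w) (at w)"
    "\<And>w. norm w < 1 \<Longrightarrow> (E1 has_field_derivative E2 w) (at w)"
    and ODE: "\<And>w. norm w < 1 \<Longrightarrow>
      w * (1 - w) * E2 w + (1/2 - 2 * w) * E1 w = - (\<nu> * (\<nu> + 1)) * cheb_series \<nu> w"
    using cheb_series_ODE by blast
  define S S1 where "S y = cos y * cheb_series \<nu> ((sin y)\<^sup>2)"
    and "S1 y = - sin y * cheb_series \<nu> ((sin y)\<^sup>2) + 2 * sin y * (cos y)\<^sup>2 * E1 ((sin y)\<^sup>2)" for y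
  have "(2 * \<nu> + 1) * S z =
      (2 * \<nu> + 1) * S 0 * cos ((2 * \<nu> + 1) * z) + S1 0 * sin ((2 * \<nu> + 1) * z)"
  proof (rule harmonic_ODE_solution[of "closed_segment 0 z"])
    fix y assume "y \<in> closed_segment 0 z"
    then have sq: "norm ((sin y)\<^sup>2) < 1"
      using z by (simp add: norm_power abs_square_less_1)
    show "(S has_field_derivative S1 y) (at y within closed_segment 0 z)"
      unfolding S_def S1_def
      by (rule has_field_derivative_at_within, rule DERIV_cos_times_comp_sin_squared)
        (rule dE(1)[OF sq])
    show "(S1 has_field_derivative - ((2 * \<nu> + 1)\<^sup>2 * S y)) (at y within closed_segment 0 z)"
      unfolding S_def S1_def
      by (rule has_field_derivative_at_within,
        rule DERIV2_cos_times_comp_sin_squared[where f'' = E2])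
        (rule dE[OF sq] ODE[OF sq])+
  qed auto
  moreover have "S 0 = 1" "S1 0 = 0"
    using rGamma_inverse_Gamma[of "1/2 :: complex"] Gamma_one_half_complex
    by (simp_all add: S_def S1_def cheb_series_def hyp2F1_reg_series_0)
  ultimately show ?thesis
    using \<nu> by (simp add: S_def)
qed

definition cheb_closed :: "complex \<Rightarrow> complex \<Rightarrow> complex" where
  "cheb_closed \<nu> w = cosh ((2 * \<nu> + 1) * Ln (csqrt (1 - w) + csqrt (- w))) / csqrt (1 - w)"

lemma Re_csqrt_pos:
  assumes "w \<notin> \<real>\<^sub>\<le>\<^sub>0"
  shows "Re (csqrt w) > 0"
proof -
  have "Re (csqrt w) \<noteq> 0"
  proof
    assume "Re (csqrt w) = 0"
    then have "csqrt w = \<i> * of_real (Im (csqrt w))"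
      by (simp add: complex_eq_iff)
    then have "(csqrt w)\<^sup>2 = of_real (- (Im (csqrt w))\<^sup>2)"
      by (simp add: power_mult_distrib)
    then have "w = of_real (- (Im (csqrt w))\<^sup>2)"
      by (simp only: power2_csqrt)
    then have "w \<in> \<real>\<^sub>\<le>\<^sub>0"
      by (metis neg_le_0_iff_le nonpos_Reals_of_real_iff zero_le_power2)
    then show False
      using assms by contradiction
  qed
  then show ?thesis
    using Re_csqrt[of w] by linarith
qed

lemma cheb_closed_holomorphic: "cheb_closed \<nu> holomorphic_on {w. - w \<notin> \<real>\<^sub>\<le>\<^sub>0}"
proof -
  have pos: "1 - w \<notin> \<real>\<^sub>\<le>\<^sub>0" "Re (csqrt (1 - w)) > 0" "Re (csqrt (- w)) > 0"
    if "- w \<notin> \<real>\<^sub>\<le>\<^sub>0" for w :: complex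
  proof -
    show "1 - w \<notin> \<real>\<^sub>\<le>\<^sub>0"
      using that by (auto simp: complex_nonpos_Reals_iff)
    then show "Re (csqrt (1 - w)) > 0" "Re (csqrt (- w)) > 0"
      using that by (simp_all only: Re_csqrt_pos not_False_eq_True)
  qed
  have "csqrt (1 - w) + csqrt (- w) \<notin> \<real>\<^sub>\<le>\<^sub>0" "csqrt (1 - w) \<noteq> 0" if "- w \<notin> \<real>\<^sub>\<le>\<^sub>0" for w :: complex
    using pos(2,3)[OF that] by (auto simp: complex_nonpos_Reals_iff simp del: csqrt.sel)
  then show ?thesis
    unfolding cheb_closed_def cosh_field_def
    by (intro holomorphic_intros holomorphic_on_csqrt' holomorphic_on_Ln') (use pos(1) in auto)
qed

lemma cosh_of_real_complex: "cosh (complex_of_real x) = of_real (cosh x)"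
  and sinh_of_real_complex: "sinh (complex_of_real x) = of_real (sinh x)"
  by (simp_all add: sinh_def cosh_def exp_of_real scaleR_conv_of_real flip: of_real_minus)

lemma cheb_series_eq_closed_of_real:
  assumes \<nu>: "2 * \<nu> + 1 \<noteq> 0" and x: "- 1 < x" "x < 0"
  shows "cheb_series \<nu> (of_real x) = cheb_closed \<nu> (of_real x)"
proof -
  define t where "t = arsinh (sqrt (- x))"
  have sinh_t: "sinh t = sqrt (- x)"
    by (simp add: t_def sinh_arsinh_real)
  moreover have "cosh t = sqrt ((cosh t)\<^sup>2)"
    by (simp only: real_sqrt_abs abs_of_nonneg cosh_real_nonneg)
  ultimately have cosh_t: "cosh t = sqrt (1 - x)"
    using x by (simp add: cosh_square_eq)
  have "sinh t \<ge> 0" and t_less: "sinh t < 1"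
    using x by (simp_all add: sinh_t)
  then have t_nonneg: "t \<ge> 0"
    by simp
  have cos_sin: "cos (\<i> * z) = cosh z" "sin (\<i> * z) = \<i> * sinh z" for z :: complex
    by (simp_all add: cosh_conv_cos sinh_conv_sin)
  have norm_sin: "norm (sin y) < 1" if y: "y \<in> closed_segment 0 (\<i> * of_real t)" for y
  proof -
    obtain u where u: "0 \<le> u" "u \<le> 1" "y = \<i> * of_real (u * t)"
      using y by (auto simp: in_segment scaleR_conv_of_real mult_ac)
    have "norm (sin y) = sinh (u * t)"
      unfolding u(3) cos_sin using t_nonneg u(1)
      by (simp add: norm_mult sinh_of_real_complex del: of_real_mult)
    also have "\<dots> \<le> sinh t"
      using t_nonneg u mult_right_mono[of u 1 t] by simp
    finally show ?thesis
      using t_less by linarith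
  qed
  have "cos (\<i> * of_real t) * cheb_series \<nu> ((sin (\<i> * of_real t))\<^sup>2) =
      cos ((2 * \<nu> + 1) * (\<i> * of_real t))"
    using \<nu> norm_sin by (rule cos_times_cheb_series)
  then have "cosh (of_real t) * cheb_series \<nu> ((\<i> * sinh (of_real t))\<^sup>2) =
      cosh ((2 * \<nu> + 1) * of_real t)"
    by (simp only: cos_sin mult.left_commute[of "2 * \<nu> + 1" \<i>])
  moreover have "(\<i> * sinh (of_real t))\<^sup>2 = complex_of_real x"
    using x by (simp add: sinh_of_real_complex sinh_t power_mult_distrib flip: of_real_power)
  moreover have "csqrt (1 - of_real x) = cosh (of_real t)" "csqrt (- of_real x) = sinh (of_real t)"
    using csqrt_of_real_nonneg[of "1 - x"] csqrt_of_real_nonneg[of "- x"] x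
    by (simp_all add: sinh_of_real_complex cosh_of_real_complex sinh_t cosh_t)
  moreover have "Ln (cosh (complex_of_real t) + sinh (of_real t)) = of_real t"
    by (simp add: cosh_plus_sinh)
  ultimately show ?thesis
    unfolding cheb_closed_def by (simp add: nonzero_eq_divide_eq mult.commute cosh_of_real_complex)
qed

lemma open_neg_slit: "open {w :: complex. - w \<notin> \<real>\<^sub>\<le>\<^sub>0}"
proof -
  have "{w :: complex. - w \<notin> \<real>\<^sub>\<le>\<^sub>0} = uminus -` (- \<real>\<^sub>\<le>\<^sub>0)"
    by auto
  then show ?thesis
    by (simp add: open_vimage open_Compl continuous_on_minus)
qed

lemma connected_slit_disc: "connected (ball 0 1 \<inter> {w :: complex. - w \<notin> \<real>\<^sub>\<le>\<^sub>0})" (is "connected ?S")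
proof (rule starlike_imp_connected)
  have "closed_segment (- 1/2) z \<subseteq> ?S" if z: "z \<in> ?S" for z
  proof
    fix v assume v: "v \<in> closed_segment (- 1/2) z"
    have "closed_segment (- 1/2) z \<subseteq> ball 0 1"
      by (rule closed_segment_subset[OF _ _ convex_ball]) (use z in auto)
    moreover have "- v \<notin> \<real>\<^sub>\<le>\<^sub>0"
    proof
      obtain u where u: "0 \<le> u" "u \<le> 1" "v = of_real (1 - u) * (- 1/2) + of_real u * z"
        using v by (auto simp: in_segment scaleR_conv_of_real)
      assume "- v \<in> \<real>\<^sub>\<le>\<^sub>0"
      then have u_z: "u * Im z = 0" "1 - u \<le> u * Re z * 2"
        using u(3) by (auto simp: complex_nonpos_Reals_iff)
      then have "u > 0" "Im z = 0"
        using u by (auto simp: less_le)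
      then have "u * Re z < 0"
        using z by (auto simp: complex_nonpos_Reals_iff mult_pos_neg)
      then show False
        using u_z u by linarith
    qed
    ultimately show "v \<in> ?S"
      using v by blast
  qed
  moreover have "- 1/2 \<in> ?S"
    by (auto simp: complex_nonpos_Reals_iff)
  ultimately show "starlike ?S"
    unfolding starlike_def by blast
qed

lemma cheb_series_eq_closed:
  assumes \<nu>: "2 * \<nu> + 1 \<noteq> 0" and w: "norm w < 1" "- w \<notin> \<real>\<^sub>\<le>\<^sub>0"
  shows "cheb_series \<nu> w = cheb_closed \<nu> w"
proof (rule analytic_continuation_Ioo[OF _ _ _ connected_slit_disc,
      where f = "cheb_series \<nu>" and g = "cheb_closed \<nu>" and a = "- 1" and b = 0])
  show "cheb_series \<nu> holomorphic_on ball 0 1 \<inter> {w. - w \<notin> \<real>\<^sub>\<le>\<^sub>0}"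
    unfolding cheb_series_def[abs_def]
    by (intro holomorphic_intros holomorphic_on_subset[OF hyp2F1_reg_series_holomorphic]) auto
  show "cheb_closed \<nu> holomorphic_on ball 0 1 \<inter> {w. - w \<notin> \<real>\<^sub>\<le>\<^sub>0}"
    by (rule holomorphic_on_subset[OF cheb_closed_holomorphic]) auto
  show "open (ball 0 1 \<inter> {w :: complex. - w \<notin> \<real>\<^sub>\<le>\<^sub>0})"
    by (intro open_Int open_ball open_neg_slit)
qed (use w cheb_series_eq_closed_of_real[OF \<nu>] in \<open>auto simp: complex_nonpos_Reals_iff\<close>)

definition cheb_ext :: "complex \<Rightarrow> complex \<Rightarrow> complex" where
  "cheb_ext \<nu> w = (if w \<in> ball 0 1 then cheb_series \<nu> w else cheb_closed \<nu> w)"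

lemma slit_plane_eq: "slit_plane = ball 0 1 \<union> {w. - w \<notin> \<real>\<^sub>\<le>\<^sub>0}"
proof (intro equalityI subsetI)
  fix w assume w: "w \<in> slit_plane"
  have "- w \<notin> \<real>\<^sub>\<le>\<^sub>0" if "norm w \<ge> 1"
  proof
    assume "- w \<in> \<real>\<^sub>\<le>\<^sub>0"
    then obtain x where "w = of_real x" "x \<ge> 0"
      by (metis minus_minus neg_le_0_iff_le nonpos_Reals_cases of_real_minus)
    then show False
      using w that by (auto simp: slit_plane_def)
  qed
  then show "w \<in> ball 0 1 \<union> {w. - w \<notin> \<real>\<^sub>\<le>\<^sub>0}"
    by (auto simp: not_less)
qed (auto simp: slit_plane_def)

lemma cheb_ext_holomorphic:
  assumes "2 * \<nu> + 1 \<noteq> 0"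
  shows "cheb_ext \<nu> holomorphic_on slit_plane"
  unfolding slit_plane_eq cheb_ext_def cheb_series_def[abs_def]
  by (intro holomorphic_on_If_Un holomorphic_intros hyp2F1_reg_series_holomorphic
    cheb_closed_holomorphic
      open_ball open_neg_slit) (use cheb_series_eq_closed[OF assms] in \<open>auto simp: cheb_series_def\<close>)

lemma slit_plane_scale:
  assumes w: "w \<in> slit_plane" and r: "0 \<le> r" "r \<le> 1"
  shows "w * of_real r \<in> slit_plane"
proof (rule ccontr)
  assume "w * of_real r \<notin> slit_plane"
  then obtain t where t: "t \<ge> 1" "w * of_real r = of_real t"
    by (auto simp: slit_plane_def)
  then have "w = of_real (t / r)" "t / r \<ge> 1"
    using r by (cases "r = 0"; auto simp: field_simps)+
  then have "w \<in> complex_of_real ` {1..}"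
    by (intro image_eqI[of _ _ "t / r"]) auto
  then show False
    using w by (simp add: slit_plane_def)
qed

lemma
  fixes f :: "'i \<Rightarrow> 'a \<Rightarrow> 'b::{banach, second_countable_topology}"
  assumes "\<And>i. i \<in> I \<Longrightarrow> set_integrable M A (f i)"
  shows set_integrable_sum: "set_integrable M A (\<lambda>x. \<Sum>i\<in>I. f i x)"
    and set_integral_sum: "(LINT x:A|M. \<Sum>i\<in>I. f i x) = (\<Sum>i\<in>I. LINT x:A|M. f i x)"
  using assms unfolding set_integrable_def set_lebesgue_integral_def
  by (simp_all add: scaleR_sum_right)

lemma set_integral_power_series_sums:
  fixes e :: "nat \<Rightarrow> complex" and W :: "real \<Rightarrow> complex"
  assumes W: "set_integrable lborel {0<..<1} W" and e: "summable (\<lambda>n. norm (e n))"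
  shows "(\<lambda>n. e n * (LINT r:{0<..<1}|lborel. W r * of_real r ^ n)) sums
    (LINT r:{0<..<1}|lborel. W r * (\<Sum>n. e n * of_real r ^ n))"
proof -
  let ?f = "\<lambda>n r. e n * (W r * of_real r ^ n)"
  have integrable: "set_integrable lborel {0<..<1} (?f n)" for n
    by (intro set_integrable_mult_right set_integrable_weighted[OF W,
      where C = 1] continuous_intros)
      (auto simp: norm_power power_le_one)
  have "(\<lambda>N. LINT r:{0<..<1}|lborel. \<Sum>n<N. ?f n r) \<longlonglongrightarrow>
      (LINT r:{0<..<1}|lborel. W r * (\<Sum>n. e n * of_real r ^ n))"
  proof (rule set_integral_dominated_convergence)
    show "set_integrable lborel {0<..<1} (\<lambda>r. (\<Sum>n. norm (e n)) * norm (W r))"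
      using set_integrable_norm[OF W] by (rule set_integrable_mult_right)
    show "set_borel_measurable lborel {0<..<1} (\<lambda>r. \<Sum>n<N. ?f n r)" for N
      using set_integrable_sum[of "{..<N}" lborel "{0<..<1}" ?f, OF integrable]
      by (simp only: set_integrable_def set_borel_measurable_def borel_measurable_integrable)
    fix r :: real assume r: "r \<in> {0<..<1}"
    have term_le: "norm (e n * of_real r ^ n) \<le> norm (e n)" for n
      using r by (simp add: norm_mult norm_power power_le_one mult_left_le)
    then have summable: "summable (\<lambda>n. e n * complex_of_real r ^ n)"
      by (intro summable_comparison_test'[OF e]) auto
    show "(\<lambda>N. \<Sum>n<N. ?f n r) \<longlonglongrightarrow> W r * (\<Sum>n. e n * of_real r ^ n)"
      using sums_mult[OF summable_sums[OF summable], of "W r"]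
      unfolding sums_def by (simp only: mult.left_commute)
    fix N
    have "norm (\<Sum>n<N. ?f n r) \<le> (\<Sum>n<N. norm (?f n r))"
      by (rule norm_sum)
    also have "\<dots> \<le> (\<Sum>n<N. norm (e n) * norm (W r))"
      using mult_right_mono[OF term_le norm_ge_zero[of "W r"]]
      by (intro sum_mono) (simp add: norm_mult mult_ac)
    also have "\<dots> = (\<Sum>n<N. norm (e n)) * norm (W r)"
      by (rule sum_distrib_right[symmetric])
    also have "\<dots> \<le> (\<Sum>n. norm (e n)) * norm (W r)"
      by (intro mult_right_mono sum_le_suminf e) auto
    finally show "norm (\<Sum>n<N. ?f n r) \<le> (\<Sum>n. norm (e n)) * norm (W r)" .
  qed
  then show ?thesis
    by (simp add: sums_def set_integral_sum[OF integrable])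
qed

lemma beta_weight_times_power:
  assumes "r \<in> {0<..<1}"
  shows "beta_weight a b r * of_real r ^ n = beta_weight (a + of_nat n) b r"
proof -
  have "of_real r powr (a - 1) * of_real r ^ n = complex_of_real r powr (a - 1 + of_nat n)"
    using assms by (simp add: powr_add powr_nat)
  then show ?thesis
    unfolding beta_weight_def by (simp add: algebra_simps)
qed

lemma Bateman_integral:
  assumes c: "Re c > 0" and d: "Re d > 0" and w: "norm w < 1"
  shows "(LINT r:{0<..<1}|lborel. beta_weight c d r * hyp2F1_reg_series a b c (w * of_real r)) =
    Gamma d * hyp2F1_reg_series a b (c + d) w"
proof (rule sums_unique2)
  let ?e = "\<lambda>n. hyp2F1_reg_coeff a b c n * w ^ n"
  have "(\<lambda>n. ?e n * (LINT r:{0<..<1}|lborel. beta_weight c d r * of_real r ^ n)) sums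
      (LINT r:{0<..<1}|lborel. beta_weight c d r * (\<Sum>n. ?e n * of_real r ^ n))"
    by (rule set_integral_power_series_sums[OF beta_weight_integrable[OF c d]
      hyp2F1_reg_summable_norm[OF w]])
  moreover have "?e n * (LINT r:{0<..<1}|lborel. beta_weight c d r * of_real r ^ n) =
      Gamma d * (hyp2F1_reg_coeff a b (c + d) n * w ^ n)" for n
  proof -
    have pos: "Re (c + of_nat n) > 0"
      using c by simp
    have "(LINT r:{0<..<1}|lborel. beta_weight c d r * of_real r ^ n) =
        (LINT r:{0<..<1}|lborel. beta_weight (c + of_nat n) d r)"
      by (rule set_integral_cong) (rule beta_weight_times_power)
    also have "\<dots> = Gamma (c + of_nat n) * Gamma d * rGamma (c + d + of_nat n)"
      unfolding beta_weight_integral[OF pos d] Beta_def rGamma_inverse_Gamma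
      by (simp add: field_simps)
    finally show ?thesis
      using Gamma_eq_zero_iff[of "c + of_nat n"] Gamma_arg_notin_nonpos_Ints[OF pos]
      by (simp add: hyp2F1_reg_coeff_def rGamma_inverse_Gamma)
  qed
  moreover have "(\<Sum>n. ?e n * of_real r ^ n) = hyp2F1_reg_series a b c (w * of_real r)" for r
    by (simp add: hyp2F1_reg_series_eq power_mult_distrib mult.assoc)
  ultimately show "(\<lambda>n. Gamma d * (hyp2F1_reg_coeff a b (c + d) n * w ^ n)) sums
      (LINT r:{0<..<1}|lborel. beta_weight c d r * hyp2F1_reg_series a b c (w * of_real r))"
    by (simp only:)
  show "(\<lambda>n. Gamma d * (hyp2F1_reg_coeff a b (c + d) n * w ^ n)) sums
      (Gamma d * hyp2F1_reg_series a b (c + d) w)"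
    by (intro sums_mult hyp2F1_reg_series_sums w)
qed

definition mehler_integral :: "complex \<Rightarrow> complex \<Rightarrow> complex \<Rightarrow> complex" where
  "mehler_integral \<nu> \<mu> w =
    (LINT r:{0<..<1}|lborel. beta_weight (1/2) (1/2 - \<mu>) r * cheb_ext \<nu> (w * of_real r))"

lemma mehler_integral_eq_series:
  assumes \<mu>: "Re \<mu> < 1/2" and w: "norm w < 1"
  shows "mehler_integral \<nu> \<mu> w =
    of_real (sqrt pi) * Gamma (1/2 - \<mu>) * hyp2F1_reg_series (\<nu> + 1) (- \<nu>) (1 - \<mu>) w"
proof -
  have "cheb_ext \<nu> (w * of_real r) =
      of_real (sqrt pi) * hyp2F1_reg_series (\<nu> + 1) (- \<nu>) (1/2) (w * of_real r)"
    if "r \<in> {0<..<1}" for r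
  proof -
    have "norm (w * of_real r) \<le> norm w * 1"
      using that unfolding norm_mult by (intro mult_left_mono) auto
    then show ?thesis
      using w by (simp add: cheb_ext_def cheb_series_def)
  qed
  then have "mehler_integral \<nu> \<mu> w = (LINT r:{0<..<1}|lborel. of_real (sqrt pi) *
      (beta_weight (1/2) (1/2 - \<mu>) r * hyp2F1_reg_series (\<nu> + 1) (- \<nu>) (1/2) (w * of_real r)))"
    unfolding mehler_integral_def by (intro set_integral_cong) (simp only: mult.left_commute)
  also have "\<dots> = of_real (sqrt pi) *
      (Gamma (1/2 - \<mu>) * hyp2F1_reg_series (\<nu> + 1) (- \<nu>) (1/2 + (1/2 - \<mu>)) w)"
    unfolding set_integral_mult_right by (subst Bateman_integral) (use \<mu> w in auto)
  finally show ?thesis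
    by simp
qed

definition is_hyp2F1_reg_continuation :: "complex \<Rightarrow> complex \<Rightarrow> (complex \<Rightarrow> complex) \<Rightarrow> bool" where
  "is_hyp2F1_reg_continuation \<nu> c F \<longleftrightarrow> F holomorphic_on slit_plane \<and>
    (\<forall>w. norm w < 1 \<longrightarrow> F w = hyp2F1_reg_series (\<nu> + 1) (- \<nu>) c w)"

lemma is_hyp2F1_reg_continuation_lower:
  assumes F: "is_hyp2F1_reg_continuation \<nu> (c + 1) F"
  shows "is_hyp2F1_reg_continuation \<nu> c (\<lambda>w. c * F w + w * deriv F w)"
proof -
  have hol: "F holomorphic_on slit_plane"
    and eq: "\<And>w. norm w < 1 \<Longrightarrow> F w = hyp2F1_reg_series (\<nu> + 1) (- \<nu>) (c + 1) w"
    using F by (auto simp: is_hyp2F1_reg_continuation_def)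
  have "c * F w + w * deriv F w = hyp2F1_reg_series (\<nu> + 1) (- \<nu>) c w" if w: "norm w < 1" for w
  proof -
    have "\<forall>\<^sub>F v in nhds w. v \<in> ball 0 1"
      using w by (intro eventually_nhds_in_open) auto
    then have "\<forall>\<^sub>F v in nhds w. F v = hyp2F1_reg_series (\<nu> + 1) (- \<nu>) (c + 1) v"
      by eventually_elim (use eq in auto)
    then have "deriv F w = deriv (hyp2F1_reg_series (\<nu> + 1) (- \<nu>) (c + 1)) w"
      by (intro deriv_cong_ev) auto
    also have "\<dots> = (\<nu> + 1) * - \<nu> * hyp2F1_reg_series (\<nu> + 1 + 1) (- \<nu> + 1) (c + 1 + 1) w"
      by (intro DERIV_imp_deriv DERIV_hyp2F1_reg_series w)
    finally show ?thesis
      using hyp2F1_reg_series_lower[OF w, of c "\<nu> + 1" "- \<nu>"] eq[OF w] by (simp add: add.assoc)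
  qed
  moreover have "(\<lambda>w. c * F w + w * deriv F w) holomorphic_on slit_plane"
    by (intro holomorphic_intros hol holomorphic_deriv open_slit_plane)
  ultimately show ?thesis
    by (simp add: is_hyp2F1_reg_continuation_def)
qed

context
  fixes \<nu> :: complex
  assumes \<nu>: "2 * \<nu> + 1 \<noteq> 0"
begin

lemma cheb_ext_locally_bounded:
  assumes w: "w \<in> slit_plane"
  shows "\<exists>e>0. \<exists>C. \<forall>v\<in>ball w e. \<forall>r\<in>{0<..<1::real}. norm (cheb_ext \<nu> (v * of_real r)) \<le> C"
proof -
  obtain e where e: "e > 0" "cball w e \<subseteq> slit_plane"
    using open_slit_plane w open_contains_cball by blast
  let ?K = "(\<lambda>p. fst p * complex_of_real (snd p)) ` (cball w e \<times> {0..1})"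
  have "compact ?K"
    by (intro compact_continuous_image compact_Times continuous_intros) auto
  moreover have "?K \<subseteq> slit_plane"
    using e(2) slit_plane_scale by force
  ultimately have "compact (cheb_ext \<nu> ` ?K)"
    using cheb_ext_holomorphic[OF \<nu>]
    by (meson compact_continuous_image continuous_on_subset holomorphic_on_imp_continuous_on)
  then obtain C where C: "\<And>y. y \<in> cheb_ext \<nu> ` ?K \<Longrightarrow> norm y \<le> C"
    using compact_imp_bounded bounded_iff by metis
  have "v * of_real r \<in> ?K" if "v \<in> ball w e" "r \<in> {0<..<1}" for v r
    using that by (intro image_eqI[of _ _ "(v, r)"]) auto
  then show ?thesis
    using e(1) C by blast
qed

lemma continuous_on_cheb_ext_ray:
  assumes "w \<in> slit_plane"
  shows "continuous_on {0<..<1} (\<lambda>r. cheb_ext \<nu> (w * of_real r))"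
  by (rule continuous_on_compose2[OF holomorphic_on_imp_continuous_on[OF cheb_ext_holomorphic[OF \<nu>]]])
    (use slit_plane_scale[OF assms] in \<open>auto intro!: continuous_intros\<close>)

lemma mehler_integral_integrable:
  assumes \<mu>: "Re \<mu> < 1/2" and w: "w \<in> slit_plane"
  shows "set_integrable lborel {0<..<1}
    (\<lambda>r. beta_weight (1/2) (1/2 - \<mu>) r * cheb_ext \<nu> (w * of_real r))"
proof -
  obtain e C where "e > 0" "\<forall>v\<in>ball w e. \<forall>r\<in>{0<..<1::real}. norm (cheb_ext \<nu> (v * of_real r)) \<le> C"
    using cheb_ext_locally_bounded[OF w] by blast
  then show ?thesis
    by (intro set_integrable_weighted[where C = C] beta_weight_integrable continuous_on_cheb_ext_ray
      w) (use \<mu> in auto)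
qed

lemma mehler_integral_holomorphic:
  assumes "Re \<mu> < 1/2"
  shows "mehler_integral \<nu> \<mu> holomorphic_on slit_plane"
  unfolding mehler_integral_def[abs_def]
proof (rule beta_transform_holomorphic[OF open_slit_plane])
  show "(\<lambda>w. cheb_ext \<nu> (w * of_real r)) holomorphic_on slit_plane" if "r \<in> {0<..<1}" for r
    by (rule holomorphic_on_compose_gen[OF _ cheb_ext_holomorphic[OF \<nu>], unfolded o_def])
      (use slit_plane_scale that in \<open>auto intro!: holomorphic_intros\<close>)
  show "\<exists>e>0. \<exists>C. \<forall>v\<in>ball w e \<inter> slit_plane. \<forall>r\<in>{0<..<1::real}.
      norm (cheb_ext \<nu> (v * of_real r)) \<le> C"
    if "w \<in> slit_plane" for w
    using cheb_ext_locally_bounded[OF that] by blast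
qed (use assms continuous_on_cheb_ext_ray in auto)

lemma mehler_integral_is_hyp2F1_reg_continuation:
  assumes c: "Re c > 1/2"
  shows "is_hyp2F1_reg_continuation \<nu> c
    (\<lambda>w. mehler_integral \<nu> (1 - c) w / (of_real (sqrt pi) * Gamma (c - 1/2)))"
proof -
  have \<mu>: "Re (1 - c) < 1/2" "Re (c - 1/2) > 0"
    using c by simp_all
  then have "Gamma (c - 1/2) \<noteq> 0"
    using Gamma_eq_zero_iff Gamma_arg_notin_nonpos_Ints by blast
  moreover from this have "(\<lambda>w. mehler_integral \<nu> (1 - c) w / (of_real (sqrt pi) * Gamma (c - 1/2)))
      holomorphic_on slit_plane"
    by (intro holomorphic_intros mehler_integral_holomorphic \<mu>) simp
  ultimately show ?thesis
    using mehler_integral_eq_series[OF \<mu>(1), of _ \<nu>] by (simp add: is_hyp2F1_reg_continuation_def)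
qed

lemma hyp2F1_reg_continuation_exists: "\<exists>F. is_hyp2F1_reg_continuation \<nu> c F"
proof -
  have "\<exists>F. is_hyp2F1_reg_continuation \<nu> c F" if "Re c + real k > 1/2" for k c
    using that
  proof (induction k arbitrary: c)
    case 0
    then show ?case
      using mehler_integral_is_hyp2F1_reg_continuation[of c] by auto
  next
    case (Suc k)
    then have "\<exists>F. is_hyp2F1_reg_continuation \<nu> (c + 1) F"
      by (intro Suc.IH) simp
    then show ?case
      using is_hyp2F1_reg_continuation_lower by blast
  qed
  moreover obtain k :: nat where "real k > 1/2 - Re c"
    using reals_Archimedean2 by blast
  then have "Re c + real k > 1/2"
    by linarith
  ultimately show ?thesis by blast
qed

lemma hyp2F1_reg_holomorphic: "hyp2F1_reg (\<nu> + 1) (- \<nu>) c holomorphic_on slit_plane"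
  and hyp2F1_reg_eq_series: "norm w < 1 \<Longrightarrow>
    hyp2F1_reg (\<nu> + 1) (- \<nu>) c w = hyp2F1_reg_series (\<nu> + 1) (- \<nu>) c w"
  using someI_ex[OF hyp2F1_reg_continuation_exists[of c, unfolded is_hyp2F1_reg_continuation_def]]
  unfolding hyp2F1_reg_def by blast+

lemma cheb_ext_sin_half_sq:
  assumes "0 < \<eta>" "\<eta> < pi"
  shows "cheb_ext \<nu> (of_real ((1 - cos \<eta>) / 2)) =
    cos ((\<nu> + 1/2) * of_real \<eta>) / of_real (cos (\<eta> / 2))"
proof -
  have half: "0 < cos (\<eta> / 2)"
    using assms by (intro cos_gt_zero) auto
  have sq: "(1 - cos \<eta>) / 2 = (sin (\<eta> / 2))\<^sup>2"
    using cos_double_sin[of "\<eta> / 2"] by simp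
  have inside: "norm (sin y) < 1" if y: "y \<in> closed_segment 0 (of_real (\<eta> / 2))" for y :: complex
  proof -
    obtain u where u: "0 \<le> u" "u \<le> 1" "y = of_real (u * (\<eta> / 2))"
      using y by (auto simp: in_segment scaleR_conv_of_real)
    have "u * (\<eta> / 2) \<le> 1 * (\<eta> / 2)"
      using u(2) assms by (intro mult_right_mono) auto
    then have bounds: "0 \<le> u * (\<eta> / 2)" "u * (\<eta> / 2) < pi / 2"
      using u(1) assms by (simp, linarith)
    then have "sin (u * (\<eta> / 2)) < sin (pi / 2)"
      by (intro sin_monotone_2pi) auto
    then show ?thesis
      using bounds unfolding u(3) sin_of_real norm_of_real by (simp add: sin_ge_zero)
  qed
  have "cos (of_real (\<eta> / 2)) * cheb_series \<nu> ((sin (of_real (\<eta> / 2)))\<^sup>2) =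
      cos ((2 * \<nu> + 1) * of_real (\<eta> / 2))"
    using \<nu> inside by (rule cos_times_cheb_series)
  moreover have "norm (sin (complex_of_real (\<eta> / 2))) < 1"
    by (rule inside) simp
  ultimately have "of_real (cos (\<eta> / 2)) * cheb_ext \<nu> (of_real ((1 - cos \<eta>) / 2)) =
      cos ((2 * \<nu> + 1) * of_real (\<eta> / 2))"
    unfolding sq sin_of_real cos_of_real norm_of_real of_real_power[symmetric]
    by (simp add: cheb_ext_def abs_square_less_1 del: of_real_power of_real_divide)
  also have "(2 * \<nu> + 1) * of_real (\<eta> / 2) = (\<nu> + 1/2) * of_real \<eta>"
    by (simp add: algebra_simps)
  finally show ?thesis
    using half by (simp add: nonzero_eq_divide_eq mult.commute)
qed

lemma mehler_integrand_angle:
  assumes b: "0 < b" "b < pi" and \<eta>: "\<eta> \<in> {0<..<b}"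
  defines "r \<equiv> (1 - cos \<eta>) / (1 - cos b)"
  shows "\<bar>sin \<eta> / (1 - cos b)\<bar> *\<^sub>R
      (beta_weight (1/2) (1/2 - of_real m) r * cheb_ext \<nu> (of_real ((1 - cos b) / 2) * of_real r)) =
    of_real (sqrt 2 * (1 - cos b) powr m) *
      (cos ((\<nu> + 1/2) * of_real \<eta>) * of_real ((cos \<eta> - cos b) powr (- m - 1/2)))"
proof -
  let ?D = "1 - cos b"
  have r: "r \<in> {0<..<1}"
    unfolding r_def by (rule bij_betw_apply[OF bij_betw_one_minus_cos_ratio[OF b] \<eta>])
  have half: "0 < cos (\<eta> / 2)"
    using \<eta> b by (intro cos_gt_zero) auto
  then have sqrt: "sqrt (1 + cos \<eta>) = sqrt 2 * cos (\<eta> / 2)"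
    using cos_double_cos[of "\<eta> / 2"] by (simp add: real_sqrt_mult)
  have "\<bar>sin \<eta> / ?D\<bar> *\<^sub>R beta_weight (1/2) (1/2 - of_real m) r =
      of_real (\<bar>sin \<eta> / ?D\<bar> * (r powr (1/2 - 1) * (1 - r) powr ((1/2 - m) - 1)))"
    using beta_weight_of_real[OF r, of "1/2" "1/2 - m"] by (simp add: scaleR_conv_of_real)
  also have "\<dots> = of_real (?D powr m * (sqrt 2 * cos (\<eta> / 2) * (cos \<eta> - cos b) powr (- m - 1/2)))"
    unfolding r_def one_minus_cos_ratio_weight[OF b(2) \<eta>] sqrt ..
  finally have weight: "\<bar>sin \<eta> / ?D\<bar> *\<^sub>R beta_weight (1/2) (1/2 - of_real m) r = \<dots>" .
  have "?D / 2 * r = (1 - cos \<eta>) / 2"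
    using one_minus_cos_pos[OF b] by (simp add: r_def field_simps)
  then have "cheb_ext \<nu> (of_real (?D / 2) * of_real r) =
      cos ((\<nu> + 1/2) * of_real \<eta>) / of_real (cos (\<eta> / 2))"
    using cheb_ext_sin_half_sq[of \<eta>] \<eta> b by (simp only: of_real_mult[symmetric]) simp
  then show ?thesis
    unfolding mult_scaleR_left[symmetric] weight using half by simp
qed

lemma mehler_integral_eq_angle_integral:
  assumes m: "m < 1/2" and b: "0 < b" "b < pi"
  shows "mehler_integral \<nu> (of_real m) (of_real ((1 - cos b) / 2)) =
    of_real (sqrt 2 * (1 - cos b) powr m) * mehler_angle_integral b m \<nu>"
proof -
  let ?D = "1 - cos b"
  let ?f = "\<lambda>r. beta_weight (1/2) (1/2 - of_real m) r * cheb_ext \<nu> (of_real (?D / 2) * of_real r)"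
  have slit: "complex_of_real (?D / 2) \<in> slit_plane"
    using norm_half_one_minus_cos_less_1[OF b]
    by (intro subsetD[OF ball_subset_slit_plane]) (simp only: mem_ball_0)
  have cont: "continuous_on {0<..<1} ?f"
    by (intro continuous_on_mult continuous_on_beta_weight continuous_on_cheb_ext_ray slit)
  have integrable: "set_integrable lborel {0<..<1} ?f"
    by (rule mehler_integral_integrable[OF _ slit]) (use m in simp)
  have "(LINT r:{0<..<1}|lborel. ?f r) =
      (LINT \<eta>:{0<..<b}|lborel. \<bar>sin \<eta> / ?D\<bar> *\<^sub>R ?f ((1 - cos \<eta>) / ?D))"
    by (rule set_integral_substitution(2)[OF _ _ bij_betw_one_minus_cos_ratio[OF b] _ _ cont
      integrable, symmetric])
      (use one_minus_cos_pos[OF b] in \<open>auto intro!: derivative_eq_intros continuous_intros\<close>)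
  also have "\<dots> = (LINT \<eta>:{0<..<b}|lborel. of_real (sqrt 2 * ?D powr m) *
      (cos ((\<nu> + 1/2) * of_real \<eta>) * of_real ((cos \<eta> - cos b) powr (- m - 1/2))))"
    by (rule set_integral_cong) (rule mehler_integrand_angle[OF b])
  also have "\<dots> = of_real (sqrt 2 * ?D powr m) * mehler_angle_integral b m \<nu>"
    unfolding mehler_angle_integral_def by (rule set_integral_mult_right)
  finally show ?thesis
    by (simp only: mehler_integral_def)
qed

end

section \<open>The expansion off the real axis\<close>

lemma double_plus_1_nonzero:
  fixes \<nu> :: complex
  assumes "Re \<nu> > - 1/2"
  shows "2 * \<nu> + 1 \<noteq> 0"
  using assms by (auto simp: complex_eq_iff)

definition slit_strip :: "complex set" where
  "slit_strip = {\<xi>. \<bar>Im \<xi>\<bar> < pi \<and> (Im \<xi> \<noteq> 0 \<or> Re \<xi> > 0)}"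

lemma D1_subset_slit_strip: "D1 \<subseteq> slit_strip"
  by (auto simp: D1_def slit_strip_def)

lemma open_slit_strip: "open slit_strip"
proof -
  have eq: "slit_strip =
      {\<xi>. Im \<xi> < pi} \<inter> {\<xi>. Im \<xi> > - pi} \<inter> ({\<xi>. Im \<xi> > 0} \<union> {\<xi>. Im \<xi> < 0} \<union> {\<xi>. Re \<xi> > 0})"
    by (auto simp: slit_strip_def)
  show ?thesis
    unfolding eq by (intro open_Int open_Un open_halfspace_Im_gt open_halfspace_Im_lt
      open_halfspace_Re_gt)
qed

lemma sin_Im_eq_0_slit_strip:
  assumes "\<xi> \<in> slit_strip" "sin (Im \<xi>) = 0"
  shows "Im \<xi> = 0" "Re \<xi> > 0"
proof -
  show "Im \<xi> = 0"
    using assms(2) by (rule sin_eq_0_pi[rotated 2]) (use assms(1) in \<open>auto simp: slit_strip_def\<close>)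
  then show "Re \<xi> > 0"
    using assms(1) by (simp add: slit_strip_def)
qed

lemma sinh_notin_nonpos_Reals:
  assumes "\<xi> \<in> slit_strip"
  shows "sinh \<xi> \<notin> \<real>\<^sub>\<le>\<^sub>0"
proof
  assume "sinh \<xi> \<in> \<real>\<^sub>\<le>\<^sub>0"
  then have Re: "sinh (Re \<xi>) * cos (Im \<xi>) \<le> 0" and "cosh (Re \<xi>) * sin (Im \<xi>) = 0"
    by (simp_all add: complex_nonpos_Reals_iff Re_sinh_complex Im_sinh_complex)
  then have "sin (Im \<xi>) = 0"
    using cosh_real_pos[of "Re \<xi>"] by auto
  then show False
    using sin_Im_eq_0_slit_strip[OF assms] Re by simp
qed

lemma sinh_nonzero_slit_strip:
  assumes "\<xi> \<in> slit_strip"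
  shows "sinh \<xi> \<noteq> 0" "sinh (\<xi> / 2) \<noteq> 0"
proof -
  have "\<xi> / 2 \<in> slit_strip"
    using assms by (auto simp: slit_strip_def)
  then show "sinh \<xi> \<noteq> 0" "sinh (\<xi> / 2) \<noteq> 0"
    using assms sinh_notin_nonpos_Reals by fastforce+
qed

lemma holomorphic_on_sinh [holomorphic_intros]:
  "f holomorphic_on A \<Longrightarrow> (\<lambda>z. sinh (f z) :: complex) holomorphic_on A"
  and holomorphic_on_cosh [holomorphic_intros]:
  "f holomorphic_on A \<Longrightarrow> (\<lambda>z. cosh (f z) :: complex) holomorphic_on A"
  unfolding sinh_field_def cosh_field_def by (intro holomorphic_intros; simp)+

definition coth_half :: "complex \<Rightarrow> complex" where
  "coth_half \<xi> = cosh (\<xi> / 2) / sinh (\<xi> / 2)"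

lemma cosh_minus_one: "cosh \<xi> - 1 = 2 * (sinh (\<xi> / 2))\<^sup>2" for \<xi> :: complex
  using cosh_double_cosh[of "\<xi> / 2"] cosh_square_eq[of "\<xi> / 2"] by simp

lemma coth_half_eq:
  assumes "sinh (\<xi> / 2) \<noteq> 0"
  shows "coth_half \<xi> = sinh \<xi> / (cosh \<xi> - 1)"
  using assms sinh_double[of "\<xi> / 2"] unfolding cosh_minus_one coth_half_def
  by (simp add: power2_eq_square)

lemma Re_coth_half: "Re (coth_half \<xi>) = sinh (Re \<xi>) / (2 * (norm (sinh (\<xi> / 2)))\<^sup>2)"
  and Im_coth_half: "Im (coth_half \<xi>) = - sin (Im \<xi>) / (2 * (norm (sinh (\<xi> / 2)))\<^sup>2)"
proof -
  define x y where "x = Re \<xi> / 2" and "y = Im \<xi> / 2"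
  have coth: "coth_half \<xi> = cosh (\<xi> / 2) * cnj (sinh (\<xi> / 2)) / of_real ((norm (sinh (\<xi> / 2)))\<^sup>2)"
    unfolding coth_half_def using complex_div_cnj[of "cosh (\<xi> / 2)" "sinh (\<xi> / 2)"]
    by (simp only: of_real_power)
  have "Re (cosh (\<xi> / 2) * cnj (sinh (\<xi> / 2))) =
      cosh x * cos y * (sinh x * cos y) + sinh x * sin y * (cosh x * sin y)"
    by (simp add: Re_cosh_complex Im_cosh_complex Re_sinh_complex Im_sinh_complex flip: x_def y_def)
  also have "\<dots> = sinh x * cosh x"
    using sin_cos_squared_add[of y] by algebra
  also have "\<dots> = sinh (Re \<xi>) / 2"
    using sinh_double[of x] by (simp add: x_def)
  finally have Re: "Re (cosh (\<xi> / 2) * cnj (sinh (\<xi> / 2))) = sinh (Re \<xi>) / 2" .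
  have "Im (cosh (\<xi> / 2) * cnj (sinh (\<xi> / 2))) =
      sinh x * sin y * (sinh x * cos y) - cosh x * cos y * (cosh x * sin y)"
    by (simp add: Re_cosh_complex Im_cosh_complex Re_sinh_complex Im_sinh_complex flip: x_def y_def)
  also have "\<dots> = - (sin y * cos y)"
    using cosh_square_eq[of x] by algebra
  also have "\<dots> = - sin (Im \<xi>) / 2"
    using sin_double[of y] by (simp add: y_def)
  finally have Im: "Im (cosh (\<xi> / 2) * cnj (sinh (\<xi> / 2))) = - sin (Im \<xi>) / 2" .
  show "Re (coth_half \<xi>) = sinh (Re \<xi>) / (2 * (norm (sinh (\<xi> / 2)))\<^sup>2)"
    "Im (coth_half \<xi>) = - sin (Im \<xi>) / (2 * (norm (sinh (\<xi> / 2)))\<^sup>2)"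
    unfolding coth Re_divide_of_real Im_divide_of_real Re Im by simp_all
qed

lemma coth_half_notin_nonpos_Reals:
  assumes "\<xi> \<in> slit_strip"
  shows "coth_half \<xi> \<notin> \<real>\<^sub>\<le>\<^sub>0"
proof
  assume "coth_half \<xi> \<in> \<real>\<^sub>\<le>\<^sub>0"
  then have "sin (Im \<xi>) = 0" "sinh (Re \<xi>) \<le> 0"
    using sinh_nonzero_slit_strip(2)[OF assms]
    by (auto simp: complex_nonpos_Reals_iff Re_coth_half Im_coth_half divide_le_0_iff)
  then show False
    using sin_Im_eq_0_slit_strip[OF assms] by simp
qed

lemma coth_half_holomorphic: "coth_half holomorphic_on slit_strip"
  unfolding coth_half_def[abs_def]
  by (intro holomorphic_intros) (simp_all add: sinh_nonzero_slit_strip)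

lemma one_minus_cosh_half_in_slit_plane:
  assumes "\<xi> \<in> slit_strip"
  shows "(1 - cosh \<xi>) / 2 \<in> slit_plane"
proof (rule ccontr)
  assume "(1 - cosh \<xi>) / 2 \<notin> slit_plane"
  then obtain r where "r \<ge> 1" "(1 - cosh \<xi>) / 2 = of_real r"
    by (auto simp: slit_plane_def)
  then have "cosh \<xi> = of_real (1 - 2 * r)"
    by (simp add: field_simps)
  then have "Re (cosh \<xi>) = 1 - 2 * r" "Im (cosh \<xi>) = 0"
    by simp_all
  then have cosh_le: "cosh (Re \<xi>) * cos (Im \<xi>) \<le> - 1" and "sinh (Re \<xi>) * sin (Im \<xi>) = 0"
    using \<open>r \<ge> 1\<close> by (simp_all add: Re_cosh_complex Im_cosh_complex)
  then consider "sin (Im \<xi>) = 0" | "Re \<xi> = 0"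
    by auto
  then show False
  proof cases
    case 1
    then have "cosh (Re \<xi>) \<le> - 1"
      using cosh_le sin_Im_eq_0_slit_strip[OF assms] by simp
    then show False
      using cosh_real_ge_1[of "Re \<xi>"] by linarith
  next
    case 2
    have "cos pi < cos \<bar>Im \<xi>\<bar>"
      using assms by (intro cos_monotone_0_pi) (auto simp: slit_strip_def)
    then show False
      using 2 cosh_le by simp
  qed
qed

lemma inverse_legendre_arg: "inverse (legendre_arg \<xi>) = (1 - exp (- 2 * \<xi>)) / 2"
proof -
  have "inverse (legendre_arg \<xi>) = exp (- \<xi>) * sinh \<xi>"
    by (simp add: legendre_arg_def exp_minus field_simps)
  also have "\<dots> = (1 - exp (- \<xi>) * exp (- \<xi>)) / 2"
    by (simp add: sinh_field_def exp_minus field_simps)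
  finally show ?thesis
    by (simp flip: exp_add)
qed

lemma legendre_arg_notin_nonpos_Reals:
  assumes "\<xi> \<in> slit_strip"
  shows "legendre_arg \<xi> \<notin> \<real>\<^sub>\<le>\<^sub>0"
proof
  assume "legendre_arg \<xi> \<in> \<real>\<^sub>\<le>\<^sub>0"
  then have "inverse (legendre_arg \<xi>) \<in> \<real>\<^sub>\<le>\<^sub>0"
    by (simp only: nonpos_Reals_inverse_iff)
  then have Re: "Re (exp (- 2 * \<xi>)) \<ge> 1" and "Im (exp (- 2 * \<xi>)) = 0"
    unfolding inverse_legendre_arg by (simp_all add: complex_nonpos_Reals_iff)
  then consider "sin (Im \<xi>) = 0" | "cos (Im \<xi>) = 0"
    by (auto simp: Im_exp sin_double)
  then show False
  proof cases
    case 1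
    then show False
      using Re sin_Im_eq_0_slit_strip[OF assms] by (simp add: Re_exp)
  next
    case 2
    then have "Re (exp (- 2 * \<xi>)) \<le> 0"
      by (simp add: Re_exp cos_double mult_nonneg_nonpos)
    then show False
      using Re by linarith
  qed
qed

lemma legendre_arg_minus_notin_nonpos_Reals:
  assumes "\<xi> \<in> slit_strip" "Im \<xi> \<noteq> 0"
  shows "legendre_arg (- \<xi>) \<notin> \<real>\<^sub>\<le>\<^sub>0"
  by (rule legendre_arg_notin_nonpos_Reals) (use assms in \<open>auto simp: slit_strip_def\<close>)

lemma legendre_arg_holomorphic: "legendre_arg holomorphic_on slit_strip"
  and legendre_arg_minus_holomorphic: "(\<lambda>\<xi>. legendre_arg (- \<xi>)) holomorphic_on slit_strip"
  unfolding legendre_arg_def[abs_def]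
  by (intro holomorphic_intros; simp add: sinh_nonzero_slit_strip)+

definition legendre_scaled :: "complex \<Rightarrow> complex \<Rightarrow> complex \<Rightarrow> complex" where
  "legendre_scaled \<nu> \<mu> \<xi> =
    Gamma (\<nu> - \<mu> + 1) * csqrt (2 * of_real pi * sinh \<xi>) * coth_half \<xi> powr \<mu> *
    hyp2F1_reg (\<nu> + 1) (- \<nu>) (1 - \<mu>) ((1 - cosh \<xi>) / 2)"

lemma legendre_scaled_D1:
  assumes "\<xi> \<in> D1"
  shows "legendre_scaled \<nu> \<mu> \<xi> =
    Gamma (\<nu> - \<mu> + 1) * csqrt (2 * of_real pi * sinh \<xi>) * legendre_P \<nu> \<mu> (cosh \<xi>)"
proof -
  have "sinh (\<xi> / 2) \<noteq> 0" and "Re \<xi> > 0"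
    using assms D1_subset_slit_strip sinh_nonzero_slit_strip(2) by (auto simp: D1_def)
  then have "Re (coth_half \<xi>) > 0"
    by (simp add: Re_coth_half)
  then have coth: "Re (coth_half \<xi>) > 0" "coth_half \<xi> \<noteq> 0"
    by auto
  have "\<bar>Im (Ln (coth_half \<xi>))\<bar> < pi / 2"
    using Re_Ln_pos_lt[OF coth(2)] coth(1) by simp
  then have "Ln (coth_half \<xi> * coth_half \<xi>) = Ln (coth_half \<xi>) + Ln (coth_half \<xi>)"
    by (intro Ln_times_simple coth(2)) auto
  then have "(coth_half \<xi> * coth_half \<xi>) powr (\<mu> / 2) = coth_half \<xi> powr \<mu>"
    using coth(2) by (simp add: powr_def)
  moreover have "(cosh \<xi> + 1) / (cosh \<xi> - 1) = coth_half \<xi> * coth_half \<xi>"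
    using cosh_double_cosh[of "\<xi> / 2"] unfolding cosh_minus_one coth_half_def
    by (simp add: power2_eq_square)
  ultimately show ?thesis
    unfolding legendre_scaled_def legendre_P_def by simp
qed

lemma legendre_scaled_holomorphic:
  assumes "2 * \<nu> + 1 \<noteq> 0"
  shows "legendre_scaled \<nu> \<mu> holomorphic_on slit_strip"
proof -
  have "(\<lambda>\<xi>. hyp2F1_reg (\<nu> + 1) (- \<nu>) (1 - \<mu>) ((1 - cosh \<xi>) / 2)) holomorphic_on slit_strip"
    by (rule holomorphic_on_compose_gen[OF _ hyp2F1_reg_holomorphic[OF assms], unfolded o_def])
      (auto intro!: holomorphic_intros simp: one_minus_cosh_half_in_slit_plane)
  moreover have "2 * of_real pi * sinh \<xi> \<notin> \<real>\<^sub>\<le>\<^sub>0" if "\<xi> \<in> slit_strip" for \<xi>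
    using of_real_mult_notin_nonpos_Reals[OF sinh_notin_nonpos_Reals[OF that], of "2 * pi"] by simp
  ultimately show ?thesis
    unfolding legendre_scaled_def[abs_def]
    by (intro holomorphic_intros holomorphic_on_csqrt' coth_half_holomorphic)
      (auto simp: coth_half_notin_nonpos_Reals)
qed

lemma imaginary_powr:
  assumes \<sigma>: "\<bar>\<sigma>\<bar> = 1" and s: "s > 0"
  shows "(\<i> * of_real (\<sigma> * s)) powr a = of_real s powr a * exp (\<i> * of_real (\<sigma> * pi / 2) * a)"
proof -
  have \<sigma>_cases: "\<sigma> = 1 \<or> \<sigma> = - 1"
    using \<sigma> by auto
  then have "Ln (\<i> * of_real (\<sigma> * s)) = Ln (of_real s) + \<i> * of_real (\<sigma> * pi / 2)"
    using Ln_times_of_real[OF s, of "\<i>"] Ln_times_of_real[OF s, of "- \<i>"] s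
    by (auto simp: Ln_of_real mult.commute)
  then show ?thesis
    using s \<sigma>_cases by (auto simp: powr_def exp_add[symmetric] distrib_left mult_ac)
qed

definition connection_coeff :: "real \<Rightarrow> complex \<Rightarrow> complex" where
  "connection_coeff \<sigma> \<mu> = of_real \<sigma> * \<i> * exp (- (of_real (\<sigma> * pi) * \<i> * \<mu>))"

definition legendre_expansion :: "real \<Rightarrow> nat \<Rightarrow> complex \<Rightarrow> complex \<Rightarrow> complex \<Rightarrow> complex" where
  "legendre_expansion \<sigma> N \<mu> \<nu> \<xi> = exp ((\<nu> + 1/2) * \<xi>) * legendre_sum N (legendre_arg (- \<xi>)) \<mu> \<nu> +
    connection_coeff \<sigma> \<mu> * exp (- ((\<nu> + 1/2) * \<xi>)) * legendre_sum N (legendre_arg \<xi>) \<mu> \<nu>"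

context
  fixes \<sigma> b :: real and \<nu> \<xi> :: complex
  assumes \<sigma>: "\<bar>\<sigma>\<bar> = 1" and b: "0 < b" "b < pi" and \<nu>: "Re \<nu> > - 1/2"
  defines "\<xi> \<equiv> \<i> * of_real (\<sigma> * b)"
begin

lemma sinh_imaginary_side: "sinh \<xi> = \<i> * of_real (\<sigma> * sin b)" "- sinh \<xi> = \<i> * of_real (- \<sigma> * sin b)"
  and cosh_imaginary_side: "cosh \<xi> = of_real (cos b)"
  using \<sigma> unfolding \<xi>_def sinh_i_times_of_real cosh_i_times_of_real
  by (auto simp: abs_if split: if_splits)

lemma imaginary_side_in_slit_strip: "\<xi> \<in> slit_strip" "Im \<xi> \<noteq> 0"
  using \<sigma> b by (auto simp: \<xi>_def slit_strip_def abs_mult)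

lemma exp_half_pi_side: "exp (\<i> * of_real (\<sigma> * pi / 2)) = \<i> * of_real \<sigma>"
  using \<sigma> unfolding cis_conv_exp[symmetric]
  by (auto simp: abs_if cis_minus_pi_half split: if_splits)

lemma sinh_powr: "sinh \<xi> powr of_real a =
  of_real (sin b powr a) * exp (\<i> * of_real (\<sigma> * pi / 2) * of_real a)"
  and minus_sinh_powr: "(- sinh \<xi>) powr of_real a =
    of_real (sin b powr a) * exp (\<i> * of_real (- \<sigma> * pi / 2) * of_real a)"
proof -
  have s: "sin b > 0" and minus_\<sigma>: "\<bar>- \<sigma>\<bar> = 1"
    using b \<sigma> by (simp_all add: sin_gt_zero)
  have "complex_of_real (sin b) powr of_real a = of_real (sin b powr a)"
    using s by (simp add: powr_of_real)
  then show "sinh \<xi> powr of_real a =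
      of_real (sin b powr a) * exp (\<i> * of_real (\<sigma> * pi / 2) * of_real a)"
    "(- sinh \<xi>) powr of_real a =
      of_real (sin b powr a) * exp (\<i> * of_real (- \<sigma> * pi / 2) * of_real a)"
    using imaginary_powr[OF \<sigma> s, of "of_real a"] imaginary_powr[OF minus_\<sigma> s, of "of_real a"]
    by (simp_all only: sinh_imaginary_side(1)[symmetric] sinh_imaginary_side(2)[symmetric])
qed

lemma sinh_powr_minus_sinh_powr:
  "sinh \<xi> powr of_real (- m - 1/2) * (- sinh \<xi>) powr of_real (m + 1/2) =
    - connection_coeff \<sigma> (of_real m)"
proof -
  have "sin b powr (- m - 1/2) * sin b powr (m + 1/2) = 1"
    using b sin_gt_zero[of b] by (simp flip: powr_add)
  then have "sinh \<xi> powr of_real (- m - 1/2) * (- sinh \<xi>) powr of_real (m + 1/2) =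
      exp (\<i> * of_real (\<sigma> * pi / 2) * of_real (- m - 1/2)) *
      exp (\<i> * of_real (- \<sigma> * pi / 2) * of_real (m + 1/2))"
    unfolding sinh_powr minus_sinh_powr by (simp add: mult_ac flip: of_real_mult)
  also have "\<dots> = exp (- (of_real (\<sigma> * pi) * \<i> * of_real m)) / exp (\<i> * of_real (\<sigma> * pi / 2))"
    unfolding exp_add[symmetric] exp_diff[symmetric]
    by (rule arg_cong[where f = exp]) (simp add: field_simps)
  finally show ?thesis
    unfolding exp_half_pi_side connection_coeff_def using \<sigma> by (auto simp: abs_if split: if_splits)
qed

lemma csqrt_sinh_imaginary:
  "csqrt (2 * of_real pi * sinh \<xi>) =
    of_real (sqrt (2 * pi * sin b)) * exp (\<i> * of_real (\<sigma> * pi / 2) * (1/2))"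
proof -
  have s: "2 * pi * sin b > 0"
    using b by (simp add: sin_gt_zero)
  have "2 * of_real pi * sinh \<xi> = \<i> * complex_of_real (\<sigma> * (2 * pi * sin b))"
    unfolding sinh_imaginary_side by simp
  moreover have "complex_of_real (2 * pi * sin b) powr (1/2) = of_real (sqrt (2 * pi * sin b))"
    using powr_of_real[of "2 * pi * sin b" "1/2"] s by (simp add: powr_half_sqrt)
  ultimately show ?thesis
    unfolding csqrt_conv_powr by (simp only: imaginary_powr[OF \<sigma> s])
qed

lemma coth_half_powr_imaginary:
  "coth_half \<xi> powr of_real m =
    of_real ((sin b / (1 - cos b)) powr m) * exp (\<i> * of_real (- \<sigma> * pi / 2) * of_real m)"
proof -
  have pos: "sin b / (1 - cos b) > 0"
    using b one_minus_cos_pos[OF b] by (simp add: sin_gt_zero)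
  have "coth_half \<xi> = \<i> * of_real (\<sigma> * sin b) / of_real (cos b - 1)"
    unfolding coth_half_eq[OF sinh_nonzero_slit_strip(2)[OF imaginary_side_in_slit_strip(1)]]
      cosh_imaginary_side sinh_imaginary_side(1) by simp
  also have "\<dots> = \<i> * of_real (- \<sigma> * (sin b / (1 - cos b)))"
  proof -
    have "\<sigma> * sin b / (cos b - 1) = - \<sigma> * (sin b / (1 - cos b))"
      using minus_divide_right[of "\<sigma> * sin b" "1 - cos b"] by simp
    then show ?thesis
      by (simp only: times_divide_eq_right[symmetric] of_real_divide[symmetric])
  qed
  finally show ?thesis
    using imaginary_powr[of "- \<sigma>" "sin b / (1 - cos b)" "of_real m"] pos
      powr_of_real[of "sin b / (1 - cos b)" m] \<sigma>
    by simp
qed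

lemma hyp2F1_reg_imaginary:
  assumes m: "m < 1/2"
  shows "hyp2F1_reg (\<nu> + 1) (- \<nu>) (1 - of_real m) ((1 - cosh \<xi>) / 2) =
    of_real (sqrt 2 * (1 - cos b) powr m) *
    mehler_angle_integral b m \<nu> / of_real (sqrt pi * Gamma (1/2 - m))"
proof -
  let ?w = "complex_of_real ((1 - cos b) / 2)"
  have \<nu>1: "2 * \<nu> + 1 \<noteq> 0"
    using \<nu> by (rule double_plus_1_nonzero)
  have w: "norm ?w < 1"
    by (rule norm_half_one_minus_cos_less_1[OF b])
  have "of_real (sqrt 2 * (1 - cos b) powr m) * mehler_angle_integral b m \<nu> =
      of_real (sqrt pi) * Gamma (1/2 - of_real m) * hyp2F1_reg (\<nu> + 1) (- \<nu>) (1 - of_real m) ?w"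
    using mehler_integral_eq_angle_integral[OF \<nu>1 m b]
      mehler_integral_eq_series[OF _ w, of "of_real m" \<nu>] m
      hyp2F1_reg_eq_series[OF \<nu>1 w] by simp
  moreover have "Gamma (1/2 - complex_of_real m) = of_real (Gamma (1/2 - m))" "Gamma (1/2 - m) > 0"
    using m Gamma_complex_of_real[of "1/2 - m"] by (simp_all add: Gamma_real_pos)
  moreover have "(1 - cosh \<xi>) / 2 = ?w"
    by (simp add: cosh_imaginary_side)
  ultimately show ?thesis
    by (simp add: nonzero_eq_divide_eq mult_ac)
qed

lemma legendre_scaled_imaginary:
  assumes m: "m < 1/2"
  shows "legendre_scaled \<nu> (of_real m) \<xi> = Gamma (\<nu> + 1 - of_real m) / of_real (Gamma (1/2 - m)) *
    (2 * \<i> * of_real \<sigma> * mehler_angle_integral b m \<nu>) * (- sinh \<xi>) powr of_real (m + 1/2)"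
proof -
  let ?s = "sin b" and ?D = "1 - cos b"
  have pos: "?s > 0" "?D > 0"
    using b one_minus_cos_pos[OF b] by (simp_all add: sin_gt_zero)
  have moduli: "sqrt (2 * pi * ?s) * (?s / ?D) powr m * (sqrt 2 * ?D powr m / sqrt pi) =
      2 * ?s powr (m + 1/2)"
    using pos by (simp add: powr_divide powr_add powr_half_sqrt real_sqrt_mult)
  have phases: "exp (\<i> * of_real (\<sigma> * pi / 2) * (1/2)) *
      exp (\<i> * of_real (- \<sigma> * pi / 2) * of_real m) =
      \<i> * of_real \<sigma> * exp (\<i> * of_real (- \<sigma> * pi / 2) * of_real (m + 1/2))"
    unfolding exp_half_pi_side[symmetric] exp_add[symmetric]
    by (rule arg_cong[where f = exp]) (simp add: field_simps)
  have "legendre_scaled \<nu> (of_real m) \<xi> = Gamma (\<nu> + 1 - of_real m) *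
      (csqrt (2 * of_real pi * sinh \<xi>) * coth_half \<xi> powr of_real m *
        hyp2F1_reg (\<nu> + 1) (- \<nu>) (1 - of_real m) ((1 - cosh \<xi>) / 2))"
    unfolding legendre_scaled_def by (simp add: diff_add_eq mult.assoc)
  also have "csqrt (2 * of_real pi * sinh \<xi>) * coth_half \<xi> powr of_real m *
      hyp2F1_reg (\<nu> + 1) (- \<nu>) (1 - of_real m) ((1 - cosh \<xi>) / 2) =
      of_real (sqrt (2 * pi * ?s) * (?s / ?D) powr m * (sqrt 2 * ?D powr m / sqrt pi)) *
      (exp (\<i> * of_real (\<sigma> * pi / 2) * (1/2)) * exp (\<i> * of_real (- \<sigma> * pi / 2) * of_real m)) *
      mehler_angle_integral b m \<nu> / of_real (Gamma (1/2 - m))"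
    unfolding csqrt_sinh_imaginary coth_half_powr_imaginary hyp2F1_reg_imaginary[OF m] by simp
  finally show ?thesis
    unfolding minus_sinh_powr moduli phases by (simp add: mult_ac)
qed

lemma legendre_rem_0_connection:
  assumes m: "- 1/2 < m" "m < 0"
  shows "legendre_scaled \<nu> (of_real m) \<xi> =
    exp ((\<nu> + 1/2) * \<xi>) * legendre_rem 0 (legendre_arg (- \<xi>)) (of_real m) \<nu> +
    connection_coeff \<sigma> (of_real m) * exp (- ((\<nu> + 1/2) * \<xi>)) *
    legendre_rem 0 (legendre_arg \<xi>) (of_real m) \<nu>"
proof -
  define K where "K = Gamma (\<nu> + 1 - of_real m) / of_real (Gamma (1/2 - m))"
  define P where "P = (- sinh \<xi>) powr of_real (m + 1/2)"
  have m': "\<bar>m\<bar> < 1/2" "m < 1/2"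
    using m by auto
  have rem_eq: "legendre_rem 0 x (of_real m) \<nu> = K * euler_integral m \<nu> x" if "x \<notin> \<real>\<^sub>\<le>\<^sub>0" for x
    unfolding K_def using legendre_rem_0_euler[OF m'(1) \<nu> that] .
  note rem_euler = rem_eq[OF legendre_arg_notin_nonpos_Reals[OF imaginary_side_in_slit_strip(1)]]
    rem_eq[OF legendre_arg_minus_notin_nonpos_Reals[OF imaginary_side_in_slit_strip]]
  have "(- sinh \<xi>) powr of_real (- m - 1/2) * P = (- sinh \<xi>) powr 0"
    unfolding P_def powr_add[symmetric] by simp
  also have "\<dots> = 1"
    using sinh_nonzero_slit_strip(1)[OF imaginary_side_in_slit_strip(1)] by simp
  finally have cancel: "(- sinh \<xi>) powr of_real (- m - 1/2) * P = 1" .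
  have "legendre_scaled \<nu> (of_real m) \<xi> = K * (2 * \<i> * of_real \<sigma> * mehler_angle_integral b m \<nu>) * P"
    unfolding K_def P_def by (rule legendre_scaled_imaginary[OF m'(2)])
  also have "\<dots> = K * (exp ((\<nu> + 1/2) * \<xi>) * ((- sinh \<xi>) powr of_real (- m - 1/2) * P) *
        euler_integral m \<nu> (legendre_arg (- \<xi>)) -
      exp (- ((\<nu> + 1/2) * \<xi>)) * (sinh \<xi> powr of_real (- m - 1/2) * P) *
      euler_integral m \<nu> (legendre_arg \<xi>))"
    unfolding mehler_connection[OF b m \<nu> \<sigma>, folded \<xi>_def, symmetric]
    by (simp only: right_diff_distrib left_diff_distrib mult_ac)
  also have "\<dots> = exp ((\<nu> + 1/2) * \<xi>) * (K * euler_integral m \<nu> (legendre_arg (- \<xi>))) +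
      connection_coeff \<sigma> (of_real m) * exp (- ((\<nu> + 1/2) * \<xi>)) *
      (K * euler_integral m \<nu> (legendre_arg \<xi>))"
    unfolding cancel sinh_powr_minus_sinh_powr[of m, folded P_def] by (simp add: algebra_simps)
  finally show ?thesis
    unfolding rem_euler .
qed

lemma legendre_scaled_eq_expansion_imaginary:
  assumes \<mu>: "\<bar>Re \<mu>\<bar> < real N + 1/2" and \<nu>N: "Re \<nu> > real N - 1/2"
  shows "legendre_scaled \<nu> \<mu> \<xi> = legendre_expansion \<sigma> N \<mu> \<nu> \<xi>"
proof (rule analytic_continuation_Ioo
    [where f = "\<lambda>\<mu>. legendre_scaled \<nu> \<mu> \<xi>" and a = "- 1/2" and b = 0
      and S = "{\<mu>. Re \<mu> < real N + 1/2} \<inter> {\<mu>. Re \<mu> > - (real N + 1/2)}"])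
  let ?U = "{\<mu>. Re \<mu> < real N + 1/2} \<inter> {\<mu>. Re \<mu> > - (real N + 1/2)}"
  let ?w = "(1 - cosh \<xi>) / 2"
  note args = legendre_arg_notin_nonpos_Reals[OF imaginary_side_in_slit_strip(1)]
    legendre_arg_minus_notin_nonpos_Reals[OF imaginary_side_in_slit_strip]
  have \<nu>1: "2 * \<nu> + 1 \<noteq> 0"
    using \<nu> by (rule double_plus_1_nonzero)
  show "open ?U"
    by (intro open_Int open_halfspace_Re_lt open_halfspace_Re_gt)
  show "connected ?U"
    by (intro convex_connected convex_Int convex_halfspace_Re_lt convex_halfspace_Re_gt)
  have "?w = complex_of_real ((1 - cos b) / 2)"
    by (simp add: cosh_imaginary_side)
  then have w: "norm ?w < 1"
    using norm_half_one_minus_cos_less_1[OF b] by (simp only:)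
  have "(\<lambda>\<mu>. hyp2F1_reg (\<nu> + 1) (- \<nu>) (1 - \<mu>) ?w) holomorphic_on ?U"
    unfolding hyp2F1_reg_eq_series[OF \<nu>1 w]
    by (rule holomorphic_on_compose_gen[OF _ hyp2F1_reg_series_holomorphic_parameter[OF w],
      unfolded o_def])
      (auto intro!: holomorphic_intros)
  then show "(\<lambda>\<mu>. legendre_scaled \<nu> \<mu> \<xi>) holomorphic_on ?U"
    unfolding legendre_scaled_def
    by (intro holomorphic_intros Gamma_arg_notin_nonpos_Ints) (use \<nu>N in auto)
  show "(\<lambda>\<mu>. legendre_expansion \<sigma> N \<mu> \<nu> \<xi>) holomorphic_on ?U"
    unfolding legendre_expansion_def connection_coeff_def
    by (intro holomorphic_intros legendre_sum_holomorphic[OF \<nu>N \<open>open ?U\<close>]) (use args in auto)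
  fix m :: real assume m: "- 1/2 < m" "m < 0"
  have "legendre_sum N x (of_real m) \<nu> = legendre_rem 0 x (of_real m) \<nu>" if "x \<notin> \<real>\<^sub>\<le>\<^sub>0" for x
    using legendre_sum_independent[OF that, of "of_real m" N \<nu> 0] m \<nu> \<nu>N
    by (simp add: legendre_sum_def[of 0])
  then show "legendre_scaled \<nu> (of_real m) \<xi> = legendre_expansion \<sigma> N (of_real m) \<nu> \<xi>"
    using legendre_rem_0_connection[OF m] args by (simp add: legendre_expansion_def)
qed (use \<mu> in auto)

end

lemma legendre_scaled_eq_expansion:
  assumes \<mu>: "\<bar>Re \<mu>\<bar> < real N + 1/2" and \<nu>: "Re \<nu> > real N - 1/2"
    and \<sigma>: "\<bar>\<sigma>\<bar> = 1" and \<xi>: "0 < \<sigma> * Im \<xi>" "\<sigma> * Im \<xi> < pi"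
  shows "legendre_scaled \<nu> \<mu> \<xi> = legendre_expansion \<sigma> N \<mu> \<nu> \<xi>"
proof -
  let ?V = "{\<xi>. 0 < \<sigma> * Im \<xi> \<and> \<sigma> * Im \<xi> < pi}"
  let ?T = "{t. 0 < Re t} \<inter> {t. Re t < pi}"
  let ?k = "\<lambda>t. \<i> * complex_of_real \<sigma> * t"
  let ?R = "legendre_expansion \<sigma> N \<mu> \<nu>"
  have \<sigma>_cases: "\<sigma> = 1 \<or> \<sigma> = - 1"
    using \<sigma> by auto
  have \<nu>0: "Re \<nu> > - 1/2"
    using \<nu> by simp
  note \<nu>1 = double_plus_1_nonzero[OF \<nu>0]
  have k: "?k t \<in> slit_strip" "Im (?k t) \<noteq> 0" if "t \<in> ?T" for t
    using that \<sigma>_cases by (auto simp: slit_strip_def)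
  have T: "open ?T" "connected ?T"
    by (intro open_Int open_halfspace_Re_gt open_halfspace_Re_lt convex_connected convex_Int
        convex_halfspace_Re_gt convex_halfspace_Re_lt)+
  have "legendre_scaled \<nu> \<mu> (?k t) = ?R (?k t)" if "t \<in> ?T" for t
  proof (rule analytic_continuation_Ioo[OF _ _ T,
        where f = "\<lambda>t. legendre_scaled \<nu> \<mu> (?k t)" and g = "\<lambda>t. ?R (?k t)" and a = 0 and b = pi])
    have compose: "(\<lambda>t. f (?k t)) holomorphic_on ?T" if "f holomorphic_on slit_strip" for f
      by (rule holomorphic_on_compose_gen[OF _ that, unfolded o_def])
        (use k in \<open>auto intro!: holomorphic_intros\<close>)
    show "(\<lambda>t. legendre_scaled \<nu> \<mu> (?k t)) holomorphic_on ?T"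
      by (rule compose[OF legendre_scaled_holomorphic[OF \<nu>1]])
    show "(\<lambda>t. ?R (?k t)) holomorphic_on ?T"
      unfolding legendre_expansion_def
      by (intro holomorphic_intros legendre_sum_holomorphic[OF \<nu> T(1)]
        compose[OF legendre_arg_holomorphic]
          compose[OF legendre_arg_minus_holomorphic])
        (use k \<mu> legendre_arg_notin_nonpos_Reals legendre_arg_minus_notin_nonpos_Reals in auto)
    show "legendre_scaled \<nu> \<mu> (?k (of_real b)) = ?R (?k (of_real b))" if "0 < b" "b < pi" for b
      using legendre_scaled_eq_expansion_imaginary[OF \<sigma> that \<nu>0 \<mu> \<nu>] by (simp add: mult.assoc)
  qed (use that in auto)
  from this[of "- \<i> * of_real \<sigma> * \<xi>"] show ?thesis
    using \<sigma>_cases \<xi> by auto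
qed

section \<open>Remainders and their bounds\<close>

lemma legendre_sum_P1: "legendre_sum N (legendre_arg (- \<xi>)) \<mu> \<nu> =
    (\<Sum>n<N. P1_term n \<xi> \<mu> \<nu>) + legendre_rem N (legendre_arg (- \<xi>)) \<mu> \<nu>"
  and legendre_sum_P2: "legendre_sum M (legendre_arg \<xi>) \<mu> \<nu> =
    (\<Sum>m<M. P2_term m \<xi> \<mu> \<nu>) + legendre_rem M (legendre_arg \<xi>) \<mu> \<nu>"
  by (simp_all add: legendre_sum_def P1_term_def P2_term_def legendre_arg_def)

definition legendre_P_remainder :: "complex \<Rightarrow> nat \<Rightarrow> complex \<Rightarrow> complex \<Rightarrow> complex \<Rightarrow> complex" where
  "legendre_P_remainder c N \<xi> \<mu> \<nu> = exp (- ((\<nu> + 1/2) * \<xi>)) *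
    (legendre_scaled \<nu> \<mu> \<xi> - c * exp (- ((\<nu> + 1/2) * \<xi>)) * legendre_sum N (legendre_arg \<xi>) \<mu> \<nu>) -
    (\<Sum>n<N. P1_term n \<xi> \<mu> \<nu>)"

lemma legendre_P_remainder_average:
  "legendre_P_remainder ((c + d) / 2) N \<xi> \<mu> \<nu> =
    (legendre_P_remainder c N \<xi> \<mu> \<nu> + legendre_P_remainder d N \<xi> \<mu> \<nu>) / 2"
  by (simp add: legendre_P_remainder_def field_simps)

definition legendre_R1 :: "nat \<Rightarrow> complex \<Rightarrow> complex \<Rightarrow> complex \<Rightarrow> complex" where
  "legendre_R1 N \<xi> \<mu> \<nu> = legendre_P_remainder (C_coeff \<xi> \<mu>) N \<xi> \<mu> \<nu>"

definition legendre_R2 :: "nat \<Rightarrow> complex \<Rightarrow> complex \<Rightarrow> complex \<Rightarrow> complex" where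
  "legendre_R2 M \<xi> \<mu> \<nu> = legendre_rem M (legendre_arg \<xi>) \<mu> \<nu>"

lemma C_coeff_off_axis: "Im \<xi> \<noteq> 0 \<Longrightarrow> C_coeff \<xi> \<mu> = connection_coeff (sgn (Im \<xi>)) \<mu>"
  by (simp add: C_coeff_def connection_coeff_def sgn_if)

lemma C_coeff_on_axis:
  assumes "Im \<xi> = 0"
  shows "C_coeff \<xi> \<mu> = (connection_coeff 1 \<mu> + connection_coeff (- 1) \<mu>) / 2"
  using assms by (simp add: C_coeff_def connection_coeff_def sin_exp_eq field_simps)

lemma exp_mult_exp_minus_cancel: "exp a * (exp (- a) * z) = z"
  "exp (- a) * (exp a * z) = z" for a z :: complex
  by (simp_all add: mult.assoc[symmetric] exp_add[symmetric])

lemma legendre_P_denominator_nonzero: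
  assumes "\<xi> \<in> D1" "Re (\<nu> - \<mu> + 1) > 0"
  shows "Gamma (\<nu> - \<mu> + 1) * csqrt (2 * of_real pi * sinh \<xi>) \<noteq> 0"
proof -
  have "Gamma (\<nu> - \<mu> + 1) \<noteq> 0"
    using Gamma_arg_notin_nonpos_Ints[OF assms(2)] by (simp add: Gamma_eq_zero_iff)
  moreover have "sinh \<xi> \<noteq> 0"
    using assms(1) D1_subset_slit_strip sinh_nonzero_slit_strip(1) by blast
  ultimately show ?thesis by simp
qed

lemma legendre_P_expansion:
  assumes \<xi>: "\<xi> \<in> D1"
    and N: "\<bar>Re \<mu>\<bar> < real N + 1/2" "Re \<nu> > real N - 1/2"
    and M: "\<bar>Re \<mu>\<bar> < real M + 1/2" "Re \<nu> > real M - 1/2"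
  defines "L \<equiv> Gamma (\<nu> - \<mu> + 1) * csqrt (2 * of_real pi * sinh \<xi>)"
  shows "legendre_P \<nu> \<mu> (cosh \<xi>) =
    exp ((\<nu> + 1/2) * \<xi>) / L * ((\<Sum>n<N. P1_term n \<xi> \<mu> \<nu>) + legendre_R1 N \<xi> \<mu> \<nu>) +
    C_coeff \<xi> \<mu> * exp (- (\<nu> + 1/2) * \<xi>) / L * ((\<Sum>m<M. P2_term m \<xi> \<mu> \<nu>) + legendre_R2 M \<xi> \<mu> \<nu>)"
proof -
  have "legendre_arg \<xi> \<notin> \<real>\<^sub>\<le>\<^sub>0"
    using \<xi> D1_subset_slit_strip legendre_arg_notin_nonpos_Reals by blast
  then have "legendre_sum N (legendre_arg \<xi>) \<mu> \<nu> = (\<Sum>m<M. P2_term m \<xi> \<mu> \<nu>) + legendre_R2 M \<xi> \<mu> \<nu>"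
    unfolding legendre_R2_def legendre_sum_P2[symmetric] using N M
    by (rule legendre_sum_independent)
  then have "L * legendre_P \<nu> \<mu> (cosh \<xi>) =
      exp ((\<nu> + 1/2) * \<xi>) * ((\<Sum>n<N. P1_term n \<xi> \<mu> \<nu>) + legendre_R1 N \<xi> \<mu> \<nu>) +
      C_coeff \<xi> \<mu> * exp (- (\<nu> + 1/2) * \<xi>) * ((\<Sum>m<M. P2_term m \<xi> \<mu> \<nu>) + legendre_R2 M \<xi> \<mu> \<nu>)"
    unfolding L_def legendre_scaled_D1[OF \<xi>, symmetric] legendre_R1_def legendre_P_remainder_def
      mult_minus_left
    by (simp add: exp_mult_exp_minus_cancel)
  moreover have "L \<noteq> 0"
    unfolding L_def using N by (intro legendre_P_denominator_nonzero \<xi>) auto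
  moreover have "p = a / L * A + b / L * B" if "L * p = a * A + b * B" "L \<noteq> 0" for p a b A B
  proof -
    have "p = (a * A + b * B) / L"
      using that by (simp add: nonzero_eq_divide_eq mult.commute)
    then show ?thesis
      by (simp add: add_divide_distrib)
  qed
  ultimately show ?thesis by blast
qed

lemma norm_over_Im_inverse: "norm (inverse z) / \<bar>Im (inverse z)\<bar> = norm z / \<bar>Im z\<bar>"
proof (cases "z = 0")
  case False
  have "\<bar>Im (inverse z)\<bar> = \<bar>Im z\<bar> / (norm z * norm z)"
    by (simp add: abs_divide cmod_power2 flip: power2_eq_square)
  then show ?thesis
    unfolding norm_inverse using False by (simp add: divide_inverse)
qed simp

lemma norm_over_Im_legendre_arg_minus:
  "norm (legendre_arg (- \<xi>)) / \<bar>Im (legendre_arg (- \<xi>))\<bar> =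
    norm (1 - exp (- 2 * \<xi>)) * \<bar>1 / sin (2 * Im \<xi>)\<bar>"
proof -
  have "1 - exp (2 * \<xi>) = - (exp (2 * \<xi>) * (1 - exp (- 2 * \<xi>)))"
    by (simp add: algebra_simps exp_minus)
  then have "norm (1 - exp (2 * \<xi>)) = exp (2 * Re \<xi>) * norm (1 - exp (- 2 * \<xi>))"
    by (simp add: norm_mult)
  moreover have "norm (legendre_arg (- \<xi>)) / \<bar>Im (legendre_arg (- \<xi>))\<bar> =
      norm (1 - exp (2 * \<xi>)) / \<bar>Im (exp (2 * \<xi>))\<bar>"
    using norm_over_Im_inverse[of "legendre_arg (- \<xi>)"]
    by (simp add: inverse_legendre_arg norm_divide)
  ultimately show ?thesis
    by (simp add: Im_exp abs_mult)
qed

context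
  fixes N :: nat and \<mu> \<nu> :: complex
  assumes \<mu>: "\<bar>Re \<mu>\<bar> < real N + 1/2" and \<nu>: "Re \<nu> > real N - 1/2"
begin

lemma legendre_P_remainder_eq_rem:
  assumes "\<bar>\<sigma>\<bar> = 1" "0 < \<sigma> * Im \<xi>" "\<sigma> * Im \<xi> < pi"
  shows "legendre_P_remainder (connection_coeff \<sigma> \<mu>) N \<xi> \<mu> \<nu> =
    legendre_rem N (legendre_arg (- \<xi>)) \<mu> \<nu>"
  unfolding legendre_P_remainder_def legendre_scaled_eq_expansion[OF \<mu> \<nu> assms]
    legendre_expansion_def
  by (simp add: legendre_sum_P1 exp_mult_exp_minus_cancel)

lemma norm_legendre_P_remainder_le_chi:
  assumes \<xi>: "\<xi> \<in> D1" "Im \<xi> = 0" and \<sigma>: "\<bar>\<sigma>\<bar> = 1"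
  shows "norm (legendre_P_remainder (connection_coeff \<sigma> \<mu>) N \<xi> \<mu> \<nu>) \<le>
    legendre_rem_bound N (legendre_arg (- \<xi>)) \<mu> \<nu> * (1 + chi (real N + 1/2))"
proof (rule tendsto_le[OF trivial_limit_at_right_real])
  define s where "s t = \<xi> + \<i> * of_real (\<sigma> * t)" for t
  have "(s \<longlongrightarrow> \<xi> + \<i> * of_real (\<sigma> * 0)) (at_right 0)"
    unfolding s_def by (intro tendsto_intros)
  then have s: "(s \<longlongrightarrow> \<xi>) (at_right 0)"
    by simp
  have cont: "((\<lambda>t. f (s t)) \<longlongrightarrow> f \<xi>) (at_right 0)" if "f holomorphic_on slit_strip" for f
    using that \<xi>(1) D1_subset_slit_strip open_slit_strip s
    by (metis continuous_on_eq_continuous_at holomorphic_on_imp_continuous_on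
      isCont_tendsto_compose subsetD)
  have \<nu>1: "2 * \<nu> + 1 \<noteq> 0"
    by (rule double_plus_1_nonzero) (use \<nu> in simp)
  have "(\<lambda>\<xi>. legendre_P_remainder (connection_coeff \<sigma> \<mu>) N \<xi> \<mu> \<nu>) holomorphic_on slit_strip"
    unfolding legendre_P_remainder_def P1_term_def
    by (intro holomorphic_intros legendre_scaled_holomorphic \<nu>1
      legendre_sum_holomorphic[OF \<nu> open_slit_strip]
        legendre_arg_holomorphic)
      (use \<mu> sinh_nonzero_slit_strip legendre_arg_notin_nonpos_Reals in auto)
  then show "((\<lambda>t. norm (legendre_P_remainder (connection_coeff \<sigma> \<mu>) N (s t) \<mu> \<nu>)) \<longlongrightarrow>
      norm (legendre_P_remainder (connection_coeff \<sigma> \<mu>) N \<xi> \<mu> \<nu>)) (at_right 0)"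
    by (intro tendsto_norm cont)
  show "((\<lambda>t. legendre_rem_bound N (legendre_arg (- s t)) \<mu> \<nu> * (1 + chi (real N + 1/2))) \<longlongrightarrow>
      legendre_rem_bound N (legendre_arg (- \<xi>)) \<mu> \<nu> * (1 + chi (real N + 1/2))) (at_right 0)"
    unfolding legendre_rem_bound_def
    by (intro tendsto_intros cont[OF legendre_arg_minus_holomorphic])
  have "norm (legendre_P_remainder (connection_coeff \<sigma> \<mu>) N (s t) \<mu> \<nu>) \<le>
      legendre_rem_bound N (legendre_arg (- s t)) \<mu> \<nu> * (1 + chi (real N + 1/2))"
    if t: "0 < t" "t < pi" for t
  proof -
    have Im_s: "\<sigma> * Im (s t) = t" "Im (s t) \<noteq> 0" "\<bar>Im (s t)\<bar> < pi"
      using \<xi>(2) \<sigma> t by (auto simp: s_def abs_mult abs_if split: if_splits)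
    then have "legendre_arg (- s t) \<notin> \<real>\<^sub>\<le>\<^sub>0"
      by (intro legendre_arg_minus_notin_nonpos_Reals) (auto simp: slit_strip_def)
    then show ?thesis
      using legendre_P_remainder_eq_rem[OF \<sigma>, of "s t"] norm_legendre_rem_le_chi[OF \<mu> \<nu>] Im_s t
      by simp
  qed
  then show "\<forall>\<^sub>F t in at_right 0. norm (legendre_P_remainder (connection_coeff \<sigma> \<mu>) N (s t) \<mu> \<nu>) \<le>
      legendre_rem_bound N (legendre_arg (- s t)) \<mu> \<nu> * (1 + chi (real N + 1/2))"
    using pi_gt_zero unfolding eventually_at_right_field by blast
qed

lemma norm_legendre_rem_le_P1_factor:
  assumes \<xi>: "\<xi> \<in> slit_strip" "Im \<xi> \<noteq> 0"
  shows "norm (legendre_rem N (legendre_arg (- \<xi>)) \<mu> \<nu>) \<le>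
    legendre_rem_bound N (legendre_arg (- \<xi>)) \<mu> \<nu> * P1_factor N \<xi>"
proof -
  let ?x = "legendre_arg (- \<xi>)"
  have inverse: "inverse ?x = (1 - exp (2 * \<xi>)) / 2"
    using inverse_legendre_arg[of "- \<xi>"] by simp
  have chi: "norm (legendre_rem N ?x \<mu> \<nu>) \<le> legendre_rem_bound N ?x \<mu> \<nu> * (1 + chi (real N + 1/2))"
    by (intro norm_legendre_rem_le_chi[OF \<mu> \<nu>] legendre_arg_minus_notin_nonpos_Reals \<xi>)
  consider "Re (exp (2 * \<xi>)) \<le> 1" | "Re (exp (2 * \<xi>)) > 1" "sin (2 * Im \<xi>) = 0"
    | "Re (exp (2 * \<xi>)) > 1" "sin (2 * Im \<xi>) \<noteq> 0"
    by linarith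
  then show ?thesis
  proof cases
    case 1
    then have "Re (inverse ?x) \<ge> 0"
      unfolding inverse by simp
    then have "Re ?x \<ge> 0"
      by (auto simp: zero_le_divide_iff sum_power2_le_zero_iff)
    then show ?thesis
      using norm_legendre_rem_le_Re[OF \<mu> \<nu>] 1 by (simp add: P1_factor_def)
  next
    case 2
    then show ?thesis
      using chi by (simp add: P1_factor_def)
  next
    case 3
    then have "Im (inverse ?x) \<noteq> 0"
      unfolding inverse by (simp add: Im_exp)
    then have "Im ?x \<noteq> 0"
      by auto
    from norm_legendre_rem_le_Im[OF \<mu> \<nu> this] chi 3 show ?thesis
      unfolding norm_over_Im_legendre_arg_minus by (simp add: P1_factor_def min_def)
  qed
qed

text \<open>
  On the positive axis the argument of the remainder lies on the cut of \<open>legendre_rem\<close>, and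
  \<open>C_coeff\<close>, a sine, is the mean of the connection coefficients of the two sides. So the remainder
  is the mean of the two boundary values.
\<close>

lemma norm_legendre_R1_le:
  assumes \<xi>: "\<xi> \<in> D1"
  shows "norm (legendre_R1 N \<xi> \<mu> \<nu>) \<le> legendre_rem_bound N (legendre_arg (- \<xi>)) \<mu> \<nu> * P1_factor N \<xi>"
proof (cases "Im \<xi> = 0")
  case True
  let ?R = "\<lambda>\<sigma>. legendre_P_remainder (connection_coeff \<sigma> \<mu>) N \<xi> \<mu> \<nu>"
  have "norm (legendre_R1 N \<xi> \<mu> \<nu>) = norm (?R 1 + ?R (- 1)) / 2"
    unfolding legendre_R1_def C_coeff_on_axis[OF True] legendre_P_remainder_average by simp
  also have "\<dots> \<le> legendre_rem_bound N (legendre_arg (- \<xi>)) \<mu> \<nu> * (1 + chi (real N + 1/2))"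
    using norm_triangle_ineq[of "?R 1" "?R (- 1)"]
      norm_legendre_P_remainder_le_chi[OF \<xi> True, of 1]
        norm_legendre_P_remainder_le_chi[OF \<xi> True, of "- 1"]
    by simp
  also have "1 + chi (real N + 1/2) = P1_factor N \<xi>"
    using True \<xi> by (simp add: P1_factor_def Re_exp D1_def)
  finally show ?thesis .
next
  case False
  then have "legendre_R1 N \<xi> \<mu> \<nu> = legendre_rem N (legendre_arg (- \<xi>)) \<mu> \<nu>"
    unfolding legendre_R1_def C_coeff_off_axis[OF False] using \<xi>
    by (intro legendre_P_remainder_eq_rem) (auto simp: D1_def sgn_if)
  then show ?thesis
    using norm_legendre_rem_le_P1_factor[OF _ False] \<xi> D1_subset_slit_strip by auto
qed

lemma norm_legendre_R2_le:
  assumes \<xi>: "\<xi> \<in> D1"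
  shows "norm (legendre_R2 N \<xi> \<mu> \<nu>) \<le> legendre_rem_bound N (legendre_arg \<xi>) \<mu> \<nu>"
  unfolding legendre_R2_def
proof (rule norm_legendre_rem_le_Re[OF \<mu> \<nu>])
  have "Re (exp (- 2 * \<xi>)) \<le> norm (exp (- 2 * \<xi>))"
    by (rule complex_Re_le_cmod)
  also have "\<dots> < 1"
    using \<xi> by (simp add: D1_def)
  finally have "Re (inverse (legendre_arg \<xi>)) > 0"
    unfolding inverse_legendre_arg by simp
  then show "Re (legendre_arg \<xi>) \<ge> 0"
    by (auto simp: zero_less_divide_iff not_sum_power2_lt_zero)
qed

end

definition pos_Reals :: "complex set" where
  "pos_Reals = complex_of_real ` {0<..}"

lemma of_real_in_pos_Reals_iff: "complex_of_real r \<in> pos_Reals \<longleftrightarrow> r > 0"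
  by (auto simp: pos_Reals_def)

lemma pos_Reals_mult: "x \<in> pos_Reals \<Longrightarrow> y \<in> pos_Reals \<Longrightarrow> x * y \<in> pos_Reals"
  by (auto simp: pos_Reals_def simp flip: of_real_mult)

lemma set_integral_pos_Reals:
  fixes f :: "real \<Rightarrow> complex"
  assumes f: "set_integrable lborel A f" and A: "open A" "A \<noteq> {}"
    and pos: "\<And>x. x \<in> A \<Longrightarrow> f x \<in> pos_Reals"
  shows "(LINT x:A|lborel. f x) \<in> pos_Reals"
proof -
  let ?g = "\<lambda>x::real. indicator A x * Re (f x)"
  have Re_pos: "Re (f x) > 0" "f x = of_real (Re (f x))" if "x \<in> A" for x
    using pos[OF that] by (auto simp: pos_Reals_def)
  have "integrable lborel (\<lambda>x. Re (indicator A x *\<^sub>R f x))"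
    using f unfolding set_integrable_def by (rule integrable_Re)
  then have g: "integrable lborel ?g"
    by simp
  have g_nonneg: "?g x \<ge> 0" for x
    using Re_pos(1)[of x] by (auto simp: indicator_def)
  have "(LINT x|lborel. ?g x) \<noteq> 0"
  proof
    assume "(LINT x|lborel. ?g x) = 0"
    then have "AE x in lborel. ?g x = 0"
      using integral_nonneg_eq_0_iff_AE[OF g] g_nonneg by simp
    then have "AE x in lborel. x \<notin> A"
      by (rule AE_mp) (rule AE_I2, use Re_pos(1) in \<open>force simp: indicator_def\<close>)
    then have "A \<in> null_sets lborel"
      using AE_iff_null_sets[of A lborel] A(1) by simp
    then show False
      using open_not_negligible[OF A] by (simp add: negligible_iff_null_sets null_sets_completionI)
  qed
  moreover have "(LINT x|lborel. ?g x) \<ge> 0"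
    by (intro integral_nonneg_AE AE_I2 g_nonneg)
  ultimately have "(LINT x:A|lborel. Re (f x)) > 0"
    by (simp add: set_lebesgue_integral_def)
  moreover have "(LINT x:A|lborel. f x) = of_real (LINT x:A|lborel. Re (f x))"
    unfolding set_integral_complex_of_real[symmetric] by (rule set_integral_cong) (rule Re_pos)
  ultimately show ?thesis
    by (simp only: of_real_in_pos_Reals_iff)
qed

lemma terminant_pos:
  assumes "p > 0" "q > 0"
  shows "terminant p (of_real q) \<in> pos_Reals"
  unfolding terminant_def
proof (rule set_integral_pos_Reals[OF terminant_integrable])
  show "gamma_weight (of_real p) u / (1 + of_real u * of_real q) \<in> pos_Reals" if "u \<in> {0<..}" for u
  proof -
    have "gamma_weight (of_real p) u / (1 + of_real u * of_real q) =
        of_real (u powr (p - 1) * exp (- u) / (1 + u * q))"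
      using that by (simp add: gamma_weight_of_real)
    then show ?thesis
      using that assms by (simp only: of_real_in_pos_Reals_iff) (simp add: add_pos_pos)
  qed
qed (use assms in auto)

lemma terminant_beta_pos:
  assumes m: "\<bar>m\<bar> < p" and y: "y > 0"
  shows "terminant_beta p (of_real m) (of_real y) \<in> pos_Reals"
  unfolding terminant_beta_def
proof (rule set_integral_pos_Reals)
  show "set_integrable lborel {0<..<1}
      (\<lambda>r. beta_weight (of_real p + of_real m) (of_real p - of_real m) r *
      terminant p (of_real (2 * r * (1 - r)) * of_real y))"
    by (rule terminant_beta_integrable) (use m y in auto)
  fix r :: real assume r: "r \<in> {0<..<1}"
  have "beta_weight (of_real p + of_real m) (of_real p - of_real m) r \<in> pos_Reals"
    using r beta_weight_of_real[OF r, of "p + m" "p - m"]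
      of_real_in_pos_Reals_iff[of "r powr (p + m - 1) * (1 - r) powr (p - m - 1)"] by simp
  moreover have "terminant p (of_real (2 * r * (1 - r)) * of_real y) \<in> pos_Reals"
    using terminant_pos[of p "2 * r * (1 - r) * y"] r m y by simp
  ultimately show "beta_weight (of_real p + of_real m) (of_real p - of_real m) r *
      terminant p (of_real (2 * r * (1 - r)) * of_real y) \<in> pos_Reals"
    by (rule pos_Reals_mult)
qed auto

lemma legendre_rem_sign:
  fixes m n x :: real
  assumes m: "\<bar>m\<bar> < real N + 1/2" and n: "n > real N - 1/2" and x: "x > 0"
  obtains r where "r > 0"
    "legendre_rem N (of_real x) (of_real m) (of_real n) = of_real ((-1) ^ N * cos (pi * m) * r)"
proof -
  let ?w = "gamma_weight (of_real n - of_nat N + 1/2)"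
  have "(LINT t:{0<..}|lborel. ?w t *
        terminant_beta (real N + 1/2) (of_real m) (of_real x / of_real t)) \<in> pos_Reals"
  proof (rule set_integral_pos_Reals)
    show "set_integrable lborel {0<..}
        (\<lambda>t. ?w t * terminant_beta (real N + 1/2) (of_real m) (of_real x / of_real t))"
      by (rule legendre_rem_integrable) (use m n x in auto)
    fix t :: real assume t: "t \<in> {0<..}"
    have "?w t \<in> pos_Reals"
      using t gamma_weight_of_real[of t "n - real N + 1/2"]
        of_real_in_pos_Reals_iff[of "t powr (n - real N + 1/2 - 1) * exp (- t)"] by simp
    moreover have "terminant_beta (real N + 1/2) (of_real m) (of_real x / of_real t) \<in> pos_Reals"
      using terminant_beta_pos[OF m, of "x / t"] x t by simp
    ultimately show "?w t *
        terminant_beta (real N + 1/2) (of_real m) (of_real x / of_real t) \<in> pos_Reals"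
      by (rule pos_Reals_mult)
  qed auto
  then obtain r where r: "r > 0" "(LINT t:{0<..}|lborel. ?w t *
      terminant_beta (real N + 1/2) (of_real m) (of_real x / of_real t)) = of_real r"
    by (auto simp: pos_Reals_def)
  have "legendre_rem N (of_real x) (of_real m) (of_real n) =
      of_real ((-1) ^ N * cos (pi * m) * (2 ^ N / pi powr (3/2) * x ^ N * r))"
    unfolding legendre_rem_def r(2) cos_pi_of_real by (simp add: power_minus[of 2])
  moreover have "2 ^ N / pi powr (3/2) * x ^ N * r > 0"
    using r x by simp
  ultimately show ?thesis
    using that by blast
qed

lemma legendre_R2_real:
  fixes x m n :: real
  assumes x: "x > 0" and m: "\<bar>m\<bar> < real M + 1/2" and n: "n > real M - 1/2"
  defines "R \<equiv> legendre_R2 M (of_real x) (of_real m) (of_real n)"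
    and "T \<equiv> P2_term M (of_real x) (of_real m) (of_real n)"
  shows "R \<in> \<real>" and "norm R \<le> norm T" and "sgn (Re R) = sgn (Re T)"
proof -
  define X where "X = exp x / sinh x"
  define K where "K = a_cos_ratio M m * Gamma (n - real M + 1/2) * X ^ M"
  have arg: "legendre_arg (of_real x) = of_real X"
    by (simp add: legendre_arg_def X_def sinh_of_real_complex exp_of_real)
  have X: "X > 0"
    using x by (simp add: X_def)
  have K: "K > 0"
    using n X a_cos_ratio_pos[OF m] by (simp add: K_def Gamma_real_pos)
  have "Gamma (complex_of_real n - of_nat M + 1/2) = of_real (Gamma (n - real M + 1/2))"
    using Gamma_complex_of_real[of "n - real M + 1/2"] by simp
  then have T_eq: "T = of_real ((-1) ^ M * cos (pi * m) * K)"
    unfolding T_def P2_term_def arg[unfolded legendre_arg_def] a_coeff_of_real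
      a_coeff_eq_a_cos_ratio[OF m]
    by (simp add: K_def)
  obtain r where r: "r > 0" "R = of_real ((-1) ^ M * cos (pi * m) * r)"
    using legendre_rem_sign[OF m n X] unfolding R_def legendre_R2_def arg by blast
  show "R \<in> \<real>"
    unfolding r(2) by (rule Reals_of_real)
  show "sgn (Re R) = sgn (Re T)"
    using r K unfolding T_eq by (simp add: sgn_mult)
  have "norm R \<le> legendre_rem_bound M (legendre_arg (of_real x)) (of_real m) (of_real n)"
    unfolding R_def by (rule norm_legendre_R2_le) (use m n x in \<open>auto simp: D1_def\<close>)
  also have "\<dots> = norm T"
    using K X a_cos_ratio_pos[OF m] n
    unfolding T_eq arg legendre_rem_bound_def cos_pi_of_real norm_of_real
    by (simp add: K_def abs_mult power_abs)
  finally show "norm R \<le> norm T" .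
qed

theorem theorem3p1:
  shows "\<exists>R1 R2 :: nat \<Rightarrow> complex \<Rightarrow> complex \<Rightarrow> complex \<Rightarrow> complex.
    (\<forall>\<xi>\<in>D1. \<forall>N M. \<forall>\<mu> \<nu>.
       \<bar>Re \<mu>\<bar> < min (real N + 1/2) (real M + 1/2) \<longrightarrow>
       Re \<nu> > max (real N - 1/2) (real M - 1/2) \<longrightarrow>
         legendre_P \<nu> \<mu> (cosh \<xi>) =
           exp ((\<nu> + 1/2) * \<xi>) / (Gamma (\<nu> - \<mu> + 1) * csqrt (2 * of_real pi * sinh \<xi>)) *
             ((\<Sum>n<N. P1_term n \<xi> \<mu> \<nu>) + R1 N \<xi> \<mu> \<nu>) +
           C_coeff \<xi> \<mu> * exp (- (\<nu> + 1/2) * \<xi>) /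
               (Gamma (\<nu> - \<mu> + 1) * csqrt (2 * of_real pi * sinh \<xi>)) *
             ((\<Sum>m<M. P2_term m \<xi> \<mu> \<nu>) + R2 M \<xi> \<mu> \<nu>) \<and>
         norm (R1 N \<xi> \<mu> \<nu>) \<le>
           norm (cos (of_real pi * \<mu>)) * a_cos_ratio N (Re \<mu>) * Gamma (Re \<nu> - real N + 1/2) *
             norm (exp (- \<xi>) / sinh \<xi>) ^ N * P1_factor N \<xi> \<and>
         norm (R2 M \<xi> \<mu> \<nu>) \<le>
           norm (cos (of_real pi * \<mu>)) * a_cos_ratio M (Re \<mu>) * Gamma (Re \<nu> - real M + 1/2) *
             norm (exp \<xi> / sinh \<xi>) ^ M) \<and>
    (\<forall>M. \<forall>x \<mu> \<nu> :: real.
       x > 0 \<longrightarrow> \<bar>\<mu>\<bar> < real M + 1/2 \<longrightarrow> \<nu> > real M - 1/2 \<longrightarrow>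
         R2 M (of_real x) (of_real \<mu>) (of_real \<nu>) \<in> \<real> \<and>
         norm (R2 M (of_real x) (of_real \<mu>) (of_real \<nu>)) \<le>
           norm (P2_term M (of_real x) (of_real \<mu>) (of_real \<nu>)) \<and>
         sgn (Re (R2 M (of_real x) (of_real \<mu>) (of_real \<nu>))) =
           sgn (Re (P2_term M (of_real x) (of_real \<mu>) (of_real \<nu>))))"
proof (rule exI[of _ legendre_R1], rule exI[of _ legendre_R2], intro conjI ballI allI impI)
  fix \<xi> N M \<mu> \<nu>
  assume \<xi>: "\<xi> \<in> D1" and "\<bar>Re \<mu>\<bar> < min (real N + 1/2) (real M + 1/2)"
    "Re \<nu> > max (real N - 1/2) (real M - 1/2)"
  then have N: "\<bar>Re \<mu>\<bar> < real N + 1/2" "Re \<nu> > real N - 1/2"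
    and M: "\<bar>Re \<mu>\<bar> < real M + 1/2" "Re \<nu> > real M - 1/2"
    by simp_all
  show "legendre_P \<nu> \<mu> (cosh \<xi>) =
      exp ((\<nu> + 1/2) * \<xi>) / (Gamma (\<nu> - \<mu> + 1) * csqrt (2 * of_real pi * sinh \<xi>)) *
        ((\<Sum>n<N. P1_term n \<xi> \<mu> \<nu>) + legendre_R1 N \<xi> \<mu> \<nu>) +
      C_coeff \<xi> \<mu> * exp (- (\<nu> + 1/2) * \<xi>) / (Gamma (\<nu> - \<mu> + 1) * csqrt (2 * of_real pi * sinh \<xi>)) *
        ((\<Sum>m<M. P2_term m \<xi> \<mu> \<nu>) + legendre_R2 M \<xi> \<mu> \<nu>)"
    by (rule legendre_P_expansion[OF \<xi> N M])
  show "norm (legendre_R1 N \<xi> \<mu> \<nu>) \<le> norm (cos (of_real pi * \<mu>)) * a_cos_ratio N (Re \<mu>) *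
      Gamma (Re \<nu> - real N + 1/2) * norm (exp (- \<xi>) / sinh \<xi>) ^ N * P1_factor N \<xi>"
    using norm_legendre_R1_le[OF N \<xi>]
    by (simp add: legendre_rem_bound_def legendre_arg_def norm_divide)
  show "norm (legendre_R2 M \<xi> \<mu> \<nu>) \<le> norm (cos (of_real pi * \<mu>)) * a_cos_ratio M (Re \<mu>) *
      Gamma (Re \<nu> - real M + 1/2) * norm (exp \<xi> / sinh \<xi>) ^ M"
    using norm_legendre_R2_le[OF M \<xi>] by (simp add: legendre_rem_bound_def legendre_arg_def)
qed (rule legendre_R2_real; assumption)+

end
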